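(* Under the limit conditions $$\epsilon\to0^+,\quad N\to+\infty,\quad N\epsilon\to+\infty,\quad N\epsilon^2\to\nu>0,$$ for $x\in\mathbb R^+$, $t\ge0$ and $j\in D$, the density $f(x,j,t)$ of the limit process satisfies the partial differential equation $$\frac{\partial}{\partial t}f(x,j,t)=-\frac{\partial}{\partial x}\Big\{[-\alpha(x-\beta)]f(x,j,t)\Big\}+\frac12\sigma^2\frac{\partial^2}{\partial x^2}f(x,j,t)-\xi f(x,j,t),$$ with the initial condition $f(x,j,0)=\delta(x)\,\delta_{j,l_0}$, $x\in\{0\}\cup\mathbb R^+$, $j\in D$ (where $\delta(x)$ is the Dirac delta function and $\delta_{j,l_0}$ the Kronecker delta), and the boundary condition $$\sum_{l\in D}\left\{\alpha\beta f(0,l,t)-\frac{\sigma^2}{2}\frac{\partial}{\partial x}f(x,l,t)\Big|_{x=0}\right\}-\xi=0,$$ where $\sigma^2=\alpha\nu$ and $\beta=\gamma\nu/\alpha$. Moreover, for all $j\in D$, $$f(0,j,t)=\sum_{l\in D}c_{l,j}f(0,l,t),\qquad\lim_{x\to+\infty}f(x,j,t)=0.$$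
   Context: Let $N,d$ be positive integers, $D=\{1,\dots,d\}$, $\lambda,\mu,\xi>0$, and let $\mathbf C=(c_{l,j})_{l,j\in D}$ be an irreducible stochastic matrix. The process $\mathbf X_t=(\mathcal N(t),J(t))$, $t\ge 0$, is the continuous-time Markov chain on $\{0,1,\dots,N\}\times D$ (first coordinate: level; second coordinate: phase) started at $(0,l_0)$ for some $l_0\in D$, with the following transition rates: from $(0,l)$ to $(1,j)$ at rate $c_{l,j}\lambda N$ for $l,j\in D$; from $(k,j)$ to $(k+1,j)$ at rate $\lambda(N-k)$ for $1\le k\le N-1$; from $(k,j)$ to $(k-1,j)$ at rate $\mu(N+k)$ for $1\le k\le N$; and, in addition, from $(k,j)$ to $(0,j)$ at rate $\xi$ for $1\le k\le N$ (catastrophe; for $k=1$ the total rate from $(1,j)$ to $(0,j)$ is $\mu(N+1)+\xi$). No other transitions occur. Write $p(k,j,t)=P\{(\mathcal N(t),J(t))=(k,j)\mid(\mathcal N(0),J(0))=(0,l_0)\}$. Diffusion scaling: for $\alpha>0$, $\gamma>0$, $\epsilon>0$ take $\lambda=\frac\alpha2+\frac\gamma2\epsilon$ and $\mu=\frac\alpha2-\frac\gamma2\epsilon$, and consider the scaled process $(\mathcal N^*_\epsilon(t),J(t))$ with $\mathcal N^*_\epsilon(t)=\epsilon\,\mathcal N(t)$, the zero states of all phases being identified with a single common state $0$. In the limit $\epsilon\to0^+$ this process tends to a process $\mathcal X=(\mathcal Z(t),J(t))$ on the star graph $\{0\}\cup(\mathbb R^+\times D)$ ($d$ half-lines joined at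 the origin), whose density $f$ is defined by the asymptotic relations, with $x=k\epsilon$: $p(0,l,t)=P\{\mathcal N^*_\epsilon(t)=0,J(t)=l\mid\cdot\}$ tends to $P\{0\le\mathcal Z(t)<\epsilon,J(t)=l\mid(\mathcal Z(0),J(0))=(0,l_0)\}=f(0,l,t)\epsilon+o(\epsilon)$, and $p(k,j,t)=P\{\mathcal N^*_\epsilon(t)=k\epsilon,J(t)=j\mid\cdot\}$ tends to $P\{x\le\mathcal Z(t)<x+\epsilon,J(t)=j\mid(\mathcal Z(0),J(0))=(0,l_0)\}=f(x,j,t)\epsilon+o(\epsilon)$, i.e. $p(k,j,t)\approx f(k\epsilon,j,t)\,\epsilon$. Here $f(x,j,t)$ is the density at state $x$ of the $j$-th ray at time $t$, $f$ being assumed smooth enough for the stated derivatives to make sense. *)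

theory Defs
  imports "HOL-Probability.Probability"
begin

text \<open>
  The phases are \<open>D = {1..d}\<close>. A state of the chain is a pair \<open>(level, phase)\<close> of naturals, and
  matrices on \<open>D\<close> are functions \<open>nat \<Rightarrow> nat \<Rightarrow> real\<close> of which only the entries with indices in
  \<open>D\<close> matter.
\<close>

definition stochastic_matrix :: "nat \<Rightarrow> (nat \<Rightarrow> nat \<Rightarrow> real) \<Rightarrow> bool" where
  "stochastic_matrix d C \<longleftrightarrow>
     (\<forall>l\<in>{1..d}. \<forall>j\<in>{1..d}. 0 \<le> C l j) \<and> (\<forall>l\<in>{1..d}. (\<Sum>j\<in>{1..d}. C l j) = 1)"

definition irreducible_matrix :: "nat \<Rightarrow> (nat \<Rightarrow> nat \<Rightarrow> real) \<Rightarrow> bool" where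
  "irreducible_matrix d C \<longleftrightarrow>
     (\<forall>l\<in>{1..d}. \<forall>j\<in>{1..d}. (l, j) \<in> {(a, b). a \<in> {1..d} \<and> b \<in> {1..d} \<and> C a b > 0}\<^sup>+)"


section \<open>Continuous-time Markov chains with finitely many states\<close>

text \<open>
  \<open>P t x\<close> is the law at time \<open>t\<close> of the chain started at \<open>x\<close>, and \<open>q x y\<close> (for \<open>x \<noteq> y\<close>) is the
  transition rate from \<open>x\<close> to \<open>y\<close>. Since \<open>S\<close> is finite, the diagonal of the generator is determined
  by the off-diagonal rates.
\<close>

definition transition_semigroup ::
    "'s set \<Rightarrow> ('s \<Rightarrow> 's \<Rightarrow> real) \<Rightarrow> (real \<Rightarrow> 's \<Rightarrow> 's pmf) \<Rightarrow> bool" where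
  "transition_semigroup S q P \<longleftrightarrow>
     finite S \<and>
     (\<forall>x\<in>S. P 0 x = return_pmf x) \<and>
     (\<forall>x\<in>S. \<forall>t\<ge>0. set_pmf (P t x) \<subseteq> S) \<and>
     (\<forall>x\<in>S. \<forall>s\<ge>0. \<forall>t\<ge>0. P (s + t) x = bind_pmf (P s x) (P t)) \<and>
     (\<forall>x\<in>S. \<forall>y\<in>S. x \<noteq> y \<longrightarrow> ((\<lambda>h. pmf (P h x) y / h) \<longlongrightarrow> q x y) (at_right 0))"

definition markov_chain ::
    "'w measure \<Rightarrow> (real \<Rightarrow> 'w \<Rightarrow> 's) \<Rightarrow> 's set \<Rightarrow> ('s \<Rightarrow> 's \<Rightarrow> real) \<Rightarrow> 's \<Rightarrow> bool" where
  "markov_chain M X S q x0 \<longleftrightarrow>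
     prob_space M \<and> x0 \<in> S \<and>
     (\<forall>t\<ge>0. X t \<in> M \<rightarrow>\<^sub>M count_space S) \<and>
     (\<exists>P. transition_semigroup S q P \<and>
        (\<forall>(n::nat) (t :: nat \<Rightarrow> real) x.
           t 0 = 0 \<and> (\<forall>i<n. t i \<le> t (Suc i)) \<and> (\<forall>i\<le>n. x i \<in> S) \<longrightarrow>
           measure M {w \<in> space M. \<forall>i\<le>n. X (t i) w = x i} =
             (if x 0 = x0 then 1 else 0) *
             (\<Prod>i<n. pmf (P (t (Suc i) - t i) (x i)) (x (Suc i)))))"


section \<open>The level--phase chain with catastrophes\<close>

definition states :: "nat \<Rightarrow> nat \<Rightarrow> (nat \<times> nat) set" where
  "states d N = {0..N} \<times> {1..d}"

text \<open>
  The contributions are added up, so that the rate from \<open>(1, j)\<close> to \<open>(0, j)\<close> is \<open>\<mu> (N + 1) + \<xi>\<close>.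
\<close>

definition rate ::
    "nat \<Rightarrow> (nat \<Rightarrow> nat \<Rightarrow> real) \<Rightarrow> real \<Rightarrow> real \<Rightarrow> real \<Rightarrow> nat \<times> nat \<Rightarrow> nat \<times> nat \<Rightarrow> real" where
  "rate N C lam mu \<xi> = (\<lambda>(k, l) (m, j).
     (if k = 0 \<and> m = 1 then C l j * lam * real N else 0) +
     (if 1 \<le> k \<and> k < N \<and> m = k + 1 \<and> j = l then lam * (real N - real k) else 0) +
     (if 1 \<le> k \<and> k \<le> N \<and> m + 1 = k \<and> j = l then mu * (real N + real k) else 0) +
     (if 1 \<le> k \<and> k \<le> N \<and> m = 0 \<and> j = l then \<xi> else 0))"


section \<open>The limit process and its density\<close>

text \<open>
  The scaled chains \<open>(eps n * level, phase)\<close> tend in law, at every time, to \<open>(Z, J)\<close>. The phases are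
  kept apart in the test functions.
\<close>

definition tends_in_law ::
    "nat \<Rightarrow> (nat \<Rightarrow> real) \<Rightarrow> (nat \<Rightarrow> 'w measure) \<Rightarrow> (nat \<Rightarrow> real \<Rightarrow> 'w \<Rightarrow> nat \<times> nat) \<Rightarrow>
     'v measure \<Rightarrow> (real \<Rightarrow> 'v \<Rightarrow> real) \<Rightarrow> (real \<Rightarrow> 'v \<Rightarrow> nat) \<Rightarrow> bool" where
  "tends_in_law d eps M X W Z J \<longleftrightarrow>
     (\<forall>t\<ge>0. \<forall>j\<in>{1..d}. \<forall>\<phi> :: real \<Rightarrow> real.
        continuous_on UNIV \<phi> \<and> bounded (range \<phi>) \<longrightarrow>
        (\<lambda>n. LINT w|M n. (if snd (X n t w) = j then \<phi> (eps n * real (fst (X n t w))) else 0))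
          \<longlonglongrightarrow> (LINT w|W. (if J t w = j then \<phi> (Z t w) else 0)))"

text \<open>
  The two asymptotic relations defining the density \<open>f\<close>: \<open>P (x \<le> Z t < x + h, J t = j) = f x j t h + o(h)\<close>
  as \<open>h\<close> tends to 0, and \<open>p (k, j, t) = f x j t eps + o(eps)\<close> for the lattice point \<open>k eps\<close> at \<open>x\<close>,
  that is, \<open>k = \<lfloor>x / eps\<rfloor>\<close>; both are pointwise in \<open>(x, j, t)\<close>. The pair \<open>x = 0\<close>, \<open>t = 0\<close> is left
  out, because the initial law has an atom there.
\<close>

definition limit_density ::
    "nat \<Rightarrow> (nat \<Rightarrow> real) \<Rightarrow> (nat \<Rightarrow> 'w measure) \<Rightarrow> (nat \<Rightarrow> real \<Rightarrow> 'w \<Rightarrow> nat \<times> nat) \<Rightarrow>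
     'v measure \<Rightarrow> (real \<Rightarrow> 'v \<Rightarrow> real) \<Rightarrow> (real \<Rightarrow> 'v \<Rightarrow> nat) \<Rightarrow>
     (real \<Rightarrow> nat \<Rightarrow> real \<Rightarrow> real) \<Rightarrow> bool" where
  "limit_density d eps M X W Z J f \<longleftrightarrow>
     (\<forall>x\<ge>0. \<forall>t\<ge>0. \<forall>j\<in>{1..d}. (x, t) \<noteq> (0, 0) \<longrightarrow>
        ((\<lambda>h. measure W {w \<in> space W. x \<le> Z t w \<and> Z t w < x + h \<and> J t w = j} / h)
           \<longlongrightarrow> f x j t) (at_right 0) \<and>
        (\<lambda>n. measure (M n) {w \<in> space (M n). X n t w = (nat \<lfloor>x / eps n\<rfloor>, j)} / eps n)
           \<longlonglongrightarrow> f x j t)"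

text \<open>Derivative of a function on the half-line \<open>[0, \<infinity>)\<close>; it is one-sided at 0.\<close>

definition hderiv :: "(real \<Rightarrow> real) \<Rightarrow> real \<Rightarrow> real" where
  "hderiv g x = vector_derivative g (at x within {0..})"

text \<open>
  \<open>f\<close> is once continuously differentiable in \<open>t\<close> and twice in \<open>x\<close> in the open rays (from the right
  in \<open>t\<close> at \<open>t = 0\<close>), and \<open>f\<close> and its first \<open>x\<close>-derivative are continuous up to the vertex \<open>x = 0\<close>
  for \<open>t > 0\<close>. Nothing is required at \<open>x = 0\<close>, \<open>t = 0\<close>.
\<close>

definition smooth_on_rays :: "nat \<Rightarrow> (real \<Rightarrow> nat \<Rightarrow> real \<Rightarrow> real) \<Rightarrow> bool" where
  "smooth_on_rays d f \<longleftrightarrow> (\<forall>j\<in>{1..d}.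
     (\<forall>x\<ge>0. \<forall>t\<ge>0. (x, t) \<noteq> (0, 0) \<longrightarrow>
        (\<lambda>y. f y j t) differentiable (at x within {0..})) \<and>
     (\<forall>x>0. \<forall>t\<ge>0.
        (\<lambda>s. f x j s) differentiable (at t within {0..}) \<and>
        hderiv (\<lambda>y. f y j t) differentiable (at x within {0..})) \<and>
     continuous_on ({0..} \<times> {0..} - {(0, 0)}) (\<lambda>(x, t). f x j t) \<and>
     continuous_on ({0..} \<times> {0..} - {(0, 0)}) (\<lambda>(x, t). hderiv (\<lambda>y. f y j t) x) \<and>
     continuous_on ({0<..} \<times> {0..}) (\<lambda>(x, t). hderiv (\<lambda>s. f x j s) t) \<and>
     continuous_on ({0<..} \<times> {0..}) (\<lambda>(x, t). hderiv (hderiv (\<lambda>y. f y j t)) x))"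

text \<open>
  Meaning of \<open>f x j 0 = \<delta>(x) \<delta>\<^bsub>j,l0\<^esub>\<close>. At time 0 the law of the process is the point mass at
  \<open>(0, l0)\<close>, so \<open>f x j 0 = 0\<close> for \<open>x > 0\<close>; and for \<open>t\<close> tending to 0 from the right the densities
  \<open>f x j t\<close> tend weakly to the point mass at the vertex, on the star graph, whose continuous
  functions \<open>(\<phi> j)\<close> agree at \<open>x = 0\<close>. The limit cannot be taken ray by ray: for \<open>d \<ge> 2\<close> the process
  leaves the vertex through all rays immediately.
\<close>

definition dirac_initial_condition ::
    "nat \<Rightarrow> nat \<Rightarrow> 'v measure \<Rightarrow> (real \<Rightarrow> 'v \<Rightarrow> real) \<Rightarrow> (real \<Rightarrow> 'v \<Rightarrow> nat) \<Rightarrow>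
     (real \<Rightarrow> nat \<Rightarrow> real \<Rightarrow> real) \<Rightarrow> bool" where
  "dirac_initial_condition d l0 W Z J f \<longleftrightarrow>
     (\<forall>j\<in>{1..d}. \<forall>A\<in>sets borel.
        measure W {w \<in> space W. Z 0 w \<in> A \<and> J 0 w = j} =
          measure (return borel 0) A * (if j = l0 then 1 else 0)) \<and>
     (\<forall>j\<in>{1..d}. \<forall>x>0. f x j 0 = 0) \<and>
     (\<forall>(\<phi> :: nat \<Rightarrow> real \<Rightarrow> real) c.
        (\<forall>j\<in>{1..d}. continuous_on {0..} (\<phi> j) \<and> bounded (\<phi> j ` {0..}) \<and> \<phi> j 0 = c) \<longrightarrow>
        ((\<lambda>t. \<Sum>j\<in>{1..d}. LINT x:{0..}|lborel. \<phi> j x * f x j t) \<longlongrightarrow> c) (at_right 0))"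

end

theory Submission
  imports Defs
begin

text \<open>
  Kolmogorov's forward equation for the chain, applied to \<open>C\<^sup>2\<close> cutoff functions that vanish near the
  vertex, passes to the limit by the convergence in law and shows that the masses
  \<open>T a t = P (Z t > a, J t = j)\<close> satisfy
  \<open>T a t - T a s = \<integral>\<^bsub>s\<^esub>\<^bsup>t\<^esup> (- B a r - \<xi> T a r) dr\<close>, where
  \<open>B x t = \<alpha> (x - \<beta>) f x j t + \<sigma>\<^sup>2/2 f\<^sub>x x j t\<close>. Differentiating in \<open>t\<close> and \<open>a\<close> gives the differential
  equation; summing over the rays and letting \<open>a\<close> tend to 0 gives the boundary condition, because the
  total mass is 1. The balance of the phases at the vertex holds because the phase changes only in jumps
  out of level 0, at a rate \<open>\<lambda> N\<close> that is large compared with \<open>1 / \<epsilon>\<close>. Finally, the probability flux from each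
  level to the next one is nonnegative, so that beyond the level \<open>\<beta> / \<epsilon>\<close> the level probabilities decrease; as
  they sum to at most 1, \<open>f x j t \<le> 1 / (x - \<beta>)\<close>.
\<close>

section \<open>The forward equation\<close>

text \<open>The lattice limits in \<open>limit_density\<close> are pointwise in
  \<open>(x, j, t)\<close> and come without domination, so they cannot simply be inserted in the
  forward equation. Convergence in law carries the equation inside the rays, and \<open>f\<close>
  enters afterwards, as the density of the law of the limit. The cutoffs must vanish at levels 0 and
  1 because jumps out of level 0 mix the phases at a rate of order \<open>1 / eps^2\<close>; with
  value 0 at the vertex, a catastrophe contributes just \<open>- \<xi>\<close> times the cutoff. The
  equations are integrated in time, as convergence in law at fixed times says nothing about time
  derivatives. The vertex is reached only as a limit along the rays and for positive times, since
  \<open>f\<close> is unconstrained at \<open>x = 0\<close>, \<open>t = 0\<close>. Lattice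
  probabilities are used in two places: the phase balance at the vertex, where Baire's theorem
  supplies the missing domination, and the decay at infinity, which continuity and integrability of
  \<open>f\<close> would not give and which rests on a bound for the chain itself.\<close>

lemma semigroup_has_derivative:
  assumes TS: "transition_semigroup S q P" and x: "x \<in> S" and t: "t \<ge> 0"
  shows "((\<lambda>t. \<Sum>y\<in>S. g y * pmf (P t x) y) has_real_derivative
           (\<Sum>z\<in>S. pmf (P t x) z * (\<Sum>y\<in>S. q z y * (g y - g z)))) (at t within {0..})"
proof -
  have fin: "finite S"
    and P0: "\<And>z. z \<in> S \<Longrightarrow> P 0 z = return_pmf z"
    and supp: "\<And>h z. z \<in> S \<Longrightarrow> h \<ge> 0 \<Longrightarrow> set_pmf (P h z) \<subseteq> S"
    and ck: "\<And>s h z. z \<in> S \<Longrightarrow> s \<ge> 0 \<Longrightarrow> h \<ge> 0 \<Longrightarrow> P (s + h) z = bind_pmf (P s z) (P h)"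
    and rt: "\<And>z y. z \<in> S \<Longrightarrow> y \<in> S \<Longrightarrow> z \<noteq> y \<Longrightarrow> ((\<lambda>h. pmf (P h z) y / h) \<longlongrightarrow> q z y) (at_right 0)"
    using TS by (simp_all add: transition_semigroup_def)
  define Q where "Q g h z = (\<Sum>y\<in>S. g y * pmf (P h z) y)" for g :: "'a \<Rightarrow> real" and h z
  have one: "(\<Sum>y\<in>S. pmf (P h z) y) = 1" if "z \<in> S" "h \<ge> 0" for h z
    using sum_pmf_eq_1[OF fin supp[OF that]] .
  have Q0: "Q g 0 z = g z" if "z \<in> S" for g z
    unfolding Q_def using that fin by (simp add: P0 indicator_def of_bool_def if_distrib[of "\<lambda>u. g _ * u"] cong: if_cong)
  have diff: "Q g h z - g z = (\<Sum>y\<in>S. pmf (P h z) y * (g y - g z))" if "z \<in> S" "h \<ge> 0" for g h z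
  proof -
    have "g z = (\<Sum>y\<in>S. pmf (P h z) y * g z)"
      using one[OF that] by (simp flip: sum_distrib_right)
    then show ?thesis unfolding Q_def
      by (simp add: algebra_simps sum_subtractf)
  qed
  have lim: "((\<lambda>h. (Q g h z - g z) / h) \<longlongrightarrow> (\<Sum>y\<in>S. q z y * (g y - g z))) (at_right 0)" if z: "z \<in> S" for g z
  proof -
    have "((\<lambda>h. (\<Sum>y\<in>S. pmf (P h z) y / h * (g y - g z))) \<longlongrightarrow> (\<Sum>y\<in>S. q z y * (g y - g z))) (at_right 0)"
    proof (rule tendsto_sum)
      fix y assume y: "y \<in> S"
      show "((\<lambda>h. pmf (P h z) y / h * (g y - g z)) \<longlongrightarrow> q z y * (g y - g z)) (at_right 0)"
      \<comment> \<open>\<open>transition_semigroup\<close> prescribes no diagonal rate; none is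
        needed, because the factor \<open>g y - g z\<close> is 0 there.\<close>
      proof (cases "z = y")
        case False
        show ?thesis by (intro tendsto_intros rt z y False)
      qed simp
    qed
    moreover have "\<forall>\<^sub>F h in at_right (0::real). (\<Sum>y\<in>S. pmf (P h z) y / h * (g y - g z)) = (Q g h z - g z) / h"
      using eventually_at_right_less[of "0::real"]
      by eventually_elim (simp add: diff[OF z] sum_divide_distrib)
    ultimately show ?thesis by (rule Lim_transform_eventually)
  qed
  have lim0: "((\<lambda>h. Q g h z) \<longlongrightarrow> g z) (at_right 0)" if z: "z \<in> S" for g z
  proof -
    have "((\<lambda>h. (Q g h z - g z) / h * h + g z) \<longlongrightarrow> (\<Sum>y\<in>S. q z y * (g y - g z)) * 0 + g z) (at_right 0)"
      by (intro tendsto_intros lim z)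
    moreover have "\<forall>\<^sub>F h in at_right (0::real). (Q g h z - g z) / h * h + g z = Q g h z"
      using eventually_at_right_less[of "0::real"] by eventually_elim simp
    ultimately show ?thesis by (auto intro: Lim_transform_eventually)
  qed
  have chap: "Q g (s + h) x = (\<Sum>z\<in>S. pmf (P s x) z * Q g h z)" if "s \<ge> 0" "h \<ge> 0" for g s h
  proof -
    have "pmf (P (s + h) x) y = (\<Sum>z\<in>S. pmf (P h z) y * pmf (P s x) z)" for y
      unfolding ck[OF x that] pmf_bind
      using supp[OF x that(1)] by (intro integral_measure_pmf_real fin) auto
    then have "Q g (s + h) x = (\<Sum>y\<in>S. \<Sum>z\<in>S. g y * (pmf (P h z) y * pmf (P s x) z))"
      unfolding Q_def by (simp add: sum_distrib_left)
    also have "\<dots> = (\<Sum>z\<in>S. \<Sum>y\<in>S. g y * (pmf (P h z) y * pmf (P s x) z))"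
      by (rule sum.swap)
    finally show ?thesis unfolding Q_def by (simp add: sum_distrib_left algebra_simps)
  qed
  have incr: "Q g (s + h) x - Q g s x = (\<Sum>z\<in>S. pmf (P s x) z * (Q g h z - g z))" if "s \<ge> 0" "h \<ge> 0" for g s h
    unfolding chap[OF that] Q_def[of g s] by (simp add: algebra_simps sum_subtractf)
  let ?D = "\<Sum>z\<in>S. pmf (P t x) z * (\<Sum>y\<in>S. q z y * (g y - g z))"
  have right: "((\<lambda>y. (Q g y x - Q g t x) / (y - t)) \<longlongrightarrow> ?D) (at_right t)"
  proof -
    have "((\<lambda>h. \<Sum>z\<in>S. pmf (P t x) z * ((Q g h z - g z) / h)) \<longlongrightarrow> ?D) (at_right 0)"
      by (intro tendsto_intros lim)
    moreover have "\<forall>\<^sub>F h in at_right (0::real). (\<Sum>z\<in>S. pmf (P t x) z * ((Q g h z - g z) / h)) =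
        (Q g (h + t) x - Q g t x) / (h + t - t)"
      using eventually_at_right_less[of "0::real"]
    proof eventually_elim
      case (elim h)
      show ?case using incr[OF t, of h g] elim by (simp add: sum_divide_distrib add.commute)
    qed
    ultimately show ?thesis
      unfolding filterlim_at_right_to_0[of _ _ t] by (rule Lim_transform_eventually)
  qed
  show ?thesis
  proof (cases "t = 0")
    case True
    have "at 0 within {0::real..} = at_right 0"
      by (metis at_within_Icc_at_right at_within_Ici_at_right)
    then show ?thesis using right True
      unfolding has_field_derivative_iff Q_def by simp
  next
    case False
    then have tp: "t > 0" using t by simp
    have ev: "\<forall>\<^sub>F h in at_right (0::real). 0 < h \<and> h < t"
      using tp by (intro eventually_at_rightI[of 0 t]) auto
    \<comment> \<open>The backward quotient is a mean under the law at \<open>t - h\<close>, which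
      moves with \<open>h\<close>. Left continuity of that law follows because an increment over a
      time \<open>h\<close> is at most \<open>\<Sum>z\<in>S. \<bar>Q g h z - g z\<bar>\<close>,
      whatever the starting time.\<close>
    have cont: "((\<lambda>h. Q g (t - h) x) \<longlongrightarrow> Q g t x) (at_right 0)" for g
    proof -
      have "((\<lambda>h. Q g t x - Q g (t - h) x) \<longlongrightarrow> 0) (at_right 0)"
      proof (rule tendsto_0_le[where K = 1])
        show "((\<lambda>h. \<Sum>z\<in>S. \<bar>Q g h z - g z\<bar>) \<longlongrightarrow> 0) (at_right 0)"
          by (rule tendsto_null_sum) (auto intro!: tendsto_rabs_zero LIM_zero lim0)
        show "\<forall>\<^sub>F h in at_right 0. norm (Q g t x - Q g (t - h) x) \<le> norm (\<Sum>z\<in>S. \<bar>Q g h z - g z\<bar>) * 1"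
          using ev
        proof eventually_elim
          case (elim h)
          have "\<bar>Q g t x - Q g (t - h) x\<bar> \<le> (\<Sum>z\<in>S. \<bar>pmf (P (t - h) x) z * (Q g h z - g z)\<bar>)"
            using incr[of "t - h" h g] elim by (simp add: sum_abs)
          also have "\<dots> \<le> (\<Sum>z\<in>S. \<bar>Q g h z - g z\<bar>)"
            by (intro sum_mono) (simp add: abs_mult mult_left_le_one_le pmf_le_1)
          finally show ?case by (simp add: sum_nonneg)
        qed
      qed
      from tendsto_diff[OF tendsto_const[of "Q g t x"] this] show ?thesis by simp
    qed
    have pcont: "((\<lambda>h. pmf (P (t - h) x) z) \<longlongrightarrow> pmf (P t x) z) (at_right 0)" if "z \<in> S" for z
    proof -
      have "Q (\<lambda>y. if y = z then 1 else 0) h x = pmf (P h x) z" for h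
        unfolding Q_def using that fin by (simp add: if_distrib[of "\<lambda>u. u * _"] cong: if_cong)
      then show ?thesis using cont[of "\<lambda>y. if y = z then 1 else 0"] by simp
    qed
    have left: "((\<lambda>y. (Q g y x - Q g t x) / (y - t)) \<longlongrightarrow> ?D) (at_left t)"
    proof -
      have "((\<lambda>h. \<Sum>z\<in>S. pmf (P (t - h) x) z * ((Q g h z - g z) / h)) \<longlongrightarrow> ?D) (at_right 0)"
        by (intro tendsto_intros lim pcont)
      moreover have "\<forall>\<^sub>F h in at_right (0::real). (\<Sum>z\<in>S. pmf (P (t - h) x) z * ((Q g h z - g z) / h)) =
          (Q g (- (h + - t)) x - Q g t x) / (- (h + - t) - t)"
        using ev
      proof eventually_elim
        case (elim h)
        have "(\<Sum>z\<in>S. pmf (P (t - h) x) z * ((Q g h z - g z) / h)) = (Q g t x - Q g (t - h) x) / h"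
          using incr[of "t - h" h g] elim by (simp add: sum_divide_distrib)
        then show ?case using elim by (simp add: field_simps)
      qed
      ultimately show ?thesis
        unfolding filterlim_at_left_to_right[of _ _ t] filterlim_at_right_to_0[of _ _ "- t"]
        by (rule Lim_transform_eventually)
    qed
    have "at t within {0..} = at t" using tp by (intro at_within_interior) (simp add: interior_real_atLeast)
    then show ?thesis using filterlim_split_at[OF left right]
      unfolding has_field_derivative_iff Q_def by simp
  qed
qed

text \<open>The finite-dimensional formula always includes time 0. With \<open>n = 0\<close> it
  shows that \<open>X 0 = x0\<close> almost surely; hence for \<open>n = 1\<close> the joint
  probability of \<open>x0\<close> at 0 and \<open>y\<close> at \<open>t\<close> is already the
  marginal at \<open>t\<close>.\<close>

lemma markov_chain_semigroup:
  assumes "markov_chain M X S q x0"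
  obtains P where "transition_semigroup S q P"
    and "\<And>t y. t \<ge> 0 \<Longrightarrow> y \<in> S \<Longrightarrow> measure M {w \<in> space M. X t w = y} = pmf (P t x0) y"
proof -
  interpret prob_space M using assms by (simp add: markov_chain_def)
  have x0: "x0 \<in> S" and meas: "\<And>t. t \<ge> 0 \<Longrightarrow> X t \<in> M \<rightarrow>\<^sub>M count_space S"
    using assms by (simp_all add: markov_chain_def)
  have "\<exists>P. transition_semigroup S q P \<and>
        (\<forall>(n::nat) (t :: nat \<Rightarrow> real) x.
           t 0 = 0 \<and> (\<forall>i<n. t i \<le> t (Suc i)) \<and> (\<forall>i\<le>n. x i \<in> S) \<longrightarrow>
           measure M {w \<in> space M. \<forall>i\<le>n. X (t i) w = x i} =
             (if x 0 = x0 then 1 else 0) *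
             (\<Prod>i<n. pmf (P (t (Suc i) - t i) (x i)) (x (Suc i))))"
    using assms unfolding markov_chain_def by (elim conjE)
  then obtain P where TS: "transition_semigroup S q P" and
    fdd: "\<And>(n::nat) (t :: nat \<Rightarrow> real) x. t 0 = 0 \<and> (\<forall>i<n. t i \<le> t (Suc i)) \<and> (\<forall>i\<le>n. x i \<in> S) \<Longrightarrow>
           measure M {w \<in> space M. \<forall>i\<le>n. X (t i) w = x i} =
             (if x 0 = x0 then 1 else 0) *
             (\<Prod>i<n. pmf (P (t (Suc i) - t i) (x i)) (x (Suc i)))"
    by (elim exE conjE) (rule that, auto)
  have ev: "{w \<in> space M. X t w = y} \<in> sets M" if "t \<ge> 0" "y \<in> S" for t y
    using measurable_sets[OF meas[OF that(1)], of "{y}"] that(2)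
    by (simp add: vimage_def Int_def conj_commute)
  have "measure M {w \<in> space M. X 0 w = x0} = 1"
    using fdd[of "\<lambda>_. 0" 0 "\<lambda>_. x0"] x0 by simp
  then have ae: "AE w in M. X 0 w = x0"
    using prob_Collect_eq_1[of "\<lambda>w. X 0 w = x0"] ev[of 0 x0] x0 by simp
  show thesis
  proof (rule that[OF TS])
    fix t :: real and y assume t: "t \<ge> 0" and y: "y \<in> S"
    have two: "(\<forall>i\<le>1. R i) \<longleftrightarrow> R 0 \<and> R 1" for R :: "nat \<Rightarrow> bool"
      by (auto simp: le_Suc_eq)
    have "{w \<in> space M. \<forall>i\<le>(1::nat). X (if i = 0 then 0 else t) w = (if i = 0 then x0 else y)} =
       {w \<in> space M. X 0 w = x0} \<inter> {w \<in> space M. X t w = y}" (is "?E = _")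
      unfolding two by auto
    then have "measure M {w \<in> space M. X t w = y} = measure M ?E"
      by (intro measure_eq_AE) (use ae ev[OF t y] ev[of 0 x0] x0 in auto)
    also have "\<dots> = pmf (P t x0) y"
      using fdd[of "\<lambda>i. if i = 0 then 0 else t" 1 "\<lambda>i. if i = 0 then x0 else y"] t x0 y by (simp del: One_nat_def add: two)
    finally show "measure M {w \<in> space M. X t w = y} = pmf (P t x0) y" .
  qed
qed

lemma markov_chain_forward:
  assumes mc: "markov_chain M X S q x0" and t: "t \<ge> 0"
  shows "((\<lambda>t. \<Sum>y\<in>S. g y * measure M {w \<in> space M. X t w = y}) has_real_derivative
           (\<Sum>z\<in>S. measure M {w \<in> space M. X t w = z} * (\<Sum>y\<in>S. q z y * (g y - g z)))) (at t within {0..})"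
proof -
  obtain P where TS: "transition_semigroup S q P" and
    P: "\<And>t y. t \<ge> 0 \<Longrightarrow> y \<in> S \<Longrightarrow> measure M {w \<in> space M. X t w = y} = pmf (P t x0) y"
    using markov_chain_semigroup[OF mc] by blast
  have x0: "x0 \<in> S" using mc by (simp add: markov_chain_def)
  have eq: "(\<Sum>z\<in>S. measure M {w \<in> space M. X t w = z} * (\<Sum>y\<in>S. q z y * (g y - g z))) =
     (\<Sum>z\<in>S. pmf (P t x0) z * (\<Sum>y\<in>S. q z y * (g y - g z)))"
    by (intro sum.cong) (auto simp: P t)
  show ?thesis unfolding eq
    by (rule has_field_derivative_transform_within[OF semigroup_has_derivative[OF TS x0 t, of g], of 1])
       (use t in \<open>auto simp: P intro!: sum.cong\<close>)
qed

lemma markov_chain_integral: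
  fixes g :: "'s \<Rightarrow> real"
  assumes mc: "markov_chain M X S q x0" and fin: "finite S" and t: "t \<ge> 0"
  shows "(LINT w|M. g (X t w)) = (\<Sum>y\<in>S. g y * measure M {w \<in> space M. X t w = y})"
proof -
  interpret prob_space M using mc by (simp add: markov_chain_def)
  have meas: "X t \<in> M \<rightarrow>\<^sub>M count_space S" using mc t by (simp add: markov_chain_def)
  have ev: "{w \<in> space M. X t w = y} \<in> sets M" if "y \<in> S" for y
    using measurable_sets[OF meas, of "{y}"] that
    by (simp add: vimage_def Int_def conj_commute)
  have "(LINT w|M. g (X t w)) = (LINT w|M. (\<Sum>y\<in>S. g y * indicator {w \<in> space M. X t w = y} w))"
  proof (rule Bochner_Integration.integral_cong)
    fix w assume w: "w \<in> space M"
    have "X t w \<in> S" using measurable_space[OF meas w] by simp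
    then have "(\<Sum>y\<in>S. g y * indicator {w \<in> space M. X t w = y} w) = (\<Sum>y\<in>S. if y = X t w then g y else 0)"
      using w by (intro sum.cong) (auto simp: indicator_def)
    then show "g (X t w) = (\<Sum>y\<in>S. g y * indicator {w \<in> space M. X t w = y} w)"
      using \<open>X t w \<in> S\<close> fin by (simp add: sum.delta)
  qed simp
  also have "\<dots> = (\<Sum>y\<in>S. LINT w|M. g y * indicator {w \<in> space M. X t w = y} w)"
    by (rule Bochner_Integration.integral_sum)
       (auto intro!: integrable_mult_right integrable_real_indicator ev simp: emeasure_eq_measure)
  also have "\<dots> = (\<Sum>y\<in>S. g y * measure M {w \<in> space M. X t w = y})"
    using ev by (intro sum.cong) (auto intro!: arg_cong2[where f = measure])
  finally show ?thesis .
qed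

lemma markov_chain_prob_sum:
  assumes mc: "markov_chain M X S q x0" and fin: "finite S" and t: "t \<ge> 0"
  shows "(\<Sum>y\<in>S. measure M {w \<in> space M. X t w = y}) = 1"
proof -
  interpret prob_space M using mc by (simp add: markov_chain_def)
  show ?thesis using markov_chain_integral[OF mc fin t, of "\<lambda>_. 1"] by (simp add: prob_space)
qed

lemma markov_chain_start:
  assumes mc: "markov_chain M X S q x0" and y: "y \<in> S"
  shows "measure M {w \<in> space M. X 0 w = y} = (if y = x0 then 1 else 0)"
proof -
  obtain P where TS: "transition_semigroup S q P" and
    P: "\<And>t y. t \<ge> 0 \<Longrightarrow> y \<in> S \<Longrightarrow> measure M {w \<in> space M. X t w = y} = pmf (P t x0) y"
    using markov_chain_semigroup[OF mc] by blast
  have x0: "x0 \<in> S" using mc by (simp add: markov_chain_def)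
  have "P 0 x0 = return_pmf x0" using TS x0 by (simp add: transition_semigroup_def)
  then show ?thesis using P[of 0 y] y by (simp add: indicator_def)
qed

section \<open>The generator of the level--phase chain\<close>

lemma finite_states: "finite (states d N)"
  by (simp add: states_def)

text \<open>The guard \<open>k < N\<close> of \<open>rate\<close> disappears because
  \<open>lam * (N - k)\<close> is 0 at \<open>k = N\<close>; at \<open>k = 1\<close> the downward
  step and the catastrophe have the same target and add up. \<open>N > 0\<close> ensures that level
  1 is among the states.\<close>

lemma sum_rate:
  assumes d: "l \<in> {1..d}" and k: "k \<le> N" and N: "N > 0"
  shows "(\<Sum>y\<in>states d N. rate N C lam mu \<xi> (k, l) y * (g y - g (k, l))) =
    (if k = 0 then lam * real N * (\<Sum>j=1..d. C l j * (g (1, j) - g (0, l)))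
     else lam * (real N - real k) * (g (k + 1, l) - g (k, l)) + mu * (real N + real k) * (g (k - 1, l) - g (k, l))
        + \<xi> * (g (0, l) - g (k, l)))"
proof -
  have "(\<Sum>y\<in>states d N. rate N C lam mu \<xi> (k, l) y * (g y - g (k, l))) =
     (\<Sum>m=0..N. \<Sum>j=1..d. rate N C lam mu \<xi> (k, l) (m, j) * (g (m, j) - g (k, l)))"
    by (simp add: states_def sum.cartesian_product split_def)
  also have "\<dots> = (if k = 0 then lam * real N * (\<Sum>j=1..d. C l j * (g (1, j) - g (0, l)))
     else lam * (real N - real k) * (g (k + 1, l) - g (k, l)) + mu * (real N + real k) * (g (k - 1, l) - g (k, l))
        + \<xi> * (g (0, l) - g (k, l)))"
  proof (cases "k = 0")
    case True
    have "(\<Sum>m=0..N. \<Sum>j=1..d. rate N C lam mu \<xi> (k, l) (m, j) * (g (m, j) - g (k, l))) =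
       (\<Sum>m=0..N. if m = 1 then (\<Sum>j=1..d. C l j * lam * real N * (g (1, j) - g (0, l))) else 0)"
      using True by (intro sum.cong) (auto simp: rate_def)
    also have "\<dots> = (\<Sum>j=1..d. C l j * lam * real N * (g (1, j) - g (0, l)))"
      using N by (simp add: sum.delta)
    finally show ?thesis using True by (simp add: sum_distrib_left algebra_simps)
  next
    case False
    have "(\<Sum>j=1..d. rate N C lam mu \<xi> (k, l) (m, j) * (g (m, j) - g (k, l))) =
        (\<Sum>j=1..d. if j = l then rate N C lam mu \<xi> (k, l) (m, l) * (g (m, l) - g (k, l)) else 0)" for m
      using False by (intro sum.cong) (auto simp: rate_def)
    then have inner: "(\<Sum>j=1..d. rate N C lam mu \<xi> (k, l) (m, j) * (g (m, j) - g (k, l))) =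
       rate N C lam mu \<xi> (k, l) (m, l) * (g (m, l) - g (k, l))" for m
      using d by (simp add: sum.delta)
    have "(\<Sum>m=0..N. rate N C lam mu \<xi> (k, l) (m, l) * (g (m, l) - g (k, l))) =
      (\<Sum>m=0..N. (if m = k + 1 then lam * (real N - real k) * (g (k + 1, l) - g (k, l)) else 0)
       + (if m = k - 1 then mu * (real N + real k) * (g (k - 1, l) - g (k, l)) else 0)
       + (if m = 0 then \<xi> * (g (0, l) - g (k, l)) else 0))"
      using False k by (intro sum.cong) (auto simp: rate_def algebra_simps)
    also have "\<dots> = lam * (real N - real k) * (g (k + 1, l) - g (k, l)) + mu * (real N + real k) * (g (k - 1, l) - g (k, l))
        + \<xi> * (g (0, l) - g (k, l))"
      using False k by (auto simp: sum.distrib sum.delta)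
    finally show ?thesis unfolding inner using False by simp
  qed
  finally show ?thesis .
qed

section \<open>Positivity of the flux between levels\<close>

text \<open>The exponent is at least 2, so the kink of the positive part at 0 is smoothed out.
  Needed for squared negative parts and for the pieces of the spline.\<close>

lemma max0_power_has_derivative:
  "((\<lambda>u::real. max 0 u ^ Suc (Suc n)) has_real_derivative (real (Suc (Suc n)) * max 0 u ^ Suc n)) (at u)"
proof -
  consider "u > 0" | "u < 0" | "u = 0" by linarith
  then show ?thesis
  proof cases
    case 1
    have "((\<lambda>u::real. u ^ Suc (Suc n)) has_real_derivative (real (Suc (Suc n)) * u ^ Suc n)) (at u)"
      using DERIV_pow[of "Suc (Suc n)" u] by simp
    then have "((\<lambda>u::real. max 0 u ^ Suc (Suc n)) has_real_derivative (real (Suc (Suc n)) * u ^ Suc n)) (at u)"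
      by (rule has_field_derivative_transform_within_open[of _ _ _ "{0<..}"]) (use 1 in auto)
    then show ?thesis using 1 by simp
  next
    case 2
    have "((\<lambda>u::real. 0) has_real_derivative 0) (at u)" by simp
    then have "((\<lambda>u::real. max 0 u ^ Suc (Suc n)) has_real_derivative 0) (at u)"
      by (rule has_field_derivative_transform_within_open[of _ _ _ "{..<0}"]) (use 2 in auto)
    then show ?thesis using 2 by simp
  next
    case 3
    have "((\<lambda>h::real. max 0 h ^ Suc (Suc n) / h) \<longlongrightarrow> 0) (at 0)"
    proof (rule tendsto_0_le[where K = 1])
      show "((\<lambda>h::real. \<bar>h\<bar> ^ Suc n) \<longlongrightarrow> 0) (at 0)"
        by (auto intro!: tendsto_eq_intros)
      show "\<forall>\<^sub>F h in at (0::real). norm (max 0 h ^ Suc (Suc n) / h) \<le> norm (\<bar>h\<bar> ^ Suc n) * 1"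
        by (intro always_eventually allI) (auto simp: max_def abs_mult mult_le_0_iff not_le)
    qed
    then show ?thesis using 3 by (simp add: has_field_derivative_iff)
  qed
qed

text \<open>The sum of the squared negative parts satisfies a linear differential inequality.\<close>
lemma quasi_positive_ode_nonneg:
  fixes D :: "'i \<Rightarrow> real \<Rightarrow> real"
  assumes fin: "finite I"
    and A: "\<And>k j. k \<in> I \<Longrightarrow> j \<in> I \<Longrightarrow> k \<noteq> j \<Longrightarrow> A k j \<ge> 0"
    and s: "\<And>k. k \<in> I \<Longrightarrow> s k \<ge> 0"
    and D: "\<And>k t. k \<in> I \<Longrightarrow> t \<ge> 0 \<Longrightarrow> (D k has_real_derivative (\<Sum>j\<in>I. A k j * D j t) + s k) (at t within {0..})"
    and D0: "\<And>k. k \<in> I \<Longrightarrow> D k 0 \<ge> 0"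
    and k: "k \<in> I" and t: "t \<ge> 0"
  shows "D k t \<ge> 0"
proof -
  define m where "m k t = max 0 (- D k t)" for k t
  define E where "E t = (\<Sum>k\<in>I. m k t ^ 2)" for t
  define E' where "E' t = (\<Sum>k\<in>I. 2 * m k t * (- ((\<Sum>j\<in>I. A k j * D j t) + s k)))" for t
  define B where "B = (\<Sum>k\<in>I. \<Sum>j\<in>I. \<bar>A k j\<bar>)"
  define K where "K = 2 * B * real (card I)"
  have dE: "(E has_real_derivative E' t) (at t within {0..})" if "t \<ge> 0" for t
    unfolding E_def E'_def
  proof (rule DERIV_sum)
    fix k assume k: "k \<in> I"
    have "((\<lambda>u::real. max 0 u ^ 2) has_real_derivative (2 * max 0 u)) (at u)" for u
      using max0_power_has_derivative[of 0 u] by (simp add: numeral_2_eq_2)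
    from DERIV_chain2[OF this[of "- D k t"] DERIV_minus[OF D[OF k that]]]
    show "((\<lambda>x. (m k x)\<^sup>2) has_real_derivative 2 * m k t * - ((\<Sum>j\<in>I. A k j * D j t) + s k)) (at t within {0..})"
      unfolding m_def by simp
  qed
  have mD: "- (m k t * D j t) \<le> m k t * m j t" for k j t
    using mult_left_mono[of "- D j t" "m j t" "m k t"] by (simp add: m_def)
  have mm: "- (m k t * D k t) = m k t * m k t" for k t
    by (simp add: m_def max_def)
  have bound: "E' t \<le> K * E t" for t
  proof -
    \<comment> \<open>Off the diagonal \<open>A k j \<ge> 0\<close> and
      \<open>- (m k * D j) \<le> m k * m j\<close>; on the diagonal equality holds, so the sign of
      \<open>A k k\<close> does not matter.\<close>
    have term1: "2 * m k t * (- (A k j * D j t)) \<le> B * (m k t ^ 2 + m j t ^ 2)" if kj: "k \<in> I" "j \<in> I" for k j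
    proof -
      have "2 * m k t * (- (A k j * D j t)) = 2 * (A k j * (- (m k t * D j t)))" by simp
      also have "\<dots> \<le> 2 * (A k j * (m k t * m j t))"
      proof (cases "k = j")
        case True then show ?thesis using mm[of j t] by simp
      next
        case False then show ?thesis using mult_left_mono[OF mD[of k t j] A[OF kj False]] by linarith
      qed
      also have "\<dots> = A k j * (2 * (m k t * m j t))" by simp
      also have "\<dots> \<le> \<bar>A k j\<bar> * (m k t ^ 2 + m j t ^ 2)"
      proof (rule mult_mono)
        show "2 * (m k t * m j t) \<le> m k t ^ 2 + m j t ^ 2"
          using sum_squares_bound[of "m k t" "m j t"] by simp
        show "0 \<le> 2 * (m k t * m j t)" by (simp add: m_def)
      qed simp_all
      also have "\<dots> \<le> B * (m k t ^ 2 + m j t ^ 2)"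
      proof (rule mult_right_mono)
        have "\<bar>A k j\<bar> \<le> (\<Sum>j\<in>I. \<bar>A k j\<bar>)" by (rule member_le_sum) (use fin kj in auto)
        also have "\<dots> \<le> B" unfolding B_def
          by (rule member_le_sum[of k I "\<lambda>k. \<Sum>j\<in>I. \<bar>A k j\<bar>"]) (use fin kj in \<open>auto intro: sum_nonneg\<close>)
        finally show "\<bar>A k j\<bar> \<le> B" .
      qed simp
      finally show ?thesis .
    qed
    have "E' t \<le> (\<Sum>k\<in>I. \<Sum>j\<in>I. B * (m k t ^ 2 + m j t ^ 2))"
      unfolding E'_def
    proof (rule sum_mono)
      fix k assume k: "k \<in> I"
      have "0 \<le> 2 * m k t * s k" using s[OF k] by (simp add: m_def)
      then have "2 * m k t * - ((\<Sum>j\<in>I. A k j * D j t) + s k) \<le> 2 * m k t * - (\<Sum>j\<in>I. A k j * D j t)"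
        by (simp add: algebra_simps)
      also have "\<dots> = (\<Sum>j\<in>I. 2 * m k t * (- (A k j * D j t)))"
        by (simp add: sum_distrib_left sum_negf)
      also have "\<dots> \<le> (\<Sum>j\<in>I. B * (m k t ^ 2 + m j t ^ 2))"
        by (intro sum_mono term1 k)
      finally show "2 * m k t * - ((\<Sum>j\<in>I. A k j * D j t) + s k) \<le> (\<Sum>j\<in>I. B * (m k t ^ 2 + m j t ^ 2))" .
    qed
    also have "\<dots> = K * E t"
      unfolding K_def E_def by (simp add: distrib_left sum.distrib flip: sum_distrib_left) 
    finally show ?thesis .
  qed
  have E0: "E 0 = 0" unfolding E_def using D0 by (auto simp: m_def)
  \<comment> \<open>Gronwall by an integrating factor: \<open>E' \<le> K * E\<close> makes
    \<open>G\<close> nonincreasing, and \<open>G 0 = 0\<close>.\<close>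
  define G where "G u = E u * exp (- (K * u))" for u
  have dG: "(G has_real_derivative (E' u - K * E u) * exp (- (K * u))) (at u within {0..})" if "u \<ge> 0" for u
    unfolding G_def by (auto intro!: derivative_eq_intros dE that simp: algebra_simps)
  have "G t \<le> G 0"
  proof (cases "t = 0")
    case False
    show ?thesis
    proof (rule DERIV_nonpos_imp_decreasing_open[of 0 t G])
      show "0 \<le> t" by (rule t)
      show "\<exists>y. (G has_real_derivative y) (at x) \<and> y \<le> 0" if "0 < x" "x < t" for x
      proof -
        have "at x within {0..} = at x" using that by (intro at_within_interior) simp
        then show ?thesis using dG[of x] that bound[of x] by (auto intro!: mult_nonpos_nonneg)
      qed
      show "continuous_on {0..t} G"
        by (rule continuous_on_subset[of "{0..}"], rule DERIV_continuous_on) (use dG in auto)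
    qed
  qed simp
  then have "E t * exp (- (K * t)) \<le> 0" by (simp add: G_def E0)
  then have "E t \<le> 0" by (simp add: mult_le_0_iff)
  moreover have "m k t ^ 2 \<le> E t" unfolding E_def by (rule member_le_sum) (use fin k in auto)
  ultimately have "m k t ^ 2 \<le> 0" by linarith
  then show ?thesis by (simp add: m_def)
qed

text \<open>Summation by parts in the level: only the fluxes between neighbouring levels appear.\<close>
lemma level_forward:
  fixes P :: "nat \<Rightarrow> real \<Rightarrow> real" and g :: "nat \<Rightarrow> real"
  assumes mc: "markov_chain M X (states d N) (rate N C lam mu \<xi>) x0" and N: "N > 0"
    and C: "stochastic_matrix d C" and t: "t \<ge> 0"
  defines "P \<equiv> \<lambda>k t. \<Sum>j=1..d. measure M {w \<in> space M. X t w = (k, j)}"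
  shows "((\<lambda>t. \<Sum>i\<le>N. g i * P i t) has_real_derivative
     (\<Sum>i<N. (g (Suc i) - g i) * (lam * (real N - real i) * P i t - mu * (real N + real i + 1) * P (Suc i) t))
      + \<xi> * (g 0 - (\<Sum>i\<le>N. g i * P i t))) (at t within {0..})"
proof -
  define p where "p z t = measure M {w \<in> space M. X t w = z}" for z t
  have P: "P k t = (\<Sum>j=1..d. p (k, j) t)" for k t unfolding P_def p_def ..
  have sp: "(\<Sum>y\<in>states d N. h (fst y) * p y t) = (\<Sum>i\<le>N. h i * P i t)" for h t
    using sum.cartesian_product[of "\<lambda>i j. h i * p (i, j) t" "{1..d}" "{..N}"]
    by (simp add: states_def P sum_distrib_left split_def atLeast0AtMost)
  have one: "(\<Sum>i\<le>N. P i t) = 1"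
    using markov_chain_prob_sum[OF mc finite_states t] sp[of "\<lambda>_. 1" t] by (simp add: p_def)
  \<comment> \<open>At \<open>i = 0\<close> truncated subtraction turns the downward term into 0 and
    the catastrophe term cancels, so one formula serves all levels. The row sums of \<open>C\<close>
    being 1 removes the phase.\<close>
  define G where "G i = lam * (real N - real i) * (g (Suc i) - g i) + mu * (real N + real i) * (g (i - 1) - g i)
        + \<xi> * (g 0 - g i)" for i
  have gen: "(\<Sum>y\<in>states d N. rate N C lam mu \<xi> z y * (g (fst y) - g (fst z))) = G (fst z)" if z: "z \<in> states d N" for z
  proof -
    obtain k l where kl: "z = (k, l)" "k \<le> N" "l \<in> {1..d}" using z by (auto simp: states_def)
    have "(\<Sum>j=1..d. C l j) = 1" using C kl by (auto simp: stochastic_matrix_def)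
    then have "(\<Sum>j=1..d. C l j * c) = c" for c by (simp flip: sum_distrib_right)
    then show ?thesis using sum_rate[OF kl(3,2) N, of C lam mu \<xi> "\<lambda>y. g (fst y)"]
      by (simp add: kl G_def)
  qed
  have "(\<Sum>z\<in>states d N. p z t * (\<Sum>y\<in>states d N. rate N C lam mu \<xi> z y * (g (fst y) - g (fst z)))) =
     (\<Sum>z\<in>states d N. G (fst z) * p z t)"
    by (intro sum.cong) (auto simp: gen)
  also have "\<dots> = (\<Sum>i\<le>N. G i * P i t)" by (rule sp)
  also have "\<dots> = (\<Sum>i\<le>N. lam * (real N - real i) * (g (Suc i) - g i) * P i t)
      + (\<Sum>i\<le>N. mu * (real N + real i) * (g (i - 1) - g i) * P i t)
      + \<xi> * (g 0 * (\<Sum>i\<le>N. P i t) - (\<Sum>i\<le>N. g i * P i t))"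
    unfolding G_def by (simp add: algebra_simps sum.distrib sum_subtractf sum_distrib_left)
  also have "(\<Sum>i\<le>N. lam * (real N - real i) * (g (Suc i) - g i) * P i t) =
     (\<Sum>i<N. lam * (real N - real i) * (g (Suc i) - g i) * P i t)"
    by (simp add: lessThan_Suc_atMost[symmetric])
  also have "(\<Sum>i\<le>N. mu * (real N + real i) * (g (i - 1) - g i) * P i t) =
     (\<Sum>i<N. mu * (real N + real i + 1) * (g i - g (Suc i)) * P (Suc i) t)"
    by (subst sum.atMost_shift) (simp add: add_ac)
  also have "(\<Sum>i<N. lam * (real N - real i) * (g (Suc i) - g i) * P i t) +
     (\<Sum>i<N. mu * (real N + real i + 1) * (g i - g (Suc i)) * P (Suc i) t) =
     (\<Sum>i<N. (g (Suc i) - g i) * (lam * (real N - real i) * P i t - mu * (real N + real i + 1) * P (Suc i) t))"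
    by (simp add: algebra_simps flip: sum.distrib)
  finally show ?thesis
    using markov_chain_forward[OF mc t, of "\<lambda>y. g (fst y)"]
    by (simp add: sp[of g] one flip: p_def)
qed

text \<open>The fluxes are themselves expectations of functions of the level, and so solve a closed linear system.\<close>
lemma level_flux_nonneg:
  assumes mc: "markov_chain M X (states d N) (rate N C lam mu \<xi>) (0, l0)" and N: "N > 0"
    and C: "stochastic_matrix d C" and t: "t \<ge> 0"
    and pos: "lam \<ge> 0" "mu \<ge> 0" "\<xi> \<ge> 0" and k: "k < N"
  defines "P \<equiv> \<lambda>k t. \<Sum>j=1..d. measure M {w \<in> space M. X t w = (k, j)}"
  shows "mu * (real N + real k + 1) * P (Suc k) t \<le> lam * (real N - real k) * P k t"
proof -
  define D where "D k t = lam * (real N - real k) * P k t - mu * (real N + real k + 1) * P (Suc k) t" for k t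
  \<comment> \<open>Chosen so that the mean of \<open>g k\<close> over the level is the flux
    \<open>D k\<close> from level \<open>k\<close> to level \<open>k + 1\<close>.\<close>
  define g where "g k i = (if i = k then lam * (real N - real k) else 0) -
      (if i = Suc k then mu * (real N + real k + 1) else 0)" for k i
  have gD: "(\<Sum>i\<le>N. g k i * P i t) = D k t" if "k < N" for k t
  proof -
    have "(\<Sum>i\<le>N. g k i * P i t) = (\<Sum>i\<le>N. (if i = k then lam * (real N - real k) * P k t else 0)
        - (if i = Suc k then mu * (real N + real k + 1) * P (Suc k) t else 0))"
      by (intro sum.cong) (auto simp: g_def)
    also have "\<dots> = D k t" using that by (simp add: sum_subtractf sum.delta D_def)
    finally show ?thesis .
  qed
  \<comment> \<open>Apart from \<open>j = k\<close>, the difference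
    \<open>g k (Suc j) - g k j\<close> is nonzero only for \<open>j + 1 = k\<close>, with value
    \<open>lam * (N - k)\<close>, and for \<open>j = k + 1\<close>, with value
    \<open>mu * (N + k + 1)\<close>. Both are nonnegative, so the system is quasi-positive.\<close>
  define A where "A k i = g k (Suc i) - g k i - (if i = k then \<xi> else 0)" for k i
  have "D k t \<ge> 0"
  proof (rule quasi_positive_ode_nonneg[where I = "{..<N}" and A = A and D = D and s = "\<lambda>k. \<xi> * g k 0"])
    show "A k j \<ge> 0" if "k \<in> {..<N}" "j \<in> {..<N}" "k \<noteq> j" for k j
      using that pos by (auto simp: A_def g_def intro!: mult_nonneg_nonneg)
    show "\<xi> * g k 0 \<ge> 0" if "k \<in> {..<N}" for k
      using that pos by (auto simp: g_def intro!: mult_nonneg_nonneg)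
    show "D k 0 \<ge> 0" if "k \<in> {..<N}" for k
    proof -
      have "P (Suc k) 0 = 0" unfolding P_def
        by (rule sum.neutral) (use markov_chain_start[OF mc] that in \<open>auto simp: states_def\<close>)
      then show ?thesis using that pos
        by (auto simp: D_def P_def intro!: mult_nonneg_nonneg sum_nonneg)
    qed
    show "(D k has_real_derivative (\<Sum>j<N. A k j * D j t) + \<xi> * g k 0) (at t within {0..})"
      if "k \<in> {..<N}" "t \<ge> 0" for k t
    proof -
      have k: "k < N" using that by simp
      have eq: "(\<Sum>j<N. A k j * D j t) = (\<Sum>j<N. (g k (Suc j) - g k j) * D j t) - \<xi> * D k t"
      proof -
        have "(\<Sum>j<N. A k j * D j t) = (\<Sum>j<N. (g k (Suc j) - g k j) * D j t - (if j = k then \<xi> * D k t else 0))"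
          by (intro sum.cong) (auto simp: A_def algebra_simps)
        then show ?thesis using k by (simp add: sum_subtractf sum.delta)
      qed
      have "((\<lambda>t. \<Sum>i\<le>N. g k i * P i t) has_real_derivative
          (\<Sum>i<N. (g k (Suc i) - g k i) * D i t) + \<xi> * (g k 0 - (\<Sum>i\<le>N. g k i * P i t))) (at t within {0..})"
        using level_forward[OF mc N C that(2), of "g k"] unfolding D_def P_def .
      then show ?thesis unfolding gD[OF k] eq right_diff_distrib by (simp add: add_diff_eq add.commute diff_add_eq)
    qed
  qed (use k t in auto)
  then show ?thesis by (simp add: D_def)
qed

text \<open>The condition on \<open>m\<close> says \<open>lam * (N - m) \<le> mu * (N + m)\<close>:
  from \<open>m\<close> on, the upward rate does not exceed the downward one, and a nonnegative flux
  then forces \<open>P (Suc i) t \<le> P i t\<close>. So \<open>P k t\<close> is at most each of the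
  \<open>k - m\<close> terms with indices from \<open>m\<close> to \<open>k - 1\<close>, and these
  sum to at most 1.\<close>

lemma level_tail_bound:
  assumes mc: "markov_chain M X (states d N) (rate N C lam mu \<xi>) (0, l0)" and N: "N > 0"
    and C: "stochastic_matrix d C" and t: "t \<ge> 0"
    and pos: "lam \<ge> 0" "mu > 0" "\<xi> \<ge> 0"
    and m: "(lam - mu) * real N \<le> (lam + mu) * real m" and k: "m \<le> k" and j: "j \<in> {1..d}"
  shows "(real k - real m) * measure M {w \<in> space M. X t w = (k, j)} \<le> 1"
proof -
  define P where "P k t = (\<Sum>j=1..d. measure M {w \<in> space M. X t w = (k, j)})" for k t
  interpret prob_space M using mc by (simp add: markov_chain_def)
  have meas: "X t \<in> M \<rightarrow>\<^sub>M count_space (states d N)" using mc t by (simp add: markov_chain_def)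
  have Pnn: "P k t \<ge> 0" for k by (simp add: P_def sum_nonneg)
  have P0: "P i t = 0" if "i > N" for i
  proof -
    have "{w \<in> space M. X t w = (i, j)} = {}" for j
      using measurable_space[OF meas] that by (fastforce simp: states_def)
    then show ?thesis by (simp add: P_def del: Collect_empty_eq)
  qed
  have step: "P (Suc i) t \<le> P i t" if "i \<ge> m" for i
  proof (cases "i < N")
    case True
    have "(lam + mu) * real m \<le> (lam + mu) * real i" using that pos by (intro mult_left_mono) auto
    then have "lam * (real N - real i) \<le> mu * (real N + real i + 1)"
      using m pos by (simp add: algebra_simps)
    then have "lam * (real N - real i) * P i t \<le> mu * (real N + real i + 1) * P i t"
      using Pnn by (rule mult_right_mono)
    then have "mu * (real N + real i + 1) * P (Suc i) t \<le> mu * (real N + real i + 1) * P i t"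
      using level_flux_nonneg[OF mc N C t _ _ _ True, folded P_def] pos by linarith
    moreover have "mu * (real N + real i + 1) > 0" using pos by (intro mult_pos_pos) auto
    ultimately show ?thesis by (simp add: mult_le_cancel_left_pos)
  next
    case False then show ?thesis using P0[of "Suc i"] Pnn by simp
  qed
  have anti: "P b t \<le> P a t" if "m \<le> a" "a \<le> b" for a b
    using that(2) by (induction rule: dec_induct) (use step that(1) in \<open>auto intro: order_trans\<close>)
  have one: "(\<Sum>i\<le>N. P i t) = 1"
    using markov_chain_prob_sum[OF mc finite_states t]
    using sum.cartesian_product[of "\<lambda>i j. measure M {w \<in> space M. X t w = (i, j)}" "{1..d}" "{..N}"]
    by (simp add: P_def states_def split_def atLeast0AtMost)
  have "measure M {w \<in> space M. X t w = (k, j)} \<le> P k t"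
    unfolding P_def by (rule member_le_sum[of j "{1..d}" "\<lambda>j. measure M {w \<in> space M. X t w = (k, j)}"]) (use j in auto)
  then have "(real k - real m) * measure M {w \<in> space M. X t w = (k, j)} \<le> (real k - real m) * P k t"
    using k by (intro mult_left_mono) auto
  also have "\<dots> = (\<Sum>i\<in>{m..<k}. P k t)" using k by simp
  also have "\<dots> \<le> (\<Sum>i\<in>{m..<k}. P i t)" by (intro sum_mono anti) auto
  also have "\<dots> \<le> (\<Sum>i\<in>{..max N k}. P i t)" by (intro sum_mono2) (auto simp: Pnn)
  also have "\<dots> = (\<Sum>i\<le>N. P i t)" by (intro sum.mono_neutral_right) (auto simp: P0)
  finally show ?thesis by (simp add: one)
qed

section \<open>Test functions and the limit of the generators\<close>

text \<open>
  A cubic spline: third differences of \<open>max 0 u ^ 3 / 6\<close>, hence 0 for \<open>u \<le> 0\<close> and 1 for \<open>u \<ge> 3\<close>.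
\<close>
definition spline :: "real \<Rightarrow> real" where
  "spline u = (max 0 u ^ 3 - 3 * max 0 (u - 1) ^ 3 + 3 * max 0 (u - 2) ^ 3 - max 0 (u - 3) ^ 3) / 6"

definition spline' :: "real \<Rightarrow> real" where
  "spline' u = (max 0 u ^ 2 - 3 * max 0 (u - 1) ^ 2 + 3 * max 0 (u - 2) ^ 2 - max 0 (u - 3) ^ 2) / 2"

definition spline'' :: "real \<Rightarrow> real" where
  "spline'' u = max 0 u - 3 * max 0 (u - 1) + 3 * max 0 (u - 2) - max 0 (u - 3)"

lemma spline_derivs:
  "(spline has_real_derivative spline' u) (at u)"
  "(spline' has_real_derivative spline'' u) (at u)"
proof -
  have 3: "((\<lambda>u::real. max 0 (u - c) ^ 3) has_real_derivative 3 * max 0 (u - c) ^ 2) (at u)" for c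
  proof -
    have "((\<lambda>u::real. max 0 u ^ 3) has_real_derivative 3 * max 0 v ^ 2) (at v)" for v
      using max0_power_has_derivative[of 1 v] by (simp add: numeral_eq_Suc)
    from DERIV_chain2[where f = "\<lambda>u. max 0 u ^ 3" and g = "\<lambda>u. u - c" and Db = 1, OF this]
    show ?thesis by (simp add: DERIV_ident[THEN DERIV_diff[OF _ DERIV_const], simplified])
  qed
  have 2: "((\<lambda>u::real. max 0 (u - c) ^ 2) has_real_derivative 2 * max 0 (u - c)) (at u)" for c
  proof -
    have "((\<lambda>u::real. max 0 u ^ 2) has_real_derivative 2 * max 0 v) (at v)" for v
      using max0_power_has_derivative[of 0 v] by (simp add: numeral_eq_Suc)
    from DERIV_chain2[where f = "\<lambda>u. max 0 u ^ 2" and g = "\<lambda>u. u - c" and Db = 1, OF this]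
    show ?thesis by (simp add: DERIV_ident[THEN DERIV_diff[OF _ DERIV_const], simplified])
  qed
  show "(spline has_real_derivative spline' u) (at u)"
    unfolding spline_def[abs_def] spline'_def
    by (rule DERIV_cong[OF DERIV_cdivide[OF DERIV_diff[OF DERIV_add[OF DERIV_diff[OF 3[of 0, simplified]
      DERIV_cmult[OF 3[of 1]]] DERIV_cmult[OF 3[of 2]]] 3[of 3]]]]) simp
  show "(spline' has_real_derivative spline'' u) (at u)"
    unfolding spline'_def[abs_def] spline''_def
    by (rule DERIV_cong[OF DERIV_cdivide[OF DERIV_diff[OF DERIV_add[OF DERIV_diff[OF 2[of 0, simplified]
      DERIV_cmult[OF 2[of 1]]] DERIV_cmult[OF 2[of 2]]] 2[of 3]]]]) simp
qed

lemma spline_eq: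
  "u \<le> 0 \<Longrightarrow> spline u = 0" "u \<ge> 3 \<Longrightarrow> spline u = 1"
  "u \<le> 0 \<or> u \<ge> 3 \<Longrightarrow> spline' u = 0" "u \<le> 0 \<or> u \<ge> 3 \<Longrightarrow> spline'' u = 0"
proof -
  have "spline u = 0 \<and> spline' u = 0 \<and> spline'' u = 0" if "u \<le> 0"
    using that by (simp add: spline_def spline'_def spline''_def max_absorb1)
  moreover have "spline u = 1 \<and> spline' u = 0 \<and> spline'' u = 0" if "u \<ge> 3"
  proof -
    have m: "max 0 u = u" "max 0 (u - 1) = u - 1" "max 0 (u - 2) = u - 2" "max 0 (u - 3) = u - 3"
      using that by simp_all
    show ?thesis unfolding spline_def spline'_def spline''_def m
      by (simp add: power2_eq_square power3_eq_cube algebra_simps)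
  qed
  ultimately show "u \<le> 0 \<Longrightarrow> spline u = 0" "u \<ge> 3 \<Longrightarrow> spline u = 1"
    "u \<le> 0 \<or> u \<ge> 3 \<Longrightarrow> spline' u = 0" "u \<le> 0 \<or> u \<ge> 3 \<Longrightarrow> spline'' u = 0" by blast+
qed

text \<open>Each positive part is 1-Lipschitz; 8 is the sum of the absolute weights 1, 3, 3,
  1.\<close>

lemma spline''_lipschitz: "\<bar>spline'' u - spline'' v\<bar> \<le> 8 * \<bar>u - v\<bar>"
proof -
  have "\<bar>max 0 (u - c) - max 0 (v - c)\<bar> \<le> \<bar>u - v\<bar>" for c :: real by linarith
  note m = this[of 0, unfolded diff_0_right] this[of 1] this[of 2] this[of 3]
  have "\<bar>(a - 3 * b + 3 * c - d) - (a' - 3 * b' + 3 * c' - d')\<bar> \<le> 8 * t"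
    if "\<bar>a - a'\<bar> \<le> t" "\<bar>b - b'\<bar> \<le> t" "\<bar>c - c'\<bar> \<le> t" "\<bar>d - d'\<bar> \<le> t" for a b c d a' b' c' d' t :: real
    using that unfolding abs_le_iff by linarith
  from this[OF m] show ?thesis unfolding spline''_def .
qed

text \<open>Crude constants, of which only finiteness matters. On \<open>{0..3}\<close> every
  positive part is at most 3, whence \<open>8 * 27 / 6 = 36\<close> and
  \<open>8 * 9 / 2 = 36\<close>; the bound \<open>24 = 8 * 3\<close> is the Lipschitz estimate
  against the zero at 0.\<close>

lemma spline_bounds: "\<bar>spline u\<bar> \<le> 36" "\<bar>spline' u\<bar> \<le> 36" "\<bar>spline'' u\<bar> \<le> 24"
proof -
  have 2: "\<bar>spline'' u\<bar> \<le> 24" for u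
    using spline''_lipschitz[of u 0] spline''_lipschitz[of u 3] spline_eq(4)[of u] spline_eq(4)[of 0] spline_eq(4)[of 3]
    by (cases "u \<le> 0 \<or> u \<ge> 3") auto
  then show "\<bar>spline'' u\<bar> \<le> 24" .
  have p3: "0 \<le> max 0 (u - c) ^ 3 \<and> max 0 (u - c) ^ 3 \<le> 27" if "0 \<le> u" "u \<le> 3" "c \<ge> 0" for c :: real
    using power_mono[of "max 0 (u - c)" 3 3] that by auto
  have p2: "0 \<le> max 0 (u - c) ^ 2 \<and> max 0 (u - c) ^ 2 \<le> 9" if "0 \<le> u" "u \<le> 3" "c \<ge> 0" for c :: real
    using power_mono[of "max 0 (u - c)" 3 2] that by auto
  have "\<bar>spline u\<bar> \<le> 36 \<and> \<bar>spline' u\<bar> \<le> 36"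
  proof (cases "u \<le> 0 \<or> u \<ge> 3")
    case False
    then have u: "0 \<le> u" "u \<le> 3" by auto
    have alt: "\<bar>a - 3 * b + 3 * c - d\<bar> \<le> 8 * s"
      if "0 \<le> a \<and> a \<le> s" "0 \<le> b \<and> b \<le> s" "0 \<le> c \<and> c \<le> s" "0 \<le> d \<and> d \<le> s" for a b c d s :: real
      using that unfolding abs_le_iff by linarith
    note z = order_refl[of "0::real"] zero_le_one[where 'a = real] zero_le_numeral[where 'a = real, of "num.Bit0 num.One"]
      zero_le_numeral[where 'a = real, of "num.Bit1 num.One"]
    show ?thesis
      using alt[OF p3[OF u z(1), unfolded diff_0_right] p3[OF u z(2)] p3[OF u z(3)] p3[OF u z(4)]]
        alt[OF p2[OF u z(1), unfolded diff_0_right] p2[OF u z(2)] p2[OF u z(3)] p2[OF u z(4)]]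
      by (simp add: spline_def spline'_def)
  qed (use spline_eq[of u] in auto)
  then show "\<bar>spline u\<bar> \<le> 36" "\<bar>spline' u\<bar> \<le> 36" by auto
qed

text \<open>A smooth substitute for the indicator of \<open>{a<..}\<close>: it goes from 0 at
  \<open>a\<close> to 1 at \<open>a + 3 * w\<close>, and \<open>w\<close> is sent to 0 later. The
  primed versions are its first two derivatives.\<close>

definition cutoff :: "real \<Rightarrow> real \<Rightarrow> real \<Rightarrow> real" where "cutoff a w x = spline ((x - a) / w)"
definition cutoff' :: "real \<Rightarrow> real \<Rightarrow> real \<Rightarrow> real" where "cutoff' a w x = spline' ((x - a) / w) / w"
definition cutoff'' :: "real \<Rightarrow> real \<Rightarrow> real \<Rightarrow> real" where "cutoff'' a w x = spline'' ((x - a) / w) / w\<^sup>2"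

lemma cutoff_derivs:
  assumes "w > 0"
  shows "(cutoff a w has_real_derivative cutoff' a w x) (at x)"
    "(cutoff' a w has_real_derivative cutoff'' a w x) (at x)"
proof -
  have d: "((\<lambda>x. (x - a) / w) has_real_derivative 1 / w) (at x)"
    using assms by (auto intro!: derivative_eq_intros)
  show "(cutoff a w has_real_derivative cutoff' a w x) (at x)"
    using DERIV_chain2[OF spline_derivs(1) d] by (simp add: cutoff_def[abs_def] cutoff'_def)
  show "(cutoff' a w has_real_derivative cutoff'' a w x) (at x)"
    using DERIV_cdivide[OF DERIV_chain2[OF spline_derivs(2) d], of w] assms
    by (simp add: cutoff'_def[abs_def] cutoff''_def power2_eq_square)
qed

lemma cutoff_eq:
  assumes "w > 0"
  shows "x \<le> a \<Longrightarrow> cutoff a w x = 0" "x \<ge> a + 3 * w \<Longrightarrow> cutoff a w x = 1"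
    "x \<le> a \<or> x \<ge> a + 3 * w \<Longrightarrow> cutoff' a w x = 0" "x \<le> a \<or> x \<ge> a + 3 * w \<Longrightarrow> cutoff'' a w x = 0"
proof -
  have "x \<le> a \<longleftrightarrow> (x - a) / w \<le> 0" "x \<ge> a + 3 * w \<longleftrightarrow> (x - a) / w \<ge> 3"
    using assms by (auto simp: field_simps)
  then show "x \<le> a \<Longrightarrow> cutoff a w x = 0" "x \<ge> a + 3 * w \<Longrightarrow> cutoff a w x = 1"
    "x \<le> a \<or> x \<ge> a + 3 * w \<Longrightarrow> cutoff' a w x = 0" "x \<le> a \<or> x \<ge> a + 3 * w \<Longrightarrow> cutoff'' a w x = 0"
    using spline_eq[of "(x - a) / w"] by (auto simp: cutoff_def cutoff'_def cutoff''_def)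
qed

text \<open>The products with \<open>x\<close> are bounded because the derivatives vanish outside
  \<open>{a..a + 3 * w}\<close>; this tames the unbounded coefficients of the generator. The
  Lipschitz bound on the second derivative takes the place of a third derivative.\<close>

lemma cutoff_bounds:
  assumes "w > 0"
  shows "\<bar>cutoff a w x\<bar> \<le> 36" "\<bar>cutoff' a w x\<bar> \<le> 36 / w" "\<bar>cutoff'' a w x\<bar> \<le> 24 / w\<^sup>2"
    "\<bar>x * cutoff' a w x\<bar> \<le> (\<bar>a\<bar> + 3 * w) * (36 / w)" "\<bar>x * cutoff'' a w x\<bar> \<le> (\<bar>a\<bar> + 3 * w) * (24 / w\<^sup>2)"
    "\<bar>cutoff'' a w x - cutoff'' a w y\<bar> \<le> 8 / w ^ 3 * \<bar>x - y\<bar>"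
proof -
  show "\<bar>cutoff a w x\<bar> \<le> 36" by (simp add: cutoff_def spline_bounds)
  show 1: "\<bar>cutoff' a w x\<bar> \<le> 36 / w" using assms by (simp add: cutoff'_def spline_bounds divide_right_mono)
  show 2: "\<bar>cutoff'' a w x\<bar> \<le> 24 / w\<^sup>2" using assms by (simp add: cutoff''_def spline_bounds divide_right_mono)
  show "\<bar>x * cutoff' a w x\<bar> \<le> (\<bar>a\<bar> + 3 * w) * (36 / w)"
  proof (cases "x \<le> a \<or> x \<ge> a + 3 * w")
    case False
    then have "\<bar>x\<bar> \<le> \<bar>a\<bar> + 3 * w" by linarith
    with 1 show ?thesis unfolding abs_mult using assms by (intro mult_mono) auto
  qed (use cutoff_eq[OF assms, of x a] assms in auto)
  show "\<bar>x * cutoff'' a w x\<bar> \<le> (\<bar>a\<bar> + 3 * w) * (24 / w\<^sup>2)"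
  proof (cases "x \<le> a \<or> x \<ge> a + 3 * w")
    case False
    then have "\<bar>x\<bar> \<le> \<bar>a\<bar> + 3 * w" by linarith
    with 2 show ?thesis unfolding abs_mult using assms by (intro mult_mono) auto
  qed (use cutoff_eq[OF assms, of x a] assms in auto)
  have "\<bar>cutoff'' a w x - cutoff'' a w y\<bar> = \<bar>spline'' ((x - a) / w) - spline'' ((y - a) / w)\<bar> / w\<^sup>2"
    by (simp add: cutoff''_def abs_divide flip: diff_divide_distrib)
  also have "\<dots> \<le> 8 * \<bar>(x - a) / w - (y - a) / w\<bar> / w\<^sup>2"
    by (intro divide_right_mono spline''_lipschitz) simp
  also have "(x - a) / w - (y - a) / w = (x - y) / w" by (simp add: diff_divide_distrib)
  also have "8 * \<bar>(x - y) / w\<bar> / w\<^sup>2 = 8 / w ^ 3 * \<bar>x - y\<bar>"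
    using assms by (simp add: abs_divide power2_eq_square power3_eq_cube)
  finally show "\<bar>cutoff'' a w x - cutoff'' a w y\<bar> \<le> 8 / w ^ 3 * \<bar>x - y\<bar>" .
qed

text \<open>A cubic spline has no third derivative at its knots, but a Lipschitz second derivative
  still gives a cubic remainder, which is needed because the jump rates are of order
  \<open>1 / h^2\<close>.\<close>

lemma taylor_lipschitz:
  fixes \<phi> :: "real \<Rightarrow> real"
  assumes d1: "\<And>x. (\<phi> has_real_derivative \<phi>' x) (at x)"
    and d2: "\<And>x. (\<phi>' has_real_derivative \<phi>'' x) (at x)"
    and L: "\<And>x y. \<bar>\<phi>'' x - \<phi>'' y\<bar> \<le> L * \<bar>x - y\<bar>"
  shows "\<bar>\<phi> (x + h) - \<phi> x - h * \<phi>' x - h\<^sup>2 / 2 * \<phi>'' x\<bar> \<le> L * \<bar>h\<bar> ^ 3"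
proof (cases "h = 0")
  case False
  define D where "D m = (if m = 0 then \<phi> else if m = 1 then \<phi>' else \<phi>'')" for m :: nat
  have "\<exists>t. (if x + h < x then x + h < t \<and> t < x else x < t \<and> t < x + h) \<and>
      \<phi> (x + h) = (\<Sum>m<2. D m x / fact m * (x + h - x) ^ m) + D 2 t / fact 2 * (x + h - x) ^ 2"
  proof (rule Taylor[of 2 D \<phi> "min x (x + h)" "max x (x + h)" x "x + h"])
    show "\<forall>m t. m < 2 \<and> min x (x + h) \<le> t \<and> t \<le> max x (x + h) \<longrightarrow> (D m has_real_derivative D (Suc m) t) (at t)"
      using d1 d2 by (auto simp: D_def less_2_cases_iff)
  qed (use False in \<open>auto simp: D_def\<close>)
  then obtain t where t': "if x + h < x then x + h < t \<and> t < x else x < t \<and> t < x + h"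
    and eq': "\<phi> (x + h) = (\<Sum>m<2. D m x / fact m * (x + h - x) ^ m) + D 2 t / fact 2 * (x + h - x) ^ 2"
    by blast
  have t: "\<bar>t - x\<bar> \<le> \<bar>h\<bar>" using t' by (auto split: if_splits)
  have eq: "\<phi> (x + h) = \<phi> x + \<phi>' x * h + \<phi>'' t / 2 * h\<^sup>2"
    using eq' by (simp add: D_def numeral_2_eq_2)
  have "\<phi> (x + h) - \<phi> x - h * \<phi>' x - h\<^sup>2 / 2 * \<phi>'' x = h\<^sup>2 / 2 * (\<phi>'' t - \<phi>'' x)"
    unfolding eq by (simp add: algebra_simps)
  then have "\<bar>\<phi> (x + h) - \<phi> x - h * \<phi>' x - h\<^sup>2 / 2 * \<phi>'' x\<bar> = h\<^sup>2 / 2 * \<bar>\<phi>'' t - \<phi>'' x\<bar>"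
    by (simp only: abs_mult) simp
  also have "\<dots> \<le> h\<^sup>2 * (L * \<bar>h\<bar>)"
  proof (rule mult_mono)
    have "L \<ge> 0" using L[of 1 0] abs_ge_zero[of "\<phi>'' 1 - \<phi>'' 0"] by simp
    then show "\<bar>\<phi>'' t - \<phi>'' x\<bar> \<le> L * \<bar>h\<bar>" using L[of t x] t by (meson mult_left_mono order_trans)
  qed auto
  also have "\<dots> = L * \<bar>h\<bar> ^ 3" by (simp add: power3_eq_cube power2_eq_square flip: power2_abs[of h])
  finally show ?thesis .
qed simp

text \<open>
  Second-order Taylor expansion. The error is uniform in the level \<open>k\<close>, because \<open>x * cutoff'' a w x\<close> is bounded.
\<close>
lemma generator_error:
  fixes \<alpha> \<gamma> \<nu> e :: real and N k :: nat
  assumes a: "\<alpha> > 0" "\<gamma> > 0" and e: "e > 0" "\<alpha> / 2 - \<gamma> / 2 * e > 0" and k: "k \<le> N" and w: "w > 0"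
  defines "lam \<equiv> \<alpha> / 2 + \<gamma> / 2 * e" and "mu \<equiv> \<alpha> / 2 - \<gamma> / 2 * e" and "x \<equiv> real k * e"
  shows "\<bar>lam * (real N - real k) * (cutoff a w (x + e) - cutoff a w x)
          + mu * (real N + real k) * (cutoff a w (x - e) - cutoff a w x)
          - ((\<gamma> * \<nu> - \<alpha> * x) * cutoff' a w x + \<alpha> * \<nu> / 2 * cutoff'' a w x)\<bar>
      \<le> 3 * \<alpha> * (real N * e\<^sup>2) * (8 / w ^ 3 * e)
        + \<gamma> * \<bar>real N * e\<^sup>2 - \<nu>\<bar> * (36 / w) + \<alpha> * \<bar>real N * e\<^sup>2 - \<nu>\<bar> * (24 / w\<^sup>2)
        + \<gamma> * e\<^sup>2 * ((\<bar>a\<bar> + 3 * w) * (24 / w\<^sup>2))"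
proof -
  define R where "R h = cutoff a w (x + h) - cutoff a w x - h * cutoff' a w x - h\<^sup>2 / 2 * cutoff'' a w x" for h
  have R: "\<bar>R h\<bar> \<le> 8 / w ^ 3 * \<bar>h\<bar> ^ 3" for h
    unfolding R_def by (rule taylor_lipschitz[OF cutoff_derivs[OF w] cutoff_bounds(6)[OF w]])
  have lm: "0 \<le> lam" "lam \<le> \<alpha>" "0 \<le> mu" "mu \<le> \<alpha>" "lam + mu = \<alpha>" "lam - mu = \<gamma> * e"
  proof -
    have "\<gamma> / 2 * e > 0" using a e by simp
    then show "0 \<le> lam" "lam \<le> \<alpha>" "0 \<le> mu" "mu \<le> \<alpha>"
      unfolding lam_def mu_def using a e(2) by linarith+
  qed (simp_all add: lam_def mu_def)
  \<comment> \<open>The difference \<open>p - q\<close> of the up and down rates produces the drift,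
    their sum \<open>p + q\<close> the diffusion: \<open>(p - q) * e\<close> tends to
    \<open>\<gamma> * \<nu> - \<alpha> * x\<close> and \<open>(p + q) * e^2 / 2\<close> to
    \<open>\<alpha> * \<nu> / 2\<close>.\<close>
  define p q where "p = lam * (real N - real k)" and "q = mu * (real N + real k)"
  have Nk: "0 \<le> real N - real k" "real N - real k \<le> real N" "real N + real k \<le> 2 * real N" using k by auto
  have p: "0 \<le> p" "p \<le> \<alpha> * real N" unfolding p_def using lm Nk a by (auto intro!: mult_mono)
  have q: "0 \<le> q" "q \<le> \<alpha> * (2 * real N)" unfolding q_def using lm Nk a by (auto intro!: mult_mono)
  have pq: "p - q = \<gamma> * e * real N - \<alpha> * real k" "p + q = \<alpha> * real N - \<gamma> * e * real k"
  proof -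
    have "p - q = (lam - mu) * real N - (lam + mu) * real k" "p + q = (lam + mu) * real N - (lam - mu) * real k"
      unfolding p_def q_def by (simp_all add: algebra_simps)
    then show "p - q = \<gamma> * e * real N - \<alpha> * real k" "p + q = \<alpha> * real N - \<gamma> * e * real k"
      by (simp_all only: lm)
  qed
  have "lam * (real N - real k) * (cutoff a w (x + e) - cutoff a w x)
          + mu * (real N + real k) * (cutoff a w (x - e) - cutoff a w x)
       = p * R e + q * R (- e) + (p - q) * e * cutoff' a w x + (p + q) * e\<^sup>2 / 2 * cutoff'' a w x"
    unfolding R_def p_def[symmetric] q_def[symmetric] by (simp add: algebra_simps)
  also have "\<dots> = p * R e + q * R (- e) + ((\<gamma> * \<nu> - \<alpha> * x) * cutoff' a w x + \<alpha> * \<nu> / 2 * cutoff'' a w x)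
      + \<gamma> * (real N * e\<^sup>2 - \<nu>) * cutoff' a w x
      + (\<alpha> * (real N * e\<^sup>2 - \<nu>) * (cutoff'' a w x / 2) - \<gamma> * e\<^sup>2 * (x * cutoff'' a w x / 2))"
  proof -
    obtain h where h: "cutoff'' a w x = 2 * h" by (metis field_sum_of_halves mult_2)
    show ?thesis unfolding pq h by (simp add: x_def field_simps power2_eq_square)
  qed
  finally have eq: "lam * (real N - real k) * (cutoff a w (x + e) - cutoff a w x)
          + mu * (real N + real k) * (cutoff a w (x - e) - cutoff a w x)
          - ((\<gamma> * \<nu> - \<alpha> * x) * cutoff' a w x + \<alpha> * \<nu> / 2 * cutoff'' a w x)
      = p * R e + q * R (- e) + \<gamma> * (real N * e\<^sup>2 - \<nu>) * cutoff' a w x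
      + (\<alpha> * (real N * e\<^sup>2 - \<nu>) * (cutoff'' a w x / 2) - \<gamma> * e\<^sup>2 * (x * cutoff'' a w x / 2))" by simp
  have 1: "\<bar>p * R e\<bar> \<le> (\<alpha> * real N) * (8 / w ^ 3 * e ^ 3)"
    unfolding abs_mult using p R[of e] e a by (intro mult_mono) auto
  have 2: "\<bar>q * R (- e)\<bar> \<le> (\<alpha> * (2 * real N)) * (8 / w ^ 3 * e ^ 3)"
    unfolding abs_mult using q R[of "- e"] e a by (intro mult_mono) auto
  have 3: "\<bar>\<gamma> * (real N * e\<^sup>2 - \<nu>) * cutoff' a w x\<bar> \<le> \<gamma> * \<bar>real N * e\<^sup>2 - \<nu>\<bar> * (36 / w)"
    unfolding abs_mult using a cutoff_bounds(2)[OF w] by (intro mult_mono) auto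
  have 4: "\<bar>\<alpha> * (real N * e\<^sup>2 - \<nu>) * (cutoff'' a w x / 2)\<bar> \<le> \<alpha> * \<bar>real N * e\<^sup>2 - \<nu>\<bar> * (24 / w\<^sup>2)"
    unfolding abs_mult using a cutoff_bounds(3)[OF w, of a x] by (intro mult_mono) auto
  have 5: "\<bar>\<gamma> * e\<^sup>2 * (x * cutoff'' a w x / 2)\<bar> \<le> \<gamma> * e\<^sup>2 * ((\<bar>a\<bar> + 3 * w) * (24 / w\<^sup>2))"
  proof -
    have "\<bar>x * cutoff'' a w x / 2\<bar> \<le> \<bar>x * cutoff'' a w x\<bar>" by simp
    also note cutoff_bounds(5)[OF w]
    finally show ?thesis unfolding abs_mult[of "\<gamma> * e\<^sup>2"] using a by (intro mult_mono) auto
  qed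
  have 6: "(\<alpha> * real N) * (8 / w ^ 3 * e ^ 3) + (\<alpha> * (2 * real N)) * (8 / w ^ 3 * e ^ 3) = 3 * \<alpha> * (real N * e\<^sup>2) * (8 / w ^ 3 * e)"
    by (simp add: power2_eq_square power3_eq_cube mult_ac)
  have "\<bar>r1 + r2 + r3 + (r4 - r5)\<bar> \<le> (s1 + s2) + s3 + s4 + s5"
    if "\<bar>r1\<bar> \<le> s1" "\<bar>r2\<bar> \<le> s2" "\<bar>r3\<bar> \<le> s3" "\<bar>r4\<bar> \<le> s4" "\<bar>r5\<bar> \<le> s5" for r1 r2 r3 r4 r5 s1 s2 s3 s4 s5 :: real
    using that by linarith
  from this[OF 1 2 3 4 5] show ?thesis unfolding eq 6 .
qed

text \<open>The backward generator of the Ornstein--Uhlenbeck diffusion applied to the cutoff: since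
  \<open>\<gamma> * \<nu> = \<alpha> * \<beta>\<close> and
  \<open>\<alpha> * \<nu> = \<sigma>^2\<close>, the drift is
  \<open>- \<alpha> * (x - \<beta>)\<close> and the variance \<open>\<sigma>^2\<close>. Killing at
  rate \<open>\<xi>\<close> is treated separately.\<close>

definition drift_diffusion :: "real \<Rightarrow> real \<Rightarrow> real \<Rightarrow> real \<Rightarrow> real \<Rightarrow> real \<Rightarrow> real" where
  "drift_diffusion \<alpha> \<gamma> \<nu> a w x = (\<gamma> * \<nu> - \<alpha> * x) * cutoff' a w x + \<alpha> * \<nu> / 2 * cutoff'' a w x"

lemma continuous_on_cutoff:
  assumes "w > 0"
  shows "continuous_on A (cutoff a w)" "continuous_on A (drift_diffusion \<alpha> \<gamma> \<nu> a w)"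
  using assms
  by (auto simp: drift_diffusion_def[abs_def] cutoff_def[abs_def] cutoff'_def cutoff''_def
      spline_def spline'_def spline''_def intro!: continuous_intros)

lemma drift_diffusion_bounded:
  assumes w: "w > 0"
  obtains B where "\<And>x. \<bar>drift_diffusion \<alpha> \<gamma> \<nu> a w x\<bar> \<le> B"
proof -
  have "\<bar>drift_diffusion \<alpha> \<gamma> \<nu> a w x\<bar> \<le> \<bar>\<gamma> * \<nu>\<bar> * (36 / w) + \<bar>\<alpha>\<bar> * ((\<bar>a\<bar> + 3 * w) * (36 / w))
      + \<bar>\<alpha> * \<nu> / 2\<bar> * (24 / w\<^sup>2)" for x
  proof -
    have "drift_diffusion \<alpha> \<gamma> \<nu> a w x = \<gamma> * \<nu> * cutoff' a w x - \<alpha> * (x * cutoff' a w x) + \<alpha> * \<nu> / 2 * cutoff'' a w x"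
      by (simp add: drift_diffusion_def algebra_simps)
    also have "\<bar>\<dots>\<bar> \<le> \<bar>\<gamma> * \<nu> * cutoff' a w x\<bar> + \<bar>\<alpha> * (x * cutoff' a w x)\<bar> + \<bar>\<alpha> * \<nu> / 2 * cutoff'' a w x\<bar>" by linarith
    also have "\<dots> \<le> \<bar>\<gamma> * \<nu>\<bar> * (36 / w) + \<bar>\<alpha>\<bar> * ((\<bar>a\<bar> + 3 * w) * (36 / w))
      + \<bar>\<alpha> * \<nu> / 2\<bar> * (24 / w\<^sup>2)"
      unfolding abs_mult[of "\<gamma> * \<nu>"] abs_mult[of \<alpha> "x * _"] abs_mult[of "\<alpha> * \<nu> / 2"]
      by (intro add_mono mult_left_mono cutoff_bounds[OF w] abs_ge_zero)
    finally show ?thesis .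
  qed
  then show thesis by (rule that)
qed

text \<open>As \<open>a \<ge> e\<close>, the test function is 0 at levels 0 and 1 in every phase.
  Hence the phase-mixing row of level 0 contributes nothing, and above it the phase is constant, so
  that \<open>generator_error\<close> applies on ray \<open>j\<close>.\<close>

lemma generator_cutoff:
  fixes e \<nu> :: real and j :: nat
  assumes par: "\<alpha> > 0" "\<gamma> > 0" and e: "e > 0" "\<alpha> / 2 - \<gamma> / 2 * e > 0" and N: "N > 0"
    and a: "a \<ge> e" and w: "w > 0" and z: "(k, l) \<in> states d N"
  defines "\<psi> \<equiv> \<lambda>y. if snd y = j then cutoff a w (e * real (fst y)) else 0"
  shows "\<bar>(\<Sum>y\<in>states d N. rate N C (\<alpha> / 2 + \<gamma> / 2 * e) (\<alpha> / 2 - \<gamma> / 2 * e) \<xi> (k, l) y * (\<psi> y - \<psi> (k, l)))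
       - (if l = j then drift_diffusion \<alpha> \<gamma> \<nu> a w (e * real k) - \<xi> * cutoff a w (e * real k) else 0)\<bar>
    \<le> 3 * \<alpha> * (real N * e\<^sup>2) * (8 / w ^ 3 * e)
        + \<gamma> * \<bar>real N * e\<^sup>2 - \<nu>\<bar> * (36 / w) + \<alpha> * \<bar>real N * e\<^sup>2 - \<nu>\<bar> * (24 / w\<^sup>2)
        + \<gamma> * e\<^sup>2 * ((\<bar>a\<bar> + 3 * w) * (24 / w\<^sup>2))" (is "\<bar>?S - ?T\<bar> \<le> ?R")
proof -
  have kl: "k \<le> N" "l \<in> {1..d}" using z by (auto simp: states_def)
  have R0: "?R \<ge> 0" using par e w by (intro add_nonneg_nonneg mult_nonneg_nonneg divide_nonneg_nonneg) auto
  have c0: "cutoff a w x = 0" if "x \<le> e" for x using cutoff_eq(1)[OF w] that a by simp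
  note sr = sum_rate[OF kl(2,1) N, of C "\<alpha> / 2 + \<gamma> / 2 * e" "\<alpha> / 2 - \<gamma> / 2 * e" \<xi> \<psi>]
  have dd0: "drift_diffusion \<alpha> \<gamma> \<nu> a w 0 = 0"
    using cutoff_eq(3,4)[OF w, of 0 a] a e by (simp add: drift_diffusion_def)
  show ?thesis
  proof (cases "k = 0 \<or> l \<noteq> j")
    case True
    have "\<psi> (1, m) = 0" "\<psi> (0, m) = 0" "l \<noteq> j \<Longrightarrow> \<psi> (m, l) = 0" for m
      using e by (simp_all add: \<psi>_def c0)
    with True have "?S = 0" unfolding sr by auto
    moreover from True have "?T = 0" using e c0[of 0] by (auto simp: dd0)
    ultimately have "?S = 0" "?T = 0" by simp_all
    then show ?thesis using R0 by simp
  next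
    case False
    then have k: "k > 0" and l: "l = j" by auto
    have "e * real (k + 1) = real k * e + e" "e * real (k - 1) = real k * e - e"
      using k by (auto simp: algebra_simps of_nat_diff)
    then have "?S - ?T = (\<alpha> / 2 + \<gamma> / 2 * e) * (real N - real k) * (cutoff a w (real k * e + e) - cutoff a w (real k * e))
          + (\<alpha> / 2 - \<gamma> / 2 * e) * (real N + real k) * (cutoff a w (real k * e - e) - cutoff a w (real k * e))
          - ((\<gamma> * \<nu> - \<alpha> * (real k * e)) * cutoff' a w (real k * e) + \<alpha> * \<nu> / 2 * cutoff'' a w (real k * e))"
      unfolding sr using k l c0[of 0] e by (simp add: \<psi>_def drift_diffusion_def mult.commute[of e])
    then show ?thesis using generator_error[OF par e kl(1) w, of a \<nu>] by simp
  qed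
qed

section \<open>Passage to the limit in the forward equation\<close>

locale star_limit =
  fixes d l0 :: nat
    and C :: "nat \<Rightarrow> nat \<Rightarrow> real"
    and \<alpha> \<gamma> \<xi> \<nu> :: real
    and eps :: "nat \<Rightarrow> real"
    and N :: "nat \<Rightarrow> nat"
    and M :: "nat \<Rightarrow> 'w measure"
    and X :: "nat \<Rightarrow> real \<Rightarrow> 'w \<Rightarrow> nat \<times> nat"
    and W :: "'v measure"
    and Z :: "real \<Rightarrow> 'v \<Rightarrow> real"
    and J :: "real \<Rightarrow> 'v \<Rightarrow> nat"
  assumes par: "\<alpha> > 0" "\<gamma> > 0" "\<xi> > 0" "\<nu> > 0"
    and l0: "l0 \<in> {1..d}"
    and stoch: "stochastic_matrix d C"
    and N_pos: "\<And>n. N n > 0" and eps_pos: "\<And>n. eps n > 0" and mu_pos: "\<And>n. \<alpha> / 2 - \<gamma> / 2 * eps n > 0"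
    and eps_0: "eps \<longlonglongrightarrow> 0"
    and N_eps: "filterlim (\<lambda>n. real (N n) * eps n) at_top sequentially"
    and N_eps2: "(\<lambda>n. real (N n) * (eps n)\<^sup>2) \<longlonglongrightarrow> \<nu>"
    and chain: "\<And>n. markov_chain (M n) (X n) (states d (N n))
           (rate (N n) C (\<alpha> / 2 + \<gamma> / 2 * eps n) (\<alpha> / 2 - \<gamma> / 2 * eps n) \<xi>) (0, l0)"
    and W: "prob_space W"
    and Z_meas: "\<And>t. t \<ge> 0 \<Longrightarrow> Z t \<in> borel_measurable W"
    and J_meas: "\<And>t. t \<ge> 0 \<Longrightarrow> J t \<in> W \<rightarrow>\<^sub>M count_space {1..d}"
    and Z_nonneg: "\<And>t w. t \<ge> 0 \<Longrightarrow> w \<in> space W \<Longrightarrow> Z t w \<ge> 0"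
    and law: "tends_in_law d eps M X W Z J"
begin

sublocale W: prob_space W by (rule W)

definition E :: "(real \<Rightarrow> real) \<Rightarrow> nat \<Rightarrow> real \<Rightarrow> real" where
  "E g j t = (LINT v|W. (if J t v = j then g (Z t v) else 0))"

definition En :: "nat \<Rightarrow> (real \<Rightarrow> real) \<Rightarrow> nat \<Rightarrow> real \<Rightarrow> real" where
  "En n g j t = (LINT v|M n. (if snd (X n t v) = j then g (eps n * real (fst (X n t v))) else 0))"

lemma En_tendsto:
  assumes "t \<ge> 0" "j \<in> {1..d}" "continuous_on UNIV g" "\<And>x. \<bar>g x\<bar> \<le> B"
  shows "(\<lambda>n. En n g j t) \<longlonglongrightarrow> E g j t"
proof -
  have "bounded (range g)" using assms(4) by (intro boundedI[of _ B]) auto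
  then show ?thesis using law assms unfolding tends_in_law_def En_def E_def by blast
qed

lemma En_sum:
  assumes "t \<ge> 0"
  shows "En n g j t = (\<Sum>y\<in>states d (N n). (if snd y = j then g (eps n * real (fst y)) else 0)
            * measure (M n) {w \<in> space (M n). X n t w = y})"
  using markov_chain_integral[OF chain[of n] finite_states assms, of "\<lambda>y. if snd y = j then g (eps n * real (fst y)) else 0"]
  by (simp add: En_def)

lemma J_set: "t \<ge> 0 \<Longrightarrow> {v \<in> space W. J t v = j} \<in> sets W"
proof -
  assume t: "t \<ge> 0"
  have "{v \<in> space W. J t v = j} = J t -` ({j} \<inter> {1..d}) \<inter> space W"
    using measurable_space[OF J_meas[OF t]] by auto
  then show ?thesis using measurable_sets[OF J_meas[OF t], of "{j} \<inter> {1..d}"] by simp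
qed

lemma J_pred[measurable (raw)]: "t \<ge> 0 \<Longrightarrow> Measurable.pred W (\<lambda>v. J t v = j)"
  using J_set by (simp add: pred_def)

text \<open>For each \<open>n\<close> the forward equation is integrated over \<open>{s..t}\<close>
  and the generator is replaced by its limit up to a uniform error \<open>\<delta> n\<close>. At
  each fixed time the means converge by convergence in law; uniform boundedness allows dominated
  convergence in time.\<close>

lemma weak_forward_equation:
  assumes a: "a > 0" and w: "w > 0" and st: "0 \<le> s" "s \<le> t" and j: "j \<in> {1..d}"
  shows "((\<lambda>r. E (\<lambda>x. drift_diffusion \<alpha> \<gamma> \<nu> a w x - \<xi> * cutoff a w x) j r) has_integral
           E (cutoff a w) j t - E (cutoff a w) j s) {s..t}"
proof -
  define h where "h x = drift_diffusion \<alpha> \<gamma> \<nu> a w x - \<xi> * cutoff a w x" for x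
  define p where "p n y r = measure (M n) {v \<in> space (M n). X n r v = y}" for n y r
  define \<psi> where "\<psi> n y = (if snd y = j then cutoff a w (eps n * real (fst y)) else 0)" for n and y :: "nat \<times> nat"
  define G where "G n z = (\<Sum>y\<in>states d (N n). rate (N n) C (\<alpha> / 2 + \<gamma> / 2 * eps n) (\<alpha> / 2 - \<gamma> / 2 * eps n) \<xi> z y
      * (\<psi> n y - \<psi> n z))" for n z
  define q where "q n r = (\<Sum>z\<in>states d (N n). p n z r * G n z)" for n r
  define \<delta> where "\<delta> n = 3 * \<alpha> * (real (N n) * (eps n)\<^sup>2) * (8 / w ^ 3 * eps n)
        + \<gamma> * \<bar>real (N n) * (eps n)\<^sup>2 - \<nu>\<bar> * (36 / w) + \<alpha> * \<bar>real (N n) * (eps n)\<^sup>2 - \<nu>\<bar> * (24 / w\<^sup>2)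
        + \<gamma> * (eps n)\<^sup>2 * ((\<bar>a\<bar> + 3 * w) * (24 / w\<^sup>2))" for n
  have \<delta>0: "\<delta> \<longlonglongrightarrow> 0"
  proof -
    have "\<delta> \<longlonglongrightarrow> 3 * \<alpha> * \<nu> * (8 / w ^ 3 * 0) + \<gamma> * \<bar>\<nu> - \<nu>\<bar> * (36 / w) + \<alpha> * \<bar>\<nu> - \<nu>\<bar> * (24 / w\<^sup>2)
        + \<gamma> * 0\<^sup>2 * ((\<bar>a\<bar> + 3 * w) * (24 / w\<^sup>2))"
      unfolding \<delta>_def by (intro tendsto_intros eps_0 N_eps2)
    then show ?thesis by simp
  qed
  obtain B where B: "\<And>x. \<bar>drift_diffusion \<alpha> \<gamma> \<nu> a w x\<bar> \<le> B" using drift_diffusion_bounded[OF w, where \<alpha> = \<alpha> and \<gamma> = \<gamma> and \<nu> = \<nu> and a = a] by blast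
  have hB: "\<bar>h x\<bar> \<le> B + \<xi> * 36" for x
  proof -
    have "\<bar>\<xi> * cutoff a w x\<bar> \<le> \<xi> * 36"
      using cutoff_bounds(1)[OF w, of a x] par(3) unfolding abs_mult by (intro mult_mono) auto
    with B[of x] show ?thesis unfolding h_def by linarith
  qed
  have hc: "continuous_on UNIV h"
    unfolding h_def by (intro continuous_intros continuous_on_cutoff w)
  have p1: "(\<Sum>z\<in>states d (N n). p n z r) = 1" if "r \<ge> 0" for n r
    unfolding p_def by (rule markov_chain_prob_sum[OF chain finite_states that])
  have p0: "p n z r \<ge> 0" for n z r by (simp add: p_def)
  have int: "(q n has_integral En n (cutoff a w) j t - En n (cutoff a w) j s) {s..t}" for n
  proof (rule fundamental_theorem_of_calculus[OF st(2)])
    fix r assume r: "r \<in> {s..t}"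
    then have r0: "r \<ge> 0" using st by simp
    have "((\<lambda>r. \<Sum>y\<in>states d (N n). \<psi> n y * p n y r) has_real_derivative q n r) (at r within {0..})"
      using markov_chain_forward[OF chain[of n] r0, of "\<psi> n"] unfolding q_def G_def p_def .
    then have "((\<lambda>r. \<Sum>y\<in>states d (N n). \<psi> n y * p n y r) has_real_derivative q n r) (at r within {s..t})"
      by (rule DERIV_subset) (use st in auto)
    then have "((\<lambda>r. En n (cutoff a w) j r) has_real_derivative q n r) (at r within {s..t})"
      by (rule has_field_derivative_transform_within[of _ _ _ _ 1])
         (use r st in \<open>auto simp: En_sum p_def \<psi>_def\<close>)
    then show "((\<lambda>r. En n (cutoff a w) j r) has_vector_derivative q n r) (at r within {s..t})"
      by (simp add: has_real_derivative_iff_has_vector_derivative)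
  qed
  have close: "\<bar>q n r - En n h j r\<bar> \<le> \<delta> n" if r: "r \<ge> 0" and n: "eps n \<le> a" for n r
  proof -
    have Gh: "\<bar>G n z - (if snd z = j then h (eps n * real (fst z)) else 0)\<bar> \<le> \<delta> n" if z: "z \<in> states d (N n)" for z
    proof -
      obtain k l where kl: "z = (k, l)" by fastforce
      show ?thesis
        using generator_cutoff[OF par(1,2) eps_pos mu_pos N_pos n w z[unfolded kl], where j = j and C = C and \<xi> = \<xi> and \<nu> = \<nu>]
        unfolding G_def \<psi>_def h_def \<delta>_def kl fst_conv snd_conv .
    qed
    have "q n r - En n h j r = (\<Sum>z\<in>states d (N n). p n z r * (G n z - (if snd z = j then h (eps n * real (fst z)) else 0)))"
      unfolding q_def En_sum[OF r] p_def[symmetric] by (simp add: sum_subtractf algebra_simps)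
    also have "\<bar>\<dots>\<bar> \<le> (\<Sum>z\<in>states d (N n). p n z r * \<delta> n)"
      by (rule order_trans[OF sum_abs]) (auto simp: abs_mult p0 intro!: sum_mono mult_left_mono Gh)
    also have "\<dots> = \<delta> n" using p1[OF r] by (simp flip: sum_distrib_right)
    finally show ?thesis .
  qed
  have EnB: "\<bar>En n h j r\<bar> \<le> B + \<xi> * 36" if r: "r \<ge> 0" for n r
  proof -
    have B0: "0 \<le> B + \<xi> * 36" using hB[of 0] by linarith
    have "\<bar>En n h j r\<bar> \<le> (\<Sum>z\<in>states d (N n). (B + \<xi> * 36) * p n z r)"
      unfolding En_sum[OF r] p_def[symmetric]
      by (rule order_trans[OF sum_abs]) (auto simp: abs_mult p0 B0 intro!: sum_mono mult_right_mono hB mult_nonneg_nonneg)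
    then show ?thesis using p1[OF r] by (simp flip: sum_distrib_left)
  qed
  \<comment> \<open>The dominating bound has to hold for every index, so the sequence is started at
    an \<open>n0\<close> from which \<open>eps n \<le> a\<close> and
    \<open>\<delta> n \<le> 1\<close>.\<close>
  have "\<forall>\<^sub>F n in sequentially. eps n \<le> a \<and> \<delta> n \<le> 1"
    using order_tendstoD(2)[OF eps_0 a] order_tendstoD(2)[OF \<delta>0 zero_less_one]
    by eventually_elim simp
  then obtain n0 where n0: "\<And>n. n \<ge> n0 \<Longrightarrow> eps n \<le> a \<and> \<delta> n \<le> 1"
    by (auto simp: eventually_sequentially)
  have qlim: "(\<lambda>n. q n r) \<longlonglongrightarrow> E h j r" if r: "r \<ge> 0" for r
  proof -
    have "(\<lambda>n. q n r - En n h j r) \<longlonglongrightarrow> 0"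
    proof (rule tendsto_0_le[OF \<delta>0, where K = 1])
      show "\<forall>\<^sub>F n in sequentially. norm (q n r - En n h j r) \<le> norm (\<delta> n) * 1"
        using eventually_ge_at_top[of n0] by eventually_elim (use close[OF r] n0 in fastforce)
    qed
    from tendsto_add[OF this En_tendsto[OF r j hc hB]] show ?thesis by simp
  qed
  show ?thesis
  proof (rule has_integral_dominated_convergence[where f = "\<lambda>k. q (k + n0)" and h = "\<lambda>_. B + \<xi> * 36 + 1"
        and y = "\<lambda>k. En (k + n0) (cutoff a w) j t - En (k + n0) (cutoff a w) j s"])
    show "(q (k + n0) has_integral En (k + n0) (cutoff a w) j t - En (k + n0) (cutoff a w) j s) {s..t}" for k
      by (rule int)
    show "(\<lambda>_. B + \<xi> * 36 + 1) integrable_on {s..t}" by (rule integrable_const_ivl)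
    show "\<forall>r\<in>{s..t}. norm (q (k + n0) r) \<le> B + \<xi> * 36 + 1" for k
    proof
      fix r assume "r \<in> {s..t}"
      then have r: "r \<ge> 0" using st by simp
      show "norm (q (k + n0) r) \<le> B + \<xi> * 36 + 1"
        using close[OF r, of "k + n0"] EnB[OF r, of "k + n0"] n0[of "k + n0"] unfolding real_norm_def by linarith
    qed
    show "\<forall>r\<in>{s..t}. (\<lambda>k. q (k + n0) r) \<longlonglongrightarrow> E (\<lambda>x. drift_diffusion \<alpha> \<gamma> \<nu> a w x - \<xi> * cutoff a w x) j r"
      using LIMSEQ_ignore_initial_segment[OF qlim, of _ n0] st unfolding h_def by auto
    show "(\<lambda>k. En (k + n0) (cutoff a w) j t - En (k + n0) (cutoff a w) j s) \<longlonglongrightarrow> E (cutoff a w) j t - E (cutoff a w) j s"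
      by (intro tendsto_diff LIMSEQ_ignore_initial_segment[OF En_tendsto[where B = 36]] j continuous_on_cutoff w cutoff_bounds) (use st in auto)
  qed
qed

end

section \<open>Densities from one-sided derivatives\<close>

text \<open>A continuation argument: the set of points that \<open>G\<close> reaches with mean slope
  at most \<open>e\<close> is closed, and the right derivative at its supremum would push the
  supremum further unless it is \<open>b\<close>. Only right derivatives are available, because
  \<open>limit_density\<close> looks at intervals to the right of \<open>x\<close>.\<close>

lemma right_derivative_zero_imp_le:
  fixes G :: "real \<Rightarrow> real"
  assumes ab: "a \<le> b" and c: "continuous_on {a..b} G" and e: "e > 0"
    and r: "\<And>x. a \<le> x \<Longrightarrow> x < b \<Longrightarrow> ((\<lambda>h. (G (x + h) - G x) / h) \<longlongrightarrow> 0) (at_right 0)"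
  shows "G b - G a \<le> e * (b - a)"
proof -
  define S where "S = {y \<in> {a..b}. G y - e * y \<le> G a - e * a}"
  have cl: "closed S"
    unfolding S_def by (intro continuous_closed_preimage_constant continuous_on_closed_Collect_le c continuous_intros closed_atLeastAtMost)
  have aS: "a \<in> S" using ab by (simp add: S_def)
  have bdd: "bdd_above S" by (auto simp: S_def bdd_above_def)
  define m where "m = Sup S"
  have mS: "m \<in> S" unfolding m_def using closed_contains_Sup[OF _ bdd cl] aS by blast
  have "m = b"
  proof (rule ccontr)
    assume "m \<noteq> b"
    then have m: "a \<le> m" "m < b" using mS by (auto simp: S_def)
    have "\<forall>\<^sub>F h in at_right 0. (G (m + h) - G m) / h < e \<and> h < b - m \<and> h > 0"
      using order_tendstoD(2)[OF r[OF m] e] eventually_at_right_less[of "0::real"]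
        eventually_at_right_real[of 0 "b - m"] m
      by (auto elim: eventually_elim2)
    then obtain h where h: "(G (m + h) - G m) / h < e" "h < b - m" "h > 0"
      by (auto dest!: eventually_happens)
    then have "G (m + h) - G m < e * h" by (simp add: field_simps)
    then have "m + h \<in> S" using mS h m by (auto simp: S_def algebra_simps)
    then have "m + h \<le> m" unfolding m_def using cSup_upper[OF _ bdd] by blast
    then show False using h by simp
  qed
  then show ?thesis using mS by (auto simp: S_def algebra_simps)
qed

lemma right_derivative_zero_imp_const:
  fixes G :: "real \<Rightarrow> real"
  assumes ab: "a \<le> b" and c: "continuous_on {a..b} G"
    and r: "\<And>x. a \<le> x \<Longrightarrow> x < b \<Longrightarrow> ((\<lambda>h. (G (x + h) - G x) / h) \<longlongrightarrow> 0) (at_right 0)"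
  shows "G b = G a"
proof -
  have le: "H b \<le> H a" if "continuous_on {a..b} H"
    "\<And>x. a \<le> x \<Longrightarrow> x < b \<Longrightarrow> ((\<lambda>h. (H (x + h) - H x) / h) \<longlongrightarrow> 0) (at_right 0)" for H :: "real \<Rightarrow> real"
  proof (rule field_le_epsilon)
    fix e :: real assume e: "e > 0"
    have "H b - H a \<le> e / (b - a + 1) * (b - a)"
      by (rule right_derivative_zero_imp_le[OF ab that(1) _ that(2)]) (use ab e in auto)
    also have "\<dots> \<le> e" using ab e by (simp add: field_simps)
    finally show "H b \<le> H a + e" by simp
  qed
  have "- G b \<le> - G a"
  proof (rule le)
    show "((\<lambda>h. (- G (x + h) - - G x) / h) \<longlongrightarrow> 0) (at_right 0)" if "a \<le> x" "x < b" for x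
      using tendsto_minus[OF r[OF that]] by (simp add: minus_divide_left)
  qed (intro continuous_intros c)
  then show ?thesis using le[OF c r] by simp
qed

lemma Ici_at_right_limit:
  fixes x :: real
  assumes "x < b"
  shows "(F \<longlongrightarrow> l) (at x within {x..b}) \<longleftrightarrow> ((\<lambda>h. F (x + h)) \<longlongrightarrow> l) (at_right 0)"
  using assms by (simp add: at_within_Icc_at_right filterlim_at_right_to_0[of _ _ x] add.commute)

lemma has_right_derivative_iff:
  fixes G :: "real \<Rightarrow> real"
  assumes "x < b"
  shows "(G has_real_derivative D) (at x within {x..b}) \<longleftrightarrow> ((\<lambda>h. (G (x + h) - G x) / h) \<longlongrightarrow> D) (at_right 0)"
  unfolding has_field_derivative_iff by (simp add: Ici_at_right_limit[OF assms])

lemma has_right_derivative_unique: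
  fixes G :: "real \<Rightarrow> real"
  assumes "x < b" "(G has_real_derivative D) (at x within {x..b})" "(G has_real_derivative D') (at x within {x..b})"
  shows "D = D'"
  using assms(2,3) unfolding has_right_derivative_iff[OF assms(1)]
  by (rule tendsto_unique[OF trivial_limit_at_right_real])

lemma integral_has_right_derivative:
  fixes g :: "real \<Rightarrow> real"
  assumes "x < b" "continuous_on {x..b} g"
  shows "((\<lambda>u. integral {x..u} g) has_real_derivative g x) (at x within {x..b})"
  using integral_has_vector_derivative[OF assms(2), of x] assms(1)
  by (simp add: has_real_derivative_iff_has_vector_derivative)

lemma integral_zero_imp_zero:
  fixes g :: "real \<Rightarrow> real"
  assumes "x < b" "continuous_on {x..b} g" "\<And>u. x \<le> u \<Longrightarrow> u \<le> b \<Longrightarrow> integral {x..u} g = 0"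
  shows "g x = 0"
proof (rule has_right_derivative_unique[OF assms(1) integral_has_right_derivative[OF assms(1,2)]])
  have "((\<lambda>u. 0) has_real_derivative 0) (at x within {x..b})" by simp
  then show "((\<lambda>u. integral {x..u} g) has_real_derivative 0) (at x within {x..b})"
    by (rule has_field_derivative_transform_within[of _ _ _ _ 1]) (use assms in auto)
qed

text \<open>Absolute continuity is a conclusion here. The distribution function is left-continuous
  by continuity of the measure from below and right-continuous because it has finite right
  derivatives. So its difference with the integral of \<open>f\<close> is continuous with right
  derivative 0, hence constant, which excludes atoms and a singular part on
  \<open>{a..}\<close>.\<close>

lemma density_of_right_derivative:
  fixes f :: "real \<Rightarrow> real"
  assumes fin: "finite_borel_measure \<mu>"
    and c: "continuous_on {a..} f" and null: "measure \<mu> {..<a} = 0"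
    and lim: "\<And>x. x \<ge> a \<Longrightarrow> ((\<lambda>h. measure \<mu> {x..<x + h} / h) \<longlongrightarrow> f x) (at_right 0)"
  shows "\<mu> = density lborel (\<lambda>x. ennreal (indicator {a..} x * f x))"
proof -
  interpret finite_borel_measure \<mu> by (rule fin)
  have sb: "sets \<mu> = sets borel" by (rule M_is_borel)
  have f0: "f x \<ge> 0" if "x \<ge> a" for x
    by (rule tendsto_lowerbound[OF lim[OF that]])
       (use eventually_at_right_less[of "0::real"] in \<open>auto elim!: eventually_mono\<close>)
  \<comment> \<open>Open half-lines make the increments the masses of \<open>{x..<y}\<close>,
    exactly the intervals in the hypothesis.\<close>
  define F where "F y = measure \<mu> {..<y}" for y
  have Fdiff: "F y - F x = measure \<mu> {x..<y}" if "x \<le> y" for x y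
  proof -
    have "{..<y} = {..<x} \<union> {x..<y}" using that by auto
    then have "F y = F x + measure \<mu> {x..<y}"
      unfolding F_def using sb by (simp add: finite_measure_Union[of "{..<x}" "{x..<y}"] disjoint_iff)
    then show ?thesis by simp
  qed
  have mono: "F x \<le> F y" if "x \<le> y" for x y
    using Fdiff[OF that] measure_nonneg[of \<mu> "{x..<y}"] by linarith
  have Fr: "((\<lambda>h. (F (x + h) - F x) / h) \<longlongrightarrow> f x) (at_right 0)" if "x \<ge> a" for x
    by (rule Lim_transform_eventually[OF lim[OF that]])
       (use eventually_at_right_less[of "0::real"] in \<open>auto elim!: eventually_mono simp: Fdiff\<close>)
  have right: "(F \<longlongrightarrow> F x) (at_right x)" if "x \<ge> a" for x
  proof -
    have "(F has_real_derivative f x) (at x within {x..x+1})"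
      using Fr[OF that] by (subst has_right_derivative_iff) auto
    then have "continuous (at x within {x..x+1}) F"
      by (rule DERIV_continuous)
    then show ?thesis by (simp add: continuous_within at_within_Icc_at_right)
  qed
  have left: "(F \<longlongrightarrow> F x) (at_left x)" for x
  proof (rule tendsto_at_left_sequentially[of "x - 1"])
    fix S :: "nat \<Rightarrow> real" assume S: "incseq S" "S \<longlonglongrightarrow> x" "\<And>n. S n < x" "\<And>n. x - 1 < S n"
    have "(\<lambda>n. F (S n)) \<longlonglongrightarrow> measure \<mu> (\<Union>i. {..<S i})"
      using S(1) sb unfolding F_def by (intro finite_Lim_measure_incseq) (auto simp: incseq_def intro: less_le_trans)
    also have "(\<Union>i. {..<S i}) = {..<x}"
      using S(3) by (auto dest!: order_tendstoD(1)[OF S(2)] eventually_happens'[OF sequentially_bot] intro: less_trans)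
    finally show "(\<lambda>n. F (S n)) \<longlonglongrightarrow> F x" by (simp add: F_def)
  qed auto
  have Fc: "continuous_on {a..b} F" for b
    unfolding continuous_on_def
  proof
    fix x assume "x \<in> {a..b}"
    then have "(F \<longlongrightarrow> F x) (at x)" using left right by (auto simp: filterlim_at_split)
    then show "(F \<longlongrightarrow> F x) (at x within {a..b})" by (rule tendsto_within_subset) auto
  qed
  have ci: "continuous_on {a..b} f" for b by (rule continuous_on_subset[OF c]) auto
  have Fint: "F b = integral {a..b} f" if "a \<le> b" for b
  proof -
    define G where "G y = F y - integral {a..y} f" for y
    have "G b = G a"
    proof (rule right_derivative_zero_imp_const[OF that])
      show "continuous_on {a..b} G" unfolding G_def
        by (intro continuous_intros Fc indefinite_integral_continuous_1 integrable_continuous_real ci)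
      fix x assume x: "a \<le> x" "x < b"
      have "((\<lambda>u. integral {a..u} f) has_real_derivative f x) (at x within {a..b})"
        using integral_has_vector_derivative[OF ci, of x b] x by (simp add: has_real_derivative_iff_has_vector_derivative)
      then have "((\<lambda>u. integral {a..u} f) has_real_derivative f x) (at x within {x..b})"
        by (rule DERIV_subset) (use x in auto)
      moreover have "(F has_real_derivative f x) (at x within {x..b})"
        using Fr x by (subst has_right_derivative_iff) auto
      ultimately have "(G has_real_derivative f x - f x) (at x within {x..b})"
        unfolding G_def by (intro DERIV_diff)
      then show "((\<lambda>h. (G (x + h) - G x) / h) \<longlongrightarrow> 0) (at_right 0)"
        using x by (simp add: has_right_derivative_iff)
    qed
    then show ?thesis by (simp add: G_def F_def null)
  qed
  show ?thesis
  proof (rule measure_eqI_generator_eq[where \<Omega> = UNIV and E = "range lessThan" and A = "\<lambda>n. {..<real n}"])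
    show "Int_stable (range (lessThan :: real \<Rightarrow> _))" 
    proof (unfold Int_stable_def, safe)
      fix x y :: real
      have "{..<x} \<inter> {..<y} = {..<min x y}" by auto
      then show "{..<x} \<inter> {..<y} \<in> range lessThan" by blast
    qed
    show "sets \<mu> = sigma_sets UNIV (range lessThan)" unfolding sb by (simp add: borel_Iio)
    show "sets (density lborel (\<lambda>x. ennreal (indicator {a..} x * f x))) = sigma_sets UNIV (range lessThan)"
      by (simp add: borel_Iio)
    show "(\<Union>i. {..<real i}) = UNIV" by (auto simp: reals_Archimedean2)
    fix A :: "real set" assume "A \<in> range lessThan"
    then obtain y where A: "A = {..<y}" by auto
    have bm: "(\<lambda>x. ennreal (indicator {a..} x * f x)) \<in> borel_measurable lborel"
      using borel_measurable_continuous_on_indicator[OF _ c] by (simp add: mult.commute)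
    have "emeasure (density lborel (\<lambda>x. ennreal (indicator {a..} x * f x))) A =
        (\<integral>\<^sup>+x. ennreal (f x) * indicator {a..<y} x \<partial>lborel)"
      unfolding A by (subst emeasure_density[OF bm]) (auto intro!: nn_integral_cong simp: indicator_def)
    also have "\<dots> = (\<integral>\<^sup>+x. ennreal (f x) * indicator {a..y} x \<partial>lborel)"
      using AE_lborel_singleton[of y] by (intro nn_integral_cong_AE) (auto elim!: eventually_mono simp: indicator_def)
    also have "\<dots> = ennreal (F y)"
    proof (cases "a \<le> y")
      case True
      have "(f has_integral F y) {a..y}"
        unfolding Fint[OF True] by (intro integrable_integral integrable_continuous_real ci)
      from nn_integral_has_integral_lebesgue'[OF _ this] show ?thesis using f0 by simp
    next
      case False
      then have "F y = 0" using mono[of y a] null by (simp add: F_def measure_le_0_iff)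
      then show ?thesis using False by simp
    qed
    finally show "emeasure \<mu> A = emeasure (density lborel (\<lambda>x. ennreal (indicator {a..} x * f x))) A"
      by (simp add: A F_def emeasure_eq_measure)
  qed (auto simp: emeasure_eq_measure)
qed

text \<open>The constant \<open>108 = (36 / w) * (3 * w)\<close> does not depend on
  \<open>w\<close>, so the bound can serve as a dominating constant as \<open>w\<close> tends to
  0.\<close>

lemma integral_cutoff'_bound:
  assumes w: "w > 0" and H: "\<And>x. x \<in> {a..a + 3 * w} \<Longrightarrow> \<bar>H x\<bar> \<le> K" and c: "continuous_on {a..a + 3 * w} H"
  shows "\<bar>integral {a..a + 3 * w} (\<lambda>x. cutoff' a w x * H x)\<bar> \<le> 108 * K"
proof -
  have cc: "continuous_on A (cutoff' a w)" for A
    by (rule DERIV_continuous_on) (rule has_field_derivative_at_within[OF cutoff_derivs(2)[OF w]])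
  have "norm (integral {a..a + 3 * w} (\<lambda>x. cutoff' a w x * H x)) \<le> (36 / w * K) * (a + 3 * w - a)"
  proof (rule integral_bound)
    show "continuous_on {a..a + 3 * w} (\<lambda>x. cutoff' a w x * H x)" by (intro continuous_intros cc c)
    show "norm (cutoff' a w x * H x) \<le> 36 / w * K" if "x \<in> {a..a + 3 * w}" for x
      unfolding real_norm_def abs_mult using H[OF that] cutoff_bounds(2)[OF w] w by (intro mult_mono) auto
  qed (use w in auto)
  then show ?thesis using w by simp
qed

text \<open>\<open>cutoff' a w\<close> is an approximate identity at \<open>a\<close> from the
  right: it has integral 1 and lives on an interval of length \<open>3 * w\<close>. The tolerance
  \<open>e / 216\<close> becomes \<open>e / 2\<close> after the factor 108.\<close>

lemma integral_cutoff'_tendsto: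
  assumes c: "continuous_on {a..a + 3} H"
  defines "w \<equiv> \<lambda>m. inverse (real (Suc m))"
  shows "(\<lambda>m. integral {a..a + 3 * w m} (\<lambda>x. cutoff' a (w m) x * H x)) \<longlonglongrightarrow> H a"
proof (rule LIMSEQ_I)
  fix e :: real assume e: "e > 0"
  have w: "w m > 0" "w m \<le> 1" for m by (auto simp: w_def inverse_le_1_iff)
  have w0: "w \<longlonglongrightarrow> 0" unfolding w_def by (rule LIMSEQ_inverse_real_of_nat)
  obtain \<delta> where \<delta>: "\<delta> > 0" "\<And>x. x \<in> {a..a + 3} \<Longrightarrow> dist x a < \<delta> \<Longrightarrow> dist (H x) (H a) < e / 216"
    using c[unfolded continuous_on_iff, rule_format, of a "e / 216"] e by auto
  obtain n where n: "\<And>m. m \<ge> n \<Longrightarrow> w m < \<delta> / 3"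
    using order_tendstoD(2)[OF w0, of "\<delta> / 3"] \<delta>(1) by (auto simp: eventually_sequentially)
  show "\<exists>n. \<forall>m\<ge>n. norm (integral {a..a + 3 * w m} (\<lambda>x. cutoff' a (w m) x * H x) - H a) < e"
  proof (intro exI allI impI)
    fix m assume m: "m \<ge> n"
    have cH: "continuous_on {a..a + 3 * w m} H" by (rule continuous_on_subset[OF c]) (use w[of m] in auto)
    have cc: "continuous_on A (cutoff' a (w m))" for A
      by (rule DERIV_continuous_on) (rule has_field_derivative_at_within[OF cutoff_derivs(2)[OF w(1)]])
    have "(cutoff' a (w m) has_integral cutoff a (w m) (a + 3 * w m) - cutoff a (w m) a) {a..a + 3 * w m}"
      by (rule fundamental_theorem_of_calculus)
         (use w(1)[of m] in \<open>auto intro!: has_field_derivative_at_within cutoff_derivs simp flip: has_real_derivative_iff_has_vector_derivative\<close>)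
    then have one: "integral {a..a + 3 * w m} (cutoff' a (w m)) = 1"
      using cutoff_eq(1,2)[OF w(1)[of m]] by (simp add: integral_unique)
    have "integral {a..a + 3 * w m} (\<lambda>x. cutoff' a (w m) x * (H x - H a)) =
       integral {a..a + 3 * w m} (\<lambda>x. cutoff' a (w m) x * H x) - integral {a..a + 3 * w m} (\<lambda>x. cutoff' a (w m) x * H a)"
      unfolding right_diff_distrib
      by (rule integral_diff) (intro integrable_continuous_real continuous_intros cc cH)+
    then have "integral {a..a + 3 * w m} (\<lambda>x. cutoff' a (w m) x * H x) - H a =
        integral {a..a + 3 * w m} (\<lambda>x. cutoff' a (w m) x * (H x - H a))"
      by (simp add: one)
    also have "\<bar>\<dots>\<bar> \<le> 108 * (e / 216)"
    proof (rule integral_cutoff'_bound[OF w(1)])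
      show "\<bar>H x - H a\<bar> \<le> e / 216" if "x \<in> {a..a + 3 * w m}" for x
        using \<delta>(2)[of x] that w[of m] n[OF m] by (auto simp: dist_real_def)
    qed (intro continuous_intros cH)
    finally show "norm (integral {a..a + 3 * w m} (\<lambda>x. cutoff' a (w m) x * H x) - H a) < e"
      using e by simp
  qed
qed

section \<open>The equation for the tails\<close>

lemma hderiv_works:
  "g differentiable (at x within {0..}) \<Longrightarrow> (g has_real_derivative hderiv g x) (at x within {0..})"
  by (simp add: hderiv_def has_real_derivative_iff_has_vector_derivative vector_derivative_works)

lemma hderiv_eqI:
  assumes "x \<ge> 0" "(g has_real_derivative D) (at x within {0..})"
  shows "hderiv g x = D"
proof -
  have "at_right x \<le> at x within {0..}" using assms(1) by (intro at_le) auto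
  then have "at x within {0..} \<noteq> bot"
    using trivial_limit_at_right_real[of x] by (metis bot.extremum_uniqueI)
  then show ?thesis unfolding hderiv_def
    using assms(2) by (intro vector_derivative_within) (simp_all add: has_real_derivative_iff_has_vector_derivative)
qed

locale star_density = star_limit d l0 C \<alpha> \<gamma> \<xi> \<nu> eps N M X W Z J
  for d l0 :: nat
    and C :: "nat \<Rightarrow> nat \<Rightarrow> real"
    and \<alpha> \<gamma> \<xi> \<nu> :: real
    and eps :: "nat \<Rightarrow> real"
    and N :: "nat \<Rightarrow> nat"
    and M :: "nat \<Rightarrow> 'w measure"
    and X :: "nat \<Rightarrow> real \<Rightarrow> 'w \<Rightarrow> nat \<times> nat"
    and W :: "'v measure"
    and Z :: "real \<Rightarrow> 'v \<Rightarrow> real"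
    and J :: "real \<Rightarrow> 'v \<Rightarrow> nat" +
  fixes f :: "real \<Rightarrow> nat \<Rightarrow> real \<Rightarrow> real"
  assumes dens: "limit_density d eps M X W Z J f"
    and smooth: "smooth_on_rays d f"
begin

definition fx where "fx j t x = hderiv (\<lambda>y. f y j t) x"
definition fxx where "fxx j t x = hderiv (hderiv (\<lambda>y. f y j t)) x"
definition ft where "ft j x t = hderiv (\<lambda>s. f x j s) t"

lemma f_derivs:
  assumes "j \<in> {1..d}" "t \<ge> 0"
  shows "x \<ge> 0 \<Longrightarrow> (x, t) \<noteq> (0, 0) \<Longrightarrow> ((\<lambda>y. f y j t) has_real_derivative fx j t x) (at x within {0..})"
    "x > 0 \<Longrightarrow> (fx j t has_real_derivative fxx j t x) (at x within {0..})"
    "x > 0 \<Longrightarrow> ((\<lambda>s. f x j s) has_real_derivative ft j x t) (at t within {0..})"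
proof -
  have eta: "fx j t = hderiv (\<lambda>y. f y j t)" by (rule ext) (simp add: fx_def)
  show "x \<ge> 0 \<Longrightarrow> (x, t) \<noteq> (0, 0) \<Longrightarrow> ((\<lambda>y. f y j t) has_real_derivative fx j t x) (at x within {0..})"
    "x > 0 \<Longrightarrow> (fx j t has_real_derivative fxx j t x) (at x within {0..})"
    "x > 0 \<Longrightarrow> ((\<lambda>s. f x j s) has_real_derivative ft j x t) (at t within {0..})"
    unfolding eta fxx_def ft_def using smooth assms unfolding smooth_on_rays_def by (auto intro!: hderiv_works)
qed

lemma f_cont:
  assumes "j \<in> {1..d}"
  shows "continuous_on ({0..} \<times> {0..} - {(0, 0)}) (\<lambda>(x, t). f x j t)"
    "continuous_on ({0..} \<times> {0..} - {(0, 0)}) (\<lambda>(x, t). fx j t x)"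
    "continuous_on ({0<..} \<times> {0..}) (\<lambda>(x, t). ft j x t)"
  using smooth assms unfolding smooth_on_rays_def fx_def ft_def by auto

text \<open>The probability current through \<open>x\<close> on ray \<open>j\<close>, counted
  positive towards the vertex; it is the \<open>B\<close> of the overview, with
  \<open>\<alpha> * \<beta>\<close> and \<open>\<sigma>^2\<close> written out.\<close>

definition flux where "flux j x t = (\<alpha> * x - \<gamma> * \<nu>) * f x j t + \<alpha> * \<nu> / 2 * fx j t x"

lemma flux_cont:
  assumes "j \<in> {1..d}"
  shows "continuous_on ({0..} \<times> {0..} - {(0, 0)}) (\<lambda>(x, t). flux j x t)"
  using f_cont(1,2)[OF assms] unfolding flux_def by (auto simp: split_beta intro!: continuous_intros)

lemma cont_x:
  fixes g :: "real \<times> real \<Rightarrow> real"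
  assumes "continuous_on ({0..} \<times> {0..} - {(0, 0)}) g" "t \<ge> 0" "a \<ge> 0" "(a, t) \<noteq> (0, 0)"
  shows "continuous_on {a..} (\<lambda>x. g (x, t))" "continuous_on {a..b} (\<lambda>x. g (x, t))"
proof -
  show c: "continuous_on {a..} (\<lambda>x. g (x, t))"
    by (rule continuous_on_compose2[OF assms(1)]) (use assms in \<open>auto intro!: continuous_intros\<close>)
  show "continuous_on {a..b} (\<lambda>x. g (x, t))" by (rule continuous_on_subset[OF c]) auto
qed

lemma cont_t:
  fixes g :: "real \<times> real \<Rightarrow> real"
  assumes "continuous_on ({0..} \<times> {0..} - {(0, 0)}) g" "s \<ge> 0" "a \<ge> 0" "(a, s) \<noteq> (0, 0)"
  shows "continuous_on {s..u} (\<lambda>t. g (a, t))"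
  by (rule continuous_on_compose2[OF assms(1)]) (use assms in \<open>auto intro!: continuous_intros\<close>)

lemma E_meas:
  fixes g :: "real \<Rightarrow> real"
  assumes [measurable]: "g \<in> borel_measurable borel" and t: "t \<ge> 0"
  shows "(\<lambda>v. if J t v = j then g (Z t v) else 0) \<in> borel_measurable W"
proof -
  note [measurable] = Z_meas[OF t] J_pred[OF t]
  show ?thesis by measurable
qed

lemma E_integrable:
  fixes g :: "real \<Rightarrow> real"
  assumes "g \<in> borel_measurable borel" "t \<ge> 0" "\<And>x. \<bar>g x\<bar> \<le> B"
  shows "integrable W (\<lambda>v. if J t v = j then g (Z t v) else 0)"
proof (rule W.integrable_const_bound[of _ B])
  have "B \<ge> 0" using assms(3)[of 0] by linarith
  then show "AE v in W. norm (if J t v = j then g (Z t v) else 0) \<le> B" using assms(3) by auto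
qed (rule E_meas[OF assms(1,2)])

text \<open>\<open>density_of_right_derivative\<close> is applied to the law of \<open>Z t\<close>
  restricted to \<open>J t = j\<close> and \<open>Z t \<ge> a\<close>. Since
  \<open>Z t \<ge> 0\<close> and \<open>g\<close> vanishes on the rest of the ray, the restriction
  loses nothing. For \<open>t > 0\<close> the choice \<open>a = 0\<close> is allowed.\<close>

lemma E_density:
  assumes t: "t \<ge> 0" and a: "a \<ge> 0" "(a, t) \<noteq> (0, 0)" and j: "j \<in> {1..d}"
    and g: "g \<in> borel_measurable borel" and g0: "\<And>x. 0 \<le> x \<Longrightarrow> x < a \<Longrightarrow> g x = 0"
  shows "E g j t = (LINT x|lborel. indicator {a..} x * f x j t * g x)"
    and "\<And>x. x \<ge> a \<Longrightarrow> f x j t \<ge> 0"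
proof -
  note [measurable] = Z_meas[OF t] J_pred[OF t] g
  define A where "A = {v \<in> space W. J t v = j \<and> a \<le> Z t v}"
  have A[measurable]: "A \<in> sets W" unfolding A_def by measurable
  define \<mu> where "\<mu> = distr (density W (indicator A)) borel (Z t)"
  have em: "emeasure \<mu> B = emeasure W {v \<in> space W. J t v = j \<and> a \<le> Z t v \<and> Z t v \<in> B}" if [measurable]: "B \<in> sets borel" for B
  proof -
    have "emeasure \<mu> B = emeasure (density W (indicator A)) (Z t -` B \<inter> space W)"
      unfolding \<mu>_def by (subst emeasure_distr) auto
    also have "\<dots> = emeasure W (A \<inter> (Z t -` B \<inter> space W))"
      by (rule emeasure_restricted) auto
    also have "A \<inter> (Z t -` B \<inter> space W) = {v \<in> space W. J t v = j \<and> a \<le> Z t v \<and> Z t v \<in> B}"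
      by (auto simp: A_def)
    finally show ?thesis .
  qed
  have fin: "finite_borel_measure \<mu>"
    unfolding finite_borel_measure_def finite_borel_measure_axioms_def
    using em[of UNIV] by (auto intro!: finite_measureI simp: \<mu>_def)
  have ms: "measure \<mu> B = measure W {v \<in> space W. J t v = j \<and> a \<le> Z t v \<and> Z t v \<in> B}" if "B \<in> sets borel" for B
    unfolding measure_def em[OF that] ..
  have lim: "((\<lambda>h. measure \<mu> {x..<x + h} / h) \<longlongrightarrow> f x j t) (at_right 0)" if x: "x \<ge> a" for x
  proof -
    have "measure \<mu> {x..<x + h} = measure W {w \<in> space W. x \<le> Z t w \<and> Z t w < x + h \<and> J t w = j}" for h
      unfolding ms[OF atLeastLessThan_borel] using x by (intro arg_cong[of _ _ "measure W"]) auto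
    then show ?thesis using dens x a t j unfolding limit_density_def by auto
  qed
  show f0: "f x j t \<ge> 0" if "x \<ge> a" for x
    by (rule tendsto_lowerbound[OF lim[OF that]])
       (use eventually_at_right_less[of "0::real"] in \<open>auto elim!: eventually_mono\<close>)
  have fc: "continuous_on {a..} (\<lambda>x. f x j t)"
    using cont_x(1)[OF f_cont(1)[OF j] t a] by simp
  have eq: "\<mu> = density lborel (\<lambda>x. ennreal (indicator {a..} x * f x j t))"
  proof (rule density_of_right_derivative[OF fin fc _ lim])
    have "{v \<in> space W. J t v = j \<and> a \<le> Z t v \<and> Z t v \<in> {..<a}} = {}" by auto
    then show "measure \<mu> {..<a} = 0" unfolding ms[OF lessThan_borel] by (simp only: measure_empty)
  qed
  have bm: "(\<lambda>x. indicator {a..} x * f x j t) \<in> borel_measurable lborel"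
    using borel_measurable_continuous_on_indicator[OF _ fc] by (simp add: mult.commute)
  have "E g j t = (LINT v|W. indicator A v * g (Z t v))"
    unfolding E_def by (rule Bochner_Integration.integral_cong) (use g0 Z_nonneg t in \<open>auto simp: A_def indicator_def not_le\<close>)
  also have "\<dots> = (LINT v|density W (indicator A). g (Z t v))"
  proof -
    have "density W (indicator A) = density W (\<lambda>v. ennreal (indicator A v))" 
      by (rule arg_cong[of _ _ "density W"]) (auto simp: indicator_def fun_eq_iff)
    then show ?thesis by (simp add: integral_real_density)
  qed
  also have "\<dots> = (LINT x|\<mu>. g x)" unfolding \<mu>_def by (subst integral_distr) auto
  also have "\<dots> = (LINT x|lborel. indicator {a..} x * f x j t * g x)"
    unfolding eq using bm f0 by (subst integral_real_density) (auto simp: indicator_def)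
  finally show "E g j t = (LINT x|lborel. indicator {a..} x * f x j t * g x)" .
qed

lemma E_density_Icc:
  assumes t: "t \<ge> 0" and a: "a \<ge> 0" "(a, t) \<noteq> (0, 0)" and j: "j \<in> {1..d}"
    and g: "g \<in> borel_measurable borel" and g0: "\<And>x. 0 \<le> x \<Longrightarrow> x < a \<or> x > b \<Longrightarrow> g x = 0"
    and gc: "continuous_on {a..b} g"
  shows "E g j t = integral {a..b} (\<lambda>x. f x j t * g x)"
proof -
  have "E g j t = (LINT x|lborel. indicator {a..} x * f x j t * g x)"
    using E_density(1)[OF t a j g] g0 by blast
  also have "\<dots> = (LINT x:{a..b}|lborel. f x j t * g x)"
    unfolding set_lebesgue_integral_def
    by (rule Bochner_Integration.integral_cong) (use g0 a in \<open>auto simp: indicator_def not_le\<close>)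
  also have "\<dots> = integral {a..b} (\<lambda>x. f x j t * g x)"
  proof (rule set_borel_integral_eq_integral)
    show "set_integrable lborel {a..b} (\<lambda>x. f x j t * g x)"
      using cont_x(2)[OF f_cont(1)[OF j] t a, of b] gc
      by (intro borel_integrable_atLeastAtMost') (auto intro!: continuous_intros)
  qed
  finally show ?thesis .
qed

text \<open>One integration by parts moves a derivative from \<open>cutoff''\<close> to
  \<open>f\<close>; the boundary terms vanish with \<open>cutoff'\<close> at both ends. It stops
  after one step because \<open>cutoff'\<close> is the kernel that concentrates at
  \<open>a\<close>.\<close>

lemma E_drift_diffusion:
  assumes t: "t \<ge> 0" and a: "a > 0" and w: "w > 0" and j: "j \<in> {1..d}"
  shows "E (drift_diffusion \<alpha> \<gamma> \<nu> a w) j t = - integral {a..a + 3 * w} (\<lambda>x. cutoff' a w x * flux j x t)"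
proof -
  let ?I = "{a..a + 3 * w}"
  have cc: "continuous_on A (cutoff' a w)" for A
    by (rule DERIV_continuous_on) (rule has_field_derivative_at_within[OF cutoff_derivs(2)[OF w]])
  have dc: "continuous_on A (drift_diffusion \<alpha> \<gamma> \<nu> a w)" for A by (rule continuous_on_cutoff[OF w])
  have fc: "continuous_on ?I (\<lambda>x. f x j t)" "continuous_on ?I (\<lambda>x. flux j x t)"
    using cont_x(2)[OF f_cont(1)[OF j] t, of a "a + 3 * w"] cont_x(2)[OF flux_cont[OF j] t, of a "a + 3 * w"] a by auto
  have "E (drift_diffusion \<alpha> \<gamma> \<nu> a w) j t = integral ?I (\<lambda>x. f x j t * drift_diffusion \<alpha> \<gamma> \<nu> a w x)"
  proof (rule E_density_Icc[OF t _ _ j])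
    show "drift_diffusion \<alpha> \<gamma> \<nu> a w \<in> borel_measurable borel"
      by (rule borel_measurable_continuous_onI[OF dc])
    show "drift_diffusion \<alpha> \<gamma> \<nu> a w x = 0" if "x < a \<or> x > a + 3 * w" for x
      using cutoff_eq(3,4)[OF w, of x a] that by (auto simp: drift_diffusion_def)
  qed (use a dc in auto)
  moreover have "((\<lambda>x. f x j t * drift_diffusion \<alpha> \<gamma> \<nu> a w x + cutoff' a w x * flux j x t) has_integral
     \<alpha> * \<nu> / 2 * (cutoff' a w (a + 3 * w) * f (a + 3 * w) j t) - \<alpha> * \<nu> / 2 * (cutoff' a w a * f a j t)) ?I"
  proof (rule fundamental_theorem_of_calculus)
    fix x assume x: "x \<in> ?I"
    have "((\<lambda>y. f y j t) has_real_derivative fx j t x) (at x within ?I)"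
      by (rule DERIV_subset[OF f_derivs(1)[OF j t]]) (use x a in auto)
    moreover have "(cutoff' a w has_real_derivative cutoff'' a w x) (at x within ?I)"
      by (rule has_field_derivative_at_within[OF cutoff_derivs(2)[OF w]])
    ultimately have "((\<lambda>x. \<alpha> * \<nu> / 2 * (cutoff' a w x * f x j t)) has_real_derivative
       \<alpha> * \<nu> / 2 * (cutoff' a w x * fx j t x + cutoff'' a w x * f x j t)) (at x within ?I)"
      by (auto intro!: derivative_eq_intros)
    moreover have "\<alpha> * \<nu> / 2 * (cutoff' a w x * fx j t x + cutoff'' a w x * f x j t) =
       f x j t * drift_diffusion \<alpha> \<gamma> \<nu> a w x + cutoff' a w x * flux j x t"
      unfolding drift_diffusion_def flux_def by (simp add: algebra_simps)
    ultimately show "((\<lambda>x. \<alpha> * \<nu> / 2 * (cutoff' a w x * f x j t)) has_vector_derivative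
       f x j t * drift_diffusion \<alpha> \<gamma> \<nu> a w x + cutoff' a w x * flux j x t) (at x within ?I)"
      unfolding has_real_derivative_iff_has_vector_derivative[symmetric] by (simp only:)
  qed (use w in auto)
  then have "integral ?I (\<lambda>x. f x j t * drift_diffusion \<alpha> \<gamma> \<nu> a w x + cutoff' a w x * flux j x t) = 0"
    using cutoff_eq(3)[OF w] by (simp add: integral_unique)
  moreover have "integral ?I (\<lambda>x. f x j t * drift_diffusion \<alpha> \<gamma> \<nu> a w x + cutoff' a w x * flux j x t) =
     integral ?I (\<lambda>x. f x j t * drift_diffusion \<alpha> \<gamma> \<nu> a w x) + integral ?I (\<lambda>x. cutoff' a w x * flux j x t)"
    by (rule integral_add) (intro integrable_continuous_real continuous_intros fc dc cc)+
  ultimately show ?thesis by simp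
qed

section \<open>The mass beyond a point\<close>

definition tail where "tail j a t = measure W {v \<in> space W. a < Z t v \<and> J t v = j}"

lemma tail_eq_E: "t \<ge> 0 \<Longrightarrow> tail j a t = E (indicator {a<..}) j t"
proof -
  assume t: "t \<ge> 0"
  note [measurable] = Z_meas[OF t] J_pred[OF t]
  have "E (indicator {a<..}) j t = (LINT v|W. indicator {v \<in> space W. a < Z t v \<and> J t v = j} v)"
    unfolding E_def by (rule Bochner_Integration.integral_cong) (auto simp: indicator_def)
  then show ?thesis by (simp add: tail_def Int_def conj_commute)
qed

text \<open>The limit \<open>w\<close> to 0 in \<open>weak_forward_equation\<close>: the cutoffs
  tend pointwise to the indicator of \<open>{a<..}\<close>, being 0 at \<open>a\<close> itself, and
  the smeared current tends to its value at \<open>a\<close>. The case \<open>s = 0\<close> is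
  included, which the initial condition needs.\<close>

lemma tail_equation:
  assumes a: "a > 0" and st: "0 \<le> s" "s \<le> t" and j: "j \<in> {1..d}"
  shows "((\<lambda>r. - flux j a r - \<xi> * tail j a r) has_integral tail j a t - tail j a s) {s..t}"
proof -
  define w where "w m = inverse (real (Suc m))" for m
  have w: "w m > 0" "w m \<le> 1" for m by (auto simp: w_def inverse_le_1_iff)
  have w0: "w \<longlonglongrightarrow> 0" unfolding w_def by (rule LIMSEQ_inverse_real_of_nat)
  have cm: "cutoff a (w m) \<in> borel_measurable borel" "drift_diffusion \<alpha> \<gamma> \<nu> a (w m) \<in> borel_measurable borel" for m
    by (intro borel_measurable_continuous_onI continuous_on_cutoff w)+
  have Ecut: "(\<lambda>m. E (cutoff a (w m)) j r) \<longlonglongrightarrow> tail j a r" if r: "r \<ge> 0" for r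
    unfolding tail_eq_E[OF r] E_def
  proof (rule integral_dominated_convergence[where w = "\<lambda>_. 36"])
    show "AE v in W. (\<lambda>m. if J r v = j then cutoff a (w m) (Z r v) else 0) \<longlonglongrightarrow>
        (if J r v = j then indicator {a<..} (Z r v) else 0)"
    proof (rule AE_I2)
      fix v
      have "(\<lambda>m. cutoff a (w m) x) \<longlonglongrightarrow> indicator {a<..} x" for x
      proof (cases "x \<le> a")
        case False
        then have "\<forall>\<^sub>F m in sequentially. w m < (x - a) / 3" by (intro order_tendstoD[OF w0]) auto
        then have "\<forall>\<^sub>F m in sequentially. cutoff a (w m) x = 1"
          by eventually_elim (rule cutoff_eq(2)[OF w(1)], simp)
        then show ?thesis using False by (simp add: tendsto_eventually)
      qed (simp add: cutoff_eq(1)[OF w(1)])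
      then show "(\<lambda>m. if J r v = j then cutoff a (w m) (Z r v) else 0) \<longlonglongrightarrow>
        (if J r v = j then indicator {a<..} (Z r v) else 0)" by simp
    qed
    show "AE v in W. norm (if J r v = j then cutoff a (w m) (Z r v) else 0) \<le> 36" for m
      using cutoff_bounds(1)[OF w(1)] by auto
  qed (use r cm in \<open>auto intro!: E_meas\<close>)
  have split: "E (\<lambda>x. drift_diffusion \<alpha> \<gamma> \<nu> a (w m) x - \<xi> * cutoff a (w m) x) j r =
      - integral {a..a + 3 * w m} (\<lambda>x. cutoff' a (w m) x * flux j x r) - \<xi> * E (cutoff a (w m)) j r" if r: "r \<ge> 0" for m r
  proof -
    obtain B where B: "\<And>x. \<bar>drift_diffusion \<alpha> \<gamma> \<nu> a (w m) x\<bar> \<le> B"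
      using drift_diffusion_bounded[OF w(1), where \<alpha> = \<alpha> and \<gamma> = \<gamma> and \<nu> = \<nu> and a = a] by blast
    have "E (\<lambda>x. drift_diffusion \<alpha> \<gamma> \<nu> a (w m) x - \<xi> * cutoff a (w m) x) j r =
       (LINT v|W. (if J r v = j then drift_diffusion \<alpha> \<gamma> \<nu> a (w m) (Z r v) else 0) - \<xi> * (if J r v = j then cutoff a (w m) (Z r v) else 0))"
      unfolding E_def by (rule Bochner_Integration.integral_cong) auto
    also have "\<dots> = E (drift_diffusion \<alpha> \<gamma> \<nu> a (w m)) j r - \<xi> * E (cutoff a (w m)) j r"
      unfolding E_def
      by (subst Bochner_Integration.integral_diff)
         (auto intro!: E_integrable[OF cm(2) r B] E_integrable[OF cm(1) r cutoff_bounds(1)[OF w(1)]])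
    finally show ?thesis by (simp add: E_drift_diffusion[OF r a w(1) j])
  qed
  \<comment> \<open>Since \<open>a > 0\<close>, the compact rectangle avoids the excluded corner
    \<open>(0, 0)\<close> even when \<open>s = 0\<close>.\<close>
  obtain K where K: "\<And>x r. x \<in> {a..a + 3} \<Longrightarrow> r \<in> {s..t} \<Longrightarrow> \<bar>flux j x r\<bar> \<le> K"
  proof -
    have "continuous_on ({a..a + 3} \<times> {s..t}) (\<lambda>(x, t). flux j x t)"
      by (rule continuous_on_subset[OF flux_cont[OF j]]) (use a st in auto)
    then have "compact ((\<lambda>(x, t). flux j x t) ` ({a..a + 3} \<times> {s..t}))"
      by (intro compact_continuous_image compact_Times) auto
    then obtain K where "\<forall>y \<in> (\<lambda>(x, t). flux j x t) ` ({a..a + 3} \<times> {s..t}). norm y \<le> K"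
      using compact_imp_bounded bounded_iff by metis
    then show ?thesis by (intro that[of K]) auto
  qed
  have fc: "continuous_on {a..b} (\<lambda>x. flux j x r)" if "r \<ge> 0" for r b
    using cont_x(2)[OF flux_cont[OF j] that, of a b] a by auto
  show ?thesis
  proof (rule has_integral_dominated_convergence)
    show "((\<lambda>r. - integral {a..a + 3 * w m} (\<lambda>x. cutoff' a (w m) x * flux j x r) - \<xi> * E (cutoff a (w m)) j r)
        has_integral E (cutoff a (w m)) j t - E (cutoff a (w m)) j s) {s..t}" for m
      by (rule has_integral_eq[OF _ weak_forward_equation[OF a w(1) st j]]) (use split st in auto)
    show "(\<lambda>m. E (cutoff a (w m)) j t - E (cutoff a (w m)) j s) \<longlonglongrightarrow> tail j a t - tail j a s"
      using st by (intro tendsto_diff Ecut) auto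
    show "(\<lambda>_. 108 * K + \<xi> * 36) integrable_on {s..t}" by (rule integrable_const_ivl)
    show "\<forall>r\<in>{s..t}. norm (- integral {a..a + 3 * w m} (\<lambda>x. cutoff' a (w m) x * flux j x r) - \<xi> * E (cutoff a (w m)) j r)
        \<le> 108 * K + \<xi> * 36" for m
    proof
      fix r assume r: "r \<in> {s..t}"
      then have r0: "r \<ge> 0" using st by simp
      have 1: "\<bar>integral {a..a + 3 * w m} (\<lambda>x. cutoff' a (w m) x * flux j x r)\<bar> \<le> 108 * K"
        by (rule integral_cutoff'_bound[OF w(1) K fc[OF r0]]) (use r w(2)[of m] in auto)
      have "\<bar>E (cutoff a (w m)) j r\<bar> \<le> (LINT v|W. 36)"
      proof -
        have "\<bar>E (cutoff a (w m)) j r\<bar> \<le> (LINT v|W. norm (if J r v = j then cutoff a (w m) (Z r v) else 0))"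
          unfolding E_def real_norm_def[symmetric] by (rule integral_norm_bound)
        also have "\<dots> \<le> (LINT v|W. 36)"
          using cutoff_bounds(1)[OF w(1)]
          by (intro integral_mono integrable_norm E_integrable[OF cm(1) r0 cutoff_bounds(1)[OF w(1)]]) auto
        finally show ?thesis .
      qed
      then have "\<xi> * \<bar>E (cutoff a (w m)) j r\<bar> \<le> \<xi> * 36" using par by (simp add: W.prob_space)
      then have "\<bar>\<xi> * E (cutoff a (w m)) j r\<bar> \<le> \<xi> * 36" using par by (simp add: abs_mult)
      then show "norm (- integral {a..a + 3 * w m} (\<lambda>x. cutoff' a (w m) x * flux j x r) - \<xi> * E (cutoff a (w m)) j r)
        \<le> 108 * K + \<xi> * 36" unfolding real_norm_def using 1 by linarith
    qed
    show "\<forall>r\<in>{s..t}. (\<lambda>m. - integral {a..a + 3 * w m} (\<lambda>x. cutoff' a (w m) x * flux j x r) - \<xi> * E (cutoff a (w m)) j r)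
        \<longlonglongrightarrow> - flux j a r - \<xi> * tail j a r"
    proof
      fix r assume r: "r \<in> {s..t}"
      then have r0: "r \<ge> 0" using st by simp
      show "(\<lambda>m. - integral {a..a + 3 * w m} (\<lambda>x. cutoff' a (w m) x * flux j x r) - \<xi> * E (cutoff a (w m)) j r)
        \<longlonglongrightarrow> - flux j a r - \<xi> * tail j a r"
        unfolding w_def
        by (intro tendsto_diff tendsto_minus tendsto_mult tendsto_const Ecut[OF r0, unfolded w_def] integral_cutoff'_tendsto fc[OF r0])
    qed
  qed
qed

section \<open>The mass of an interval and the differential equation\<close>

lemma E_diff:
  fixes g h :: "real \<Rightarrow> real"
  assumes "g \<in> borel_measurable borel" "h \<in> borel_measurable borel" "t \<ge> 0"
    "\<And>x. \<bar>g x\<bar> \<le> B" "\<And>x. \<bar>h x\<bar> \<le> B"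
  shows "E (\<lambda>x. g x - h x) j t = E g j t - E h j t"
proof -
  have "E (\<lambda>x. g x - h x) j t = (LINT v|W. (if J t v = j then g (Z t v) else 0) - (if J t v = j then h (Z t v) else 0))"
    unfolding E_def by (rule Bochner_Integration.integral_cong) auto
  also have "\<dots> = E g j t - E h j t"
    unfolding E_def
    by (rule Bochner_Integration.integral_diff) (rule E_integrable[OF assms(1,3,4)], rule E_integrable[OF assms(2,3,5)])
  finally show ?thesis .
qed

lemma E_singleton:
  assumes t: "t \<ge> 0" and a: "a \<ge> 0" "(a, t) \<noteq> (0, 0)" and j: "j \<in> {1..d}"
  shows "E (indicator {a}) j t = 0"
proof -
  have "E (indicator {a}) j t = integral {a..a} (\<lambda>x. f x j t * indicator {a} x)"
    by (rule E_density_Icc[OF t a j]) (use a in \<open>auto simp: indicator_def\<close>)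
  then show ?thesis by simp
qed

lemma tail_diff:
  assumes t: "t \<ge> 0" and a: "a > 0" "a \<le> b" and j: "j \<in> {1..d}"
  shows "tail j a t - tail j b t = integral {a..b} (\<lambda>x. f x j t)"
proof -
  have "tail j a t - tail j b t = E (\<lambda>x. indicator {a<..} x - indicator {b<..} x) j t"
    unfolding tail_eq_E[OF t] by (rule E_diff[symmetric, where B = 1]) (use t in \<open>auto simp: indicator_def\<close>)
  also have "(\<lambda>x. indicator {a<..} x - indicator {b<..} x :: real) = (\<lambda>x. indicator {a..b} x - indicator {a} x)"
    using a by (auto simp: indicator_def fun_eq_iff)
  also have "E \<dots> j t = E (indicator {a..b}) j t - E (indicator {a}) j t"
    by (rule E_diff[where B = 1]) (use t in \<open>auto simp: indicator_def\<close>)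
  also have "\<dots> = E (indicator {a..b}) j t" using E_singleton[OF t _ _ j, of a] a by simp
  also have "\<dots> = integral {a..b} (\<lambda>x. f x j t * indicator {a..b} x)"
  proof (rule E_density_Icc[OF t _ _ j])
    show "continuous_on {a..b} (indicator {a..b} :: real \<Rightarrow> real)"
      by (rule continuous_on_cong[THEN iffD1, OF refl _ continuous_on_const[of _ 1]]) auto
  qed (use a in \<open>auto simp: indicator_def\<close>)
  also have "\<dots> = integral {a..b} (\<lambda>x. f x j t)" by (rule integral_cong) simp
  finally show ?thesis .
qed

text \<open>Both sides are the derivative at \<open>r\<close> of the mass of \<open>{a..b}\<close>.\<close>
lemma mass_balance:
  assumes r: "r \<ge> 0" and a: "a > 0" "a \<le> b" and j: "j \<in> {1..d}"
  shows "integral {a..b} (\<lambda>x. ft j x r) = flux j b r - flux j a r - \<xi> * integral {a..b} (\<lambda>x. f x j r)"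
proof -
  define F where "F u = integral {a..b} (\<lambda>x. f x j u)" for u
  define q where "q u = flux j b u - flux j a u - \<xi> * F u" for u
  have dF: "(F has_real_derivative integral {a..b} (\<lambda>x. ft j x u)) (at u within {0..})" if u: "u \<ge> 0" for u
    unfolding F_def box_real[symmetric]
  proof (rule leibniz_rule_field_derivative[where fx = "\<lambda>u x. ft j x u"])
    show "((\<lambda>u. f x j u) has_real_derivative ft j x u) (at u within {0..})" if "u \<in> {0..}" "x \<in> cbox a b" for u x
      using f_derivs(3)[OF j] that a by auto
    show "(\<lambda>x. f x j u) integrable_on cbox a b" if "u \<in> {0..}" for u
      using cont_x(2)[OF f_cont(1)[OF j], of u a b] that a by (auto intro!: integrable_continuous_real)
    show "continuous_on ({0..} \<times> cbox a b) (\<lambda>(u, x). ft j x u)"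
    proof -
      have "continuous_on ({0..} \<times> cbox a b) (\<lambda>p. (\<lambda>(x, t). ft j x t) (snd p, fst p))"
        by (rule continuous_on_compose2[OF f_cont(3)[OF j]]) (use a in \<open>auto intro!: continuous_intros\<close>)
      then show ?thesis by (simp add: split_beta)
    qed
  qed (use u in \<open>auto simp: convex_real_interval\<close>)
  have Fc: "continuous_on {0..} F" by (rule DERIV_continuous_on) (use dF in auto)
  have qc: "continuous_on {r..r + 1} q"
    unfolding q_def
    using cont_t[OF flux_cont[OF j], of r a "r + 1"] cont_t[OF flux_cont[OF j], of r b "r + 1"] r a
    by (auto intro!: continuous_intros continuous_on_subset[OF Fc])
  have Fq: "F u = F r + integral {r..u} q" if u: "r \<le> u" for u
  proof -
    have "((\<lambda>v. (- flux j a v - \<xi> * tail j a v) - (- flux j b v - \<xi> * tail j b v)) has_integral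
        (tail j a u - tail j a r) - (tail j b u - tail j b r)) {r..u}"
      by (intro has_integral_diff tail_equation) (use a r u j in auto)
    moreover have "(- flux j a v - \<xi> * tail j a v) - (- flux j b v - \<xi> * tail j b v) = q v" if "v \<in> {r..u}" for v
    proof -
      have "v \<ge> 0" using that r by simp
      then show ?thesis unfolding q_def F_def tail_diff[OF \<open>v \<ge> 0\<close> a j, symmetric] by (simp add: algebra_simps)
    qed
    ultimately have "(q has_integral (tail j a u - tail j a r) - (tail j b u - tail j b r)) {r..u}"
      by (rule has_integral_eq[rotated])
    then have "integral {r..u} q = (tail j a u - tail j b u) - (tail j a r - tail j b r)"
      by (simp add: integral_unique)
    then show ?thesis using r u by (simp add: F_def tail_diff[OF _ a j])
  qed
  have "integral {a..b} (\<lambda>x. ft j x r) = q r"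
  proof (rule has_right_derivative_unique[of r "r + 1" F])
    show "(F has_real_derivative integral {a..b} (\<lambda>x. ft j x r)) (at r within {r..r + 1})"
      by (rule DERIV_subset[OF dF[OF r]]) (use r in auto)
    have "((\<lambda>u. F r + integral {r..u} q) has_real_derivative 0 + q r) (at r within {r..r + 1})"
      by (intro DERIV_add DERIV_const integral_has_right_derivative qc) simp
    then have "((\<lambda>u. F r + integral {r..u} q) has_real_derivative q r) (at r within {r..r + 1})" by simp
    then show "(F has_real_derivative q r) (at r within {r..r + 1})"
      by (rule has_field_derivative_transform_within[of _ _ _ _ 1]) (auto simp flip: Fq)
  qed simp
  then show ?thesis by (simp add: q_def F_def)
qed

text \<open>Both sides of \<open>mass_balance\<close> on \<open>{x..b}\<close> are differentiated
  from the right in \<open>b\<close> at \<open>b = x\<close>.\<close>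

lemma pde:
  assumes t: "t \<ge> 0" and x: "x > 0" and j: "j \<in> {1..d}"
  shows "ft j x t = \<alpha> * f x j t + (\<alpha> * x - \<gamma> * \<nu>) * fx j t x + \<alpha> * \<nu> / 2 * fxx j t x - \<xi> * f x j t"
proof -
  define G where "G b = integral {x..b} (\<lambda>y. ft j y t)" for b
  have ftc: "continuous_on {x..x + 1} (\<lambda>y. ft j y t)"
  proof -
    have "continuous_on {x..x + 1} (\<lambda>y. (\<lambda>(x, t). ft j x t) (y, t))"
      by (rule continuous_on_compose2[OF f_cont(3)[OF j]]) (use x t in \<open>auto intro!: continuous_intros\<close>)
    then show ?thesis by simp
  qed
  have fc: "continuous_on {x..x + 1} (\<lambda>y. f y j t)"
    using cont_x(2)[OF f_cont(1)[OF j] t, of x "x + 1"] x by simp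
  show ?thesis
  proof (rule has_right_derivative_unique[of x "x + 1" G])
    show "(G has_real_derivative ft j x t) (at x within {x..x + 1})"
      unfolding G_def by (rule integral_has_right_derivative[OF _ ftc]) simp
    have "((\<lambda>b. flux j b t) has_real_derivative
       (\<alpha> * f x j t + (\<alpha> * x - \<gamma> * \<nu>) * fx j t x + \<alpha> * \<nu> / 2 * fxx j t x)) (at x within {0..})"
      unfolding flux_def using x t j
      by (auto intro!: derivative_eq_intros f_derivs[OF j t] simp: algebra_simps)
    then have "((\<lambda>b. flux j b t) has_real_derivative
       (\<alpha> * f x j t + (\<alpha> * x - \<gamma> * \<nu>) * fx j t x + \<alpha> * \<nu> / 2 * fxx j t x)) (at x within {x..x + 1})"
      by (rule DERIV_subset) (use x in auto)
    then have "((\<lambda>b. flux j b t - flux j x t - \<xi> * integral {x..b} (\<lambda>y. f y j t)) has_real_derivative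
       (\<alpha> * f x j t + (\<alpha> * x - \<gamma> * \<nu>) * fx j t x + \<alpha> * \<nu> / 2 * fxx j t x) - 0 - \<xi> * f x j t) (at x within {x..x + 1})"
      by (intro DERIV_diff DERIV_const DERIV_cmult integral_has_right_derivative fc) auto
    then have "((\<lambda>b. flux j b t - flux j x t - \<xi> * integral {x..b} (\<lambda>y. f y j t)) has_real_derivative
       (\<alpha> * f x j t + (\<alpha> * x - \<gamma> * \<nu>) * fx j t x + \<alpha> * \<nu> / 2 * fxx j t x) - \<xi> * f x j t) (at x within {x..x + 1})"
      by simp
    then show "(G has_real_derivative
       (\<alpha> * f x j t + (\<alpha> * x - \<gamma> * \<nu>) * fx j t x + \<alpha> * \<nu> / 2 * fxx j t x) - \<xi> * f x j t) (at x within {x..x + 1})"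
      by (rule has_field_derivative_transform_within[of _ _ _ _ 1]) (use x t j in \<open>auto simp: G_def mass_balance\<close>)
  qed simp
qed

section \<open>The boundary condition at the vertex\<close>

lemma sum_phases:
  assumes t: "t \<ge> 0"
  shows "(\<Sum>j=1..d. E (\<lambda>_. 1) j t) = 1"
proof -
  have "(\<Sum>j=1..d. E (\<lambda>_. 1) j t) = (LINT v|W. (\<Sum>j=1..d. if J t v = j then 1 else 0))"
    unfolding E_def
    by (rule Bochner_Integration.integral_sum[symmetric]) (rule E_integrable[of "\<lambda>_. 1" t 1], use t in auto)
  also have "\<dots> = (LINT v|W. 1)"
    by (rule Bochner_Integration.integral_cong) (use measurable_space[OF J_meas[OF t]] in \<open>auto simp: sum.delta\<close>)
  finally show ?thesis by (simp add: W.prob_space)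
qed

lemma tail_le_1: "\<bar>tail j a t\<bar> \<le> 1"
  by (simp add: tail_def)

text \<open>Continuity from below gives the mass of the open ray. Since \<open>t > 0\<close>, the
  law has a density up to the vertex and hence no atom there, so this is the full mass of phase
  \<open>j\<close>.\<close>

lemma tail_tendsto:
  assumes t: "t > 0" and j: "j \<in> {1..d}"
  shows "(\<lambda>m. tail j (inverse (real (Suc m))) t) \<longlonglongrightarrow> E (\<lambda>_. 1) j t"
proof -
  have t0: "t \<ge> 0" using t by simp
  note [measurable] = Z_meas[OF t0] J_pred[OF t0]
  have "(\<lambda>m. tail j (inverse (real (Suc m))) t) \<longlonglongrightarrow>
     measure W (\<Union>m. {v \<in> space W. inverse (real (Suc m)) < Z t v \<and> J t v = j})"
    unfolding tail_def
  proof (rule W.finite_Lim_measure_incseq)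
    show "incseq (\<lambda>m. {v \<in> space W. inverse (real (Suc m)) < Z t v \<and> J t v = j})"
    proof (rule incseq_SucI)
      fix m
      have le: "inverse (real (Suc (Suc m))) \<le> inverse (real (Suc m))" by (intro le_imp_inverse_le) auto
      show "{v \<in> space W. inverse (real (Suc m)) < Z t v \<and> J t v = j}
          \<subseteq> {v \<in> space W. inverse (real (Suc (Suc m))) < Z t v \<and> J t v = j}"
        using le_less_trans[OF le] by blast
    qed
  qed auto
  also have "(\<Union>m. {v \<in> space W. inverse (real (Suc m)) < Z t v \<and> J t v = j}) = {v \<in> space W. 0 < Z t v \<and> J t v = j}"
  proof -
    have "0 < z \<longleftrightarrow> (\<exists>m. inverse (real (Suc m)) < z)" for z :: real
      using reals_Archimedean[of z] less_trans[of 0 "inverse (real (Suc _))" z] by auto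
    then show ?thesis by auto
  qed
  also have "measure W \<dots> = E (indicator {0<..}) j t"
    using tail_eq_E[OF t0, of j 0] by (simp add: tail_def)
  also have "\<dots> = E (\<lambda>x. 1 - indicator {0} x) j t"
    unfolding E_def by (rule Bochner_Integration.integral_cong) (use Z_nonneg[OF t0] in \<open>auto simp: indicator_def le_less\<close>)
  also have "\<dots> = E (\<lambda>_. 1) j t - E (indicator {0}) j t"
    by (rule E_diff[where B = 1]) (use t in \<open>auto simp: indicator_def\<close>)
  finally show ?thesis using E_singleton[OF t0 _ _ j, of 0] t by simp
qed

text \<open>\<open>tail_equation\<close> with \<open>a\<close> tending to 0. Because
  \<open>s > 0\<close>, the current is continuous, hence bounded, on a rectangle that reaches
  \<open>x = 0\<close>.\<close>

lemma flux_at_vertex: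
  assumes st: "0 < s" "s \<le> t" and j: "j \<in> {1..d}"
  shows "((\<lambda>r. - flux j 0 r - \<xi> * E (\<lambda>_. 1) j r) has_integral E (\<lambda>_. 1) j t - E (\<lambda>_. 1) j s) {s..t}"
proof -
  define a where "a m = inverse (real (Suc m))" for m
  have a: "a m > 0" "a m \<le> 1" for m by (auto simp: a_def inverse_le_1_iff)
  have a0: "a \<longlonglongrightarrow> 0" unfolding a_def by (rule LIMSEQ_inverse_real_of_nat)
  obtain K where K: "\<And>x r. x \<in> {0..1} \<Longrightarrow> r \<in> {s..t} \<Longrightarrow> \<bar>flux j x r\<bar> \<le> K"
  proof -
    have "continuous_on ({0..1} \<times> {s..t}) (\<lambda>(x, t). flux j x t)"
      by (rule continuous_on_subset[OF flux_cont[OF j]]) (use st in auto)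
    then have "compact ((\<lambda>(x, t). flux j x t) ` ({0..1} \<times> {s..t}))"
      by (intro compact_continuous_image compact_Times) auto
    then obtain K where "\<forall>y \<in> (\<lambda>(x, t). flux j x t) ` ({0..1} \<times> {s..t}). norm y \<le> K"
      using compact_imp_bounded bounded_iff by metis
    then show ?thesis by (intro that[of K]) auto
  qed
  show ?thesis
  proof (rule has_integral_dominated_convergence)
    show "((\<lambda>r. - flux j (a m) r - \<xi> * tail j (a m) r) has_integral tail j (a m) t - tail j (a m) s) {s..t}" for m
      by (rule tail_equation) (use a st j in auto)
    show "(\<lambda>_. K + \<xi> * 1) integrable_on {s..t}" by (rule integrable_const_ivl)
    show "\<forall>r\<in>{s..t}. norm (- flux j (a m) r - \<xi> * tail j (a m) r) \<le> K + \<xi> * 1" for m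
    proof
      fix r assume r: "r \<in> {s..t}"
      have "\<bar>\<xi> * tail j (a m) r\<bar> \<le> \<xi> * 1"
        unfolding abs_mult using par tail_le_1 by (intro mult_mono) auto
      then show "norm (- flux j (a m) r - \<xi> * tail j (a m) r) \<le> K + \<xi> * 1"
        using K[OF _ r, of "a m"] a[of m] by simp
    qed
    show "\<forall>r\<in>{s..t}. (\<lambda>m. - flux j (a m) r - \<xi> * tail j (a m) r) \<longlonglongrightarrow> - flux j 0 r - \<xi> * E (\<lambda>_. 1) j r"
    proof
      fix r assume r: "r \<in> {s..t}"
      have "continuous_on {0..} (\<lambda>x. flux j x r)"
        using cont_x(1)[OF flux_cont[OF j], of r 0] r st by simp
      then have "(\<lambda>m. flux j (a m) r) \<longlonglongrightarrow> flux j 0 r"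
        by (rule continuous_on_tendsto_compose[OF _ a0]) (use a(1) in \<open>auto intro!: always_eventually less_imp_le\<close>)
      then show "(\<lambda>m. - flux j (a m) r - \<xi> * tail j (a m) r) \<longlonglongrightarrow> - flux j 0 r - \<xi> * E (\<lambda>_. 1) j r"
        using tail_tendsto[OF _ j, of r, folded a_def] r st
        by (intro tendsto_diff tendsto_minus tendsto_mult tendsto_const) auto
    qed
    show "(\<lambda>m. tail j (a m) t - tail j (a m) s) \<longlonglongrightarrow> E (\<lambda>_. 1) j t - E (\<lambda>_. 1) j s"
      unfolding a_def by (intro tendsto_diff tail_tendsto j) (use st in auto)
  qed
qed

text \<open>A single phase may gain or lose mass through the vertex; only the sum over the phases is
  conserved. The summed equation has integral 0 over every \<open>{t..u}\<close> with
  \<open>u \<le> t + 1\<close>, and continuity yields the pointwise identity.\<close>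

lemma vertex_balance:
  assumes t: "t > 0"
  shows "(\<Sum>j=1..d. flux j 0 t) = - \<xi>"
proof -
  define g where "g r = - (\<Sum>j=1..d. flux j 0 r) - \<xi>" for r
  have "g t = 0"
  proof (rule integral_zero_imp_zero[of t "t + 1"])
    show "continuous_on {t..t + 1} g"
      unfolding g_def using cont_t[OF flux_cont, of _ t 0 "t + 1"] t
      by (intro continuous_intros) auto
    fix u assume u: "t \<le> u" "u \<le> t + 1"
    have "((\<lambda>r. \<Sum>j=1..d. - flux j 0 r - \<xi> * E (\<lambda>_. 1) j r) has_integral
        (\<Sum>j=1..d. E (\<lambda>_. 1) j u - E (\<lambda>_. 1) j t)) {t..u}"
      by (intro has_integral_sum flux_at_vertex) (use t u in auto)
    also have "(\<Sum>j=1..d. E (\<lambda>_. 1) j u - E (\<lambda>_. 1) j t) = 0"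
      unfolding sum_subtractf using sum_phases[of u] sum_phases[of t] t u by simp
    finally have "((\<lambda>r. \<Sum>j=1..d. - flux j 0 r - \<xi> * E (\<lambda>_. 1) j r) has_integral 0) {t..u}" .
    then have "(g has_integral 0) {t..u}"
    proof (rule has_integral_eq[rotated])
      fix r assume "r \<in> {t..u}"
      then have "(\<Sum>j=1..d. E (\<lambda>_. 1) j r) = 1" using t by (intro sum_phases) auto
      then show "(\<Sum>j=1..d. - flux j 0 r - \<xi> * E (\<lambda>_. 1) j r) = g r"
        by (simp add: g_def sum_subtractf sum_negf flip: sum_distrib_left)
    qed
    then show "integral {t..u} g = 0" by (rule integral_unique)
  qed simp
  then show ?thesis by (simp add: g_def)
qed

section \<open>The initial condition\<close>

lemma E_initial:
  assumes j: "j \<in> {1..d}" and g: "continuous_on UNIV g" "\<And>x. \<bar>g x\<bar> \<le> B"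
  shows "E g j 0 = (if j = l0 then g 0 else 0)"
proof -
  have "En n g j 0 = (if j = l0 then g 0 else 0)" for n
  proof -
    have "En n g j 0 = (\<Sum>y\<in>states d (N n). if y = (0, l0) then (if l0 = j then g 0 else 0) else 0)"
      unfolding En_sum[OF order_refl]
      by (intro sum.cong refl) (auto simp: markov_chain_start[OF chain])
    also have "\<dots> = (if j = l0 then g 0 else 0)"
      using l0 by (subst sum.delta[OF finite_states]) (auto simp: states_def)
    finally show ?thesis .
  qed
  then show ?thesis using En_tendsto[OF order_refl j g] by (simp add: LIMSEQ_const_iff)
qed

text \<open>The bounded continuous function \<open>min 1 \<bar>x\<bar>\<close> vanishes only at 0.
  Its mean over phase \<open>j\<close> at time 0 is 0, because every chain starts at level 0, so the
  limit sits at 0 almost surely on that phase.\<close>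

lemma initial_law:
  assumes j: "j \<in> {1..d}" and A: "A \<in> sets borel"
  shows "measure W {v \<in> space W. Z 0 v \<in> A \<and> J 0 v = j} = indicator A 0 * (if j = l0 then 1 else 0)"
proof -
  note [measurable] = Z_meas[OF order_refl] J_pred[OF order_refl] A
  define g where "g x = min 1 \<bar>x\<bar>" for x :: real
  have g: "continuous_on UNIV g" "\<And>x. \<bar>g x\<bar> \<le> 1" unfolding g_def by (auto intro!: continuous_intros)
  have gm: "g \<in> borel_measurable borel" by (rule borel_measurable_continuous_onI[OF g(1)])
  have "g 0 = 0" by (simp add: g_def)
  then have "E g j 0 = 0" using E_initial[OF j g] by simp
  then have "AE v in W. (if J 0 v = j then g (Z 0 v) else 0) = 0"
    unfolding E_def
    by (subst (asm) integral_nonneg_eq_0_iff_AE[OF E_integrable[OF gm order_refl g(2)]]) (auto simp: g_def)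
  then have ae: "AE v in W. J 0 v = j \<longrightarrow> Z 0 v = 0"
    by eventually_elim (auto simp: g_def min_def split: if_splits)
  have "measure W {v \<in> space W. J 0 v = j} = E (\<lambda>_. 1) j 0"
  proof -
    have "E (\<lambda>_. 1) j 0 = (LINT v|W. indicator {v \<in> space W. J 0 v = j} v)"
      unfolding E_def by (rule Bochner_Integration.integral_cong) (auto simp: indicator_def)
    then show ?thesis by (simp add: Int_def conj_commute)
  qed
  also have "\<dots> = (if j = l0 then 1 else 0)" by (rule E_initial[OF j, of _ 1]) auto
  finally have 1: "measure W {v \<in> space W. J 0 v = j} = (if j = l0 then 1 else 0)" .
  show ?thesis
  proof (cases "0 \<in> A")
    case True
    have "measure W {v \<in> space W. Z 0 v \<in> A \<and> J 0 v = j} = measure W {v \<in> space W. J 0 v = j}"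
      by (rule W.finite_measure_eq_AE) (use ae True in \<open>auto elim!: eventually_mono\<close>)
    then show ?thesis using 1 True by simp
  next
    case False
    have "measure W {v \<in> space W. Z 0 v \<in> A \<and> J 0 v = j} = measure W {}"
      by (rule W.finite_measure_eq_AE) (use ae False in \<open>auto elim!: eventually_mono\<close>)
    then show ?thesis using False by simp
  qed
qed

lemma f_initial:
  assumes j: "j \<in> {1..d}" and x: "x > 0"
  shows "f x j 0 = 0"
proof -
  have "((\<lambda>h. measure W {w \<in> space W. x \<le> Z 0 w \<and> Z 0 w < x + h \<and> J 0 w = j} / h) \<longlongrightarrow> f x j 0) (at_right 0)"
    using dens x j unfolding limit_density_def by auto
  moreover have "measure W {w \<in> space W. x \<le> Z 0 w \<and> Z 0 w < x + h \<and> J 0 w = j} = 0" for h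
    using initial_law[OF j, of "{x..<x + h}"] x by simp
  ultimately have "((\<lambda>h. 0) \<longlongrightarrow> f x j 0) (at_right (0::real))" by simp
  then show ?thesis by (simp add: tendsto_const_iff)
qed

text \<open>\<open>tail_equation\<close> from time 0 presents the tail as an indefinite integral in
  time, hence as continuous at 0, and its initial value is 0.\<close>

lemma tail_initial:
  assumes a: "a > 0" and j: "j \<in> {1..d}"
  shows "((\<lambda>t. tail j a t) \<longlongrightarrow> 0) (at_right 0)"
proof -
  have t0: "tail j a 0 = 0"
    using initial_law[OF j, of "{a<..}"] a by (simp add: tail_def)
  define q where "q r = - flux j a r - \<xi> * tail j a r" for r
  have q: "(q has_integral tail j a u) {0..u}" if "u \<ge> 0" for u
    using tail_equation[OF a order_refl that j] unfolding q_def t0 by simp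
  have "continuous_on {0..1} (\<lambda>u. integral {0..u} q)"
    by (rule indefinite_integral_continuous_1) (use q[of 1] in \<open>auto simp: integrable_on_def\<close>)
  then have "continuous_on {0..1} (\<lambda>u. tail j a u)"
    by (rule continuous_on_eq) (use q in \<open>auto simp: integral_unique\<close>)
  then have "((\<lambda>t. tail j a t) \<longlongrightarrow> tail j a 0) (at 0 within {0..1})"
    by (simp add: continuous_on_def)
  then show ?thesis by (simp add: t0 at_within_Icc_at_right)
qed

text \<open>Near the vertex \<open>g\<close> is small because \<open>g 0 = 0\<close>; away from it
  the mass vanishes by \<open>tail_initial\<close>.\<close>

lemma E_tendsto_initial:
  assumes j: "j \<in> {1..d}" and g: "continuous_on UNIV g" "\<And>x. \<bar>g x\<bar> \<le> B" "g 0 = 0"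
  shows "((\<lambda>t. E g j t) \<longlongrightarrow> 0) (at_right 0)"
proof (rule tendstoI)
  fix e :: real assume e: "e > 0"
  have B0: "B \<ge> 0" using g(2)[of 0] by linarith
  have gm: "g \<in> borel_measurable borel" by (rule borel_measurable_continuous_onI[OF g(1)])
  have "\<forall>\<^sub>F x in at (0::real). dist (g x) (g 0) < e / 2"
    using g(1) e by (intro tendstoD) (auto simp: continuous_on_def)
  then obtain \<delta> where \<delta>: "\<delta> > 0" "\<And>x. x \<noteq> 0 \<Longrightarrow> dist x 0 < \<delta> \<Longrightarrow> dist (g x) (g 0) < e / 2"
    unfolding eventually_at by auto
  have small: "\<bar>g x\<bar> \<le> e / 2" if "0 \<le> x" "x \<le> \<delta> / 2" for x
    using \<delta>(2)[of x] \<delta>(1) that g(3) e by (cases "x = 0") (auto simp: dist_real_def)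
  have "((\<lambda>t. tail j (\<delta> / 2) t) \<longlongrightarrow> 0) (at_right 0)" by (rule tail_initial) (use \<delta> j in auto)
  then have "\<forall>\<^sub>F t in at_right 0. tail j (\<delta> / 2) t < e / (2 * (B + 1))"
    using e B0 by (intro order_tendstoD) auto
  then show "\<forall>\<^sub>F t in at_right 0. dist (E g j t) 0 < e"
    using eventually_at_right_less[of "0::real"]
  proof eventually_elim
    case (elim t)
    then have t: "t \<ge> 0" by simp
    have "\<bar>E g j t\<bar> \<le> (LINT v|W. e / 2 + B * (if J t v = j then indicator {\<delta> / 2<..} (Z t v) else 0))"
    proof -
      have "\<bar>E g j t\<bar> \<le> (LINT v|W. \<bar>if J t v = j then g (Z t v) else 0\<bar>)"
        unfolding E_def real_norm_def[symmetric] by (rule integral_norm_bound)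
      also have "\<dots> \<le> (LINT v|W. e / 2 + B * (if J t v = j then indicator {\<delta> / 2<..} (Z t v) else 0))"
      proof (rule integral_mono)
      show "integrable W (\<lambda>v. \<bar>if J t v = j then g (Z t v) else 0\<bar>)"
        by (intro integrable_abs E_integrable[OF gm t g(2)])
      show "integrable W (\<lambda>v. e / 2 + B * (if J t v = j then indicator {\<delta> / 2<..} (Z t v) else 0))"
        by (intro Bochner_Integration.integrable_add integrable_mult_right E_integrable[where B = 1] t) auto
      show "\<bar>if J t v = j then g (Z t v) else 0\<bar> \<le> e / 2 + B * (if J t v = j then indicator {\<delta> / 2<..} (Z t v) else 0)"
        if "v \<in> space W" for v
        using small[of "Z t v"] Z_nonneg[OF t that] g(2)[of "Z t v"] e by (auto simp: indicator_def)
      qed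
      finally show ?thesis .
    qed
    also have "\<dots> = e / 2 + B * tail j (\<delta> / 2) t"
      unfolding tail_eq_E[OF t] E_def
      by (subst Bochner_Integration.integral_add)
         (auto intro!: integrable_mult_right E_integrable[where B = 1] t simp: W.prob_space)
    also have "B * tail j (\<delta> / 2) t \<le> B * (e / (2 * (B + 1)))"
      using elim B0 by (intro mult_left_mono) auto
    also have "\<dots> < e / 2" using e B0 by (simp add: field_simps)
    finally show ?case by (simp add: dist_real_def)
  qed
qed

text \<open>For a continuous function on the star graph, subtracting the common vertex value
  \<open>c\<close> leaves functions that are 0 at the vertex, whose means vanish on each ray
  separately. The constant contributes \<open>c\<close> times the total mass 1, however that mass is
  shared among the rays.\<close>

lemma initial_condition: "dirac_initial_condition d l0 W Z J f"
  unfolding dirac_initial_condition_def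
proof (intro conjI ballI allI impI)
  fix j A assume "j \<in> {1..d}" "A \<in> sets (borel :: real measure)"
  then show "measure W {w \<in> space W. Z 0 w \<in> A \<and> J 0 w = j} = measure (return borel 0) A * (if j = l0 then 1 else 0)"
    by (simp add: initial_law measure_return)
next
  fix j and x :: real assume "j \<in> {1..d}" "0 < x"
  then show "f x j 0 = 0" by (rule f_initial)
next
  fix \<phi> :: "nat \<Rightarrow> real \<Rightarrow> real" and c
  assume \<phi>: "\<forall>j\<in>{1..d}. continuous_on {0..} (\<phi> j) \<and> bounded (\<phi> j ` {0..}) \<and> \<phi> j 0 = c"
  \<comment> \<open>\<open>max 0 x\<close> extends the function continuously to the whole line, as
    required of test functions.\<close>
  define h where "h j x = \<phi> j (max 0 x) - c" for j x
  have hc: "continuous_on UNIV (h j)" if "j \<in> {1..d}" for j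
  proof -
    have "continuous_on UNIV (\<lambda>x. \<phi> j (max 0 x))"
      by (rule continuous_on_compose2[of "{0..}" "\<phi> j"]) (use \<phi> that in \<open>auto intro!: continuous_on_max continuous_on_const continuous_on_id\<close>)
    then show ?thesis unfolding h_def by (intro continuous_on_diff continuous_on_const)
  qed
  have hb: "\<exists>B. \<forall>x. \<bar>h j x\<bar> \<le> B" if j: "j \<in> {1..d}" for j
  proof -
    have "bounded (\<phi> j ` {0..})" using \<phi> j by simp
    then obtain B where "\<forall>y\<in>\<phi> j ` {0..}. norm y \<le> B" unfolding bounded_iff by (rule exE)
    then have "\<bar>h j x\<bar> \<le> B + \<bar>c\<bar>" for x
      unfolding h_def by (intro order_trans[OF abs_triangle_ineq4] add_mono) auto
    then show ?thesis by blast
  qed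
  have lim: "((\<lambda>t. \<Sum>j=1..d. E (h j) j t) \<longlongrightarrow> 0) (at_right 0)"
  proof (rule tendsto_null_sum)
    fix j assume j: "j \<in> {1..d}"
    obtain B where "\<And>x. \<bar>h j x\<bar> \<le> B" using hb[OF j] by blast
    then show "((\<lambda>t. E (h j) j t) \<longlongrightarrow> 0) (at_right 0)"
      by (rule E_tendsto_initial[OF j hc[OF j]]) (use \<phi> j in \<open>simp add: h_def\<close>)
  qed
  have eq: "(\<Sum>j=1..d. E (h j) j t) + c = (\<Sum>j\<in>{1..d}. LINT x:{0..}|lborel. \<phi> j x * f x j t)" if t: "t > 0" for t
  proof -
    have "(LINT x:{0..}|lborel. \<phi> j x * f x j t) = E (h j) j t + c * E (\<lambda>_. 1) j t" if j: "j \<in> {1..d}" for j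
    proof -
      obtain B where B: "\<And>x. \<bar>h j x\<bar> \<le> B" using hb[OF j] by blast
      have hm: "h j \<in> borel_measurable borel" by (rule borel_measurable_continuous_onI[OF hc[OF j]])
      have "E (\<lambda>x. h j x + c) j t = (LINT x|lborel. indicator {0..} x * f x j t * (h j x + c))"
        by (rule E_density(1)) (use t j hm in auto)
      also have "\<dots> = (LINT x:{0..}|lborel. \<phi> j x * f x j t)"
        unfolding set_lebesgue_integral_def
        by (rule Bochner_Integration.integral_cong) (auto simp: h_def indicator_def)
      finally have 1: "(LINT x:{0..}|lborel. \<phi> j x * f x j t) = E (\<lambda>x. h j x + c) j t" by simp
      have "E (\<lambda>x. h j x + c) j t = (LINT v|W. (if J t v = j then h j (Z t v) else 0) + c * (if J t v = j then 1 else 0))"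
        unfolding E_def by (rule Bochner_Integration.integral_cong) auto
      also have "\<dots> = E (h j) j t + c * E (\<lambda>_. 1) j t"
        unfolding E_def using t
        by (subst Bochner_Integration.integral_add)
           (auto intro!: E_integrable[OF hm _ B] E_integrable[where B = 1 and g = "\<lambda>_. 1"] integrable_mult_right)
      finally show ?thesis using 1 by simp
    qed
    then have "(\<Sum>j\<in>{1..d}. LINT x:{0..}|lborel. \<phi> j x * f x j t) = (\<Sum>j=1..d. E (h j) j t + c * E (\<lambda>_. 1) j t)"
      by simp
    also have "\<dots> = (\<Sum>j=1..d. E (h j) j t) + c"
      using sum_phases[of t] t by (simp add: sum.distrib flip: sum_distrib_left)
    finally show ?thesis by simp
  qed
  have "((\<lambda>t. (\<Sum>j=1..d. E (h j) j t) + c) \<longlongrightarrow> 0 + c) (at_right 0)"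
    by (intro tendsto_add lim tendsto_const)
  moreover have "\<forall>\<^sub>F t in at_right 0. (\<Sum>j=1..d. E (h j) j t) + c = (\<Sum>j\<in>{1..d}. LINT x:{0..}|lborel. \<phi> j x * f x j t)"
    using eventually_at_right_less[of "0::real"] by eventually_elim (rule eq)
  ultimately show "((\<lambda>t. \<Sum>j\<in>{1..d}. LINT x:{0..}|lborel. \<phi> j x * f x j t) \<longlongrightarrow> c) (at_right 0)"
    by (simp add: Lim_transform_eventually)
qed

end

section \<open>Balance of the phases and behaviour at infinity\<close>

text \<open>The closed sets on which all \<open>\<phi> n\<close> are bounded by \<open>k\<close>
  cover the interval as \<open>k\<close> varies, so by Baire's theorem one of them has interior
  points relative to the interval.\<close>

lemma pointwise_bounded_imp_bounded_on_subinterval: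
  fixes \<phi> :: "nat \<Rightarrow> real \<Rightarrow> real"
  assumes st: "s < t" and c: "\<And>n. continuous_on {s..t} (\<phi> n)"
    and b: "\<And>r. r \<in> {s..t} \<Longrightarrow> \<exists>K. \<forall>n. \<bar>\<phi> n r\<bar> \<le> K"
  shows "\<exists>s' t' K. s \<le> s' \<and> s' < t' \<and> t' \<le> t \<and> (\<forall>n. \<forall>r\<in>{s'..t'}. \<bar>\<phi> n r\<bar> \<le> K)"
proof -
  define A where "A k = {r \<in> {s..t}. \<forall>n. \<bar>\<phi> n r\<bar> \<le> real k}" for k :: nat
  have cl: "closed (A k)" for k
  proof -
    have "A k = (\<Inter>n. {r \<in> {s..t}. \<bar>\<phi> n r\<bar> \<le> real k})" by (auto simp: A_def)
    also have "closed \<dots>"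
      by (intro closed_INT ballI continuous_on_closed_Collect_le continuous_on_rabs c continuous_on_const closed_atLeastAtMost)
    finally show ?thesis .
  qed
  have "\<exists>k. \<not> {s..t} \<subseteq> closure ({s..t} - A k)"
  proof (rule ccontr)
    assume "\<not> ?thesis"
    then have dense: "{s..t} \<subseteq> closure ({s..t} - A k)" for k by blast
    have "{s..t} \<subseteq> closure (\<Inter>(range (\<lambda>k. {s..t} - A k)))"
    proof (rule Baire)
      fix T assume "T \<in> range (\<lambda>k. {s..t} - A k)"
      then obtain k where T: "T = {s..t} - A k" by auto
      have "openin (top_of_set {s..t}) ({s..t} - A k)"
        using cl[of k] by (intro openin_diff) (auto intro: closed_subset simp: A_def)
      then show "openin (top_of_set {s..t}) T \<and> {s..t} \<subseteq> closure T" unfolding T using dense by blast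
    qed auto
    moreover have empty: "\<Inter>(range (\<lambda>k. {s..t} - A k)) = {}"
    proof -
      have "\<exists>k. r \<in> A k" if r: "r \<in> {s..t}" for r
      proof -
        obtain K where K: "\<forall>n. \<bar>\<phi> n r\<bar> \<le> K" using b[OF r] by blast
        obtain k :: nat where "K \<le> real k" using real_arch_simple by blast
        then show ?thesis using K r by (auto simp: A_def intro: order_trans)
      qed
      then show ?thesis by auto
    qed
    ultimately have "{s..t} \<subseteq> {}" by (simp only: empty closure_empty)
    then show False using st by auto
  qed
  \<comment> \<open>A point outside the closure of the complement is interior to \<open>A k\<close>
    relative to \<open>{s..t}\<close>; half the radius gives a closed subinterval inside.\<close>
  then obtain k r where r: "r \<in> {s..t}" "r \<notin> closure ({s..t} - A k)" by blast
  then obtain e where e: "e > 0" "\<And>y. y \<in> {s..t} - A k \<Longrightarrow> \<not> dist y r < e"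
    unfolding closure_approachable by blast
  define s' where "s' = max s (r - e / 2)"
  define t' where "t' = min t (r + e / 2)"
  show ?thesis
  proof (intro exI conjI allI ballI)
    show "s \<le> s'" "t' \<le> t" by (auto simp: s'_def t'_def)
    show "s' < t'" using r e st by (auto simp: s'_def t'_def max_def min_def)
    fix n u assume u: "u \<in> {s'..t'}"
    then have "u \<in> {s..t}" "dist u r < e" using e(1) by (auto simp: s'_def t'_def dist_real_def)
    then have "u \<in> A k" using e(2)[of u] by blast
    then show "\<bar>\<phi> n u\<bar> \<le> real k" by (simp add: A_def)
  qed
qed

context star_density
begin

section \<open>Decay along the rays\<close>

lemma density_nonneg:
  assumes "t \<ge> 0" "x > 0" "j \<in> {1..d}"
  shows "f x j t \<ge> 0"
  using E_density(2)[where t = t and a = x and j = j and g = "\<lambda>_. 0" and x = x] assms by auto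

text \<open>\<open>level_tail_bound\<close> is scale-invariant: \<open>(k - m) * p\<close> equals
  \<open>(k * eps - m * eps) * (p / eps)\<close>, whose factors tend to \<open>x - \<beta>\<close>
  and \<open>f x j t\<close>.\<close>

lemma density_tail_bound:
  assumes t: "t \<ge> 0" and x: "x > \<gamma> * \<nu> / \<alpha>" "x > 0" and j: "j \<in> {1..d}"
  shows "(x - \<gamma> * \<nu> / \<alpha>) * f x j t \<le> 1"
proof -
  define k where "k n = nat \<lfloor>x / eps n\<rfloor>" for n
  \<comment> \<open>The least level allowed in \<open>level_tail_bound\<close>, since
    \<open>lam - mu = \<gamma> * eps\<close> and \<open>lam + mu = \<alpha>\<close>.\<close>
  define m where "m n = nat \<lceil>\<gamma> * eps n * real (N n) / \<alpha>\<rceil>" for n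
  define p where "p n = measure (M n) {w \<in> space (M n). X n t w = (k n, j)}" for n
  have klim: "(\<lambda>n. real (k n) * eps n) \<longlonglongrightarrow> x"
  proof -
    have "\<bar>real (k n) * eps n - x\<bar> \<le> eps n" for n
    proof -
      have "real (k n) = of_int \<lfloor>x / eps n\<rfloor>" using x eps_pos[of n] by (simp add: k_def)
      then have "real (k n) \<le> x / eps n" "x / eps n \<le> real (k n) + 1" by linarith+
      then show ?thesis using eps_pos[of n] by (simp add: field_simps abs_le_iff)
    qed
    then have "(\<lambda>n. real (k n) * eps n - x) \<longlonglongrightarrow> 0"
      by (intro tendsto_0_le[OF eps_0, of _ 1]) (use eps_pos in \<open>auto simp: less_imp_le\<close>)
    then show ?thesis by (simp add: LIM_zero_iff)
  qed
  have mlim: "(\<lambda>n. real (m n) * eps n) \<longlonglongrightarrow> \<gamma> * \<nu> / \<alpha>"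
  proof -
    have "\<bar>real (m n) * eps n - \<gamma> * (real (N n) * (eps n)\<^sup>2) / \<alpha>\<bar> \<le> eps n" for n
    proof -
      let ?y = "\<gamma> * eps n * real (N n) / \<alpha>"
      have "?y \<ge> 0" using par eps_pos[of n] by simp
      then have "real (m n) = of_int \<lceil>?y\<rceil>" by (simp add: m_def)
      then have "real (m n) \<le> ?y + 1" "?y \<le> real (m n)" by linarith+
      then have "real (m n) * eps n \<le> (?y + 1) * eps n" "?y * eps n \<le> real (m n) * eps n"
        using eps_pos[of n] by (auto intro!: mult_right_mono simp del: times_divide_eq_left)
      moreover have "?y * eps n = \<gamma> * (real (N n) * (eps n)\<^sup>2) / \<alpha>" by (simp add: power2_eq_square)
      moreover have "(?y + 1) * eps n = ?y * eps n + eps n" by (simp add: distrib_right)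
      ultimately show ?thesis using eps_pos[of n] unfolding abs_le_iff by linarith
    qed
    then have "(\<lambda>n. real (m n) * eps n - \<gamma> * (real (N n) * (eps n)\<^sup>2) / \<alpha>) \<longlonglongrightarrow> 0"
      by (intro tendsto_0_le[OF eps_0, of _ 1]) (use eps_pos in \<open>auto simp: less_imp_le\<close>)
    moreover have "(\<lambda>n. \<gamma> * (real (N n) * (eps n)\<^sup>2) / \<alpha>) \<longlonglongrightarrow> \<gamma> * \<nu> / \<alpha>"
      using par by (intro tendsto_intros N_eps2) auto
    ultimately show ?thesis using tendsto_add by fastforce
  qed
  have plim: "(\<lambda>n. p n / eps n) \<longlonglongrightarrow> f x j t"
    using dens t x j unfolding limit_density_def p_def k_def by auto
  have lim: "(\<lambda>n. (real (k n) * eps n - real (m n) * eps n) * (p n / eps n)) \<longlonglongrightarrow> (x - \<gamma> * \<nu> / \<alpha>) * f x j t"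
    by (intro tendsto_mult tendsto_diff klim mlim plim)
  have "\<forall>\<^sub>F n in sequentially. 0 < real (k n) * eps n - real (m n) * eps n"
    using x by (intro order_tendstoD(1)[OF tendsto_diff[OF klim mlim]]) auto
  then have "\<forall>\<^sub>F n in sequentially. (real (k n) * eps n - real (m n) * eps n) * (p n / eps n) \<le> 1"
  proof eventually_elim
    case (elim n)
    then have "0 < (real (k n) - real (m n)) * eps n" by (simp add: algebra_simps)
    then have mk: "m n \<le> k n" using eps_pos[of n] by (simp add: zero_less_mult_iff)
    have "(real (k n) - real (m n)) * p n \<le> 1"
      unfolding p_def
    proof (rule level_tail_bound[OF chain N_pos stoch t _ mu_pos _ _ mk j])
      have "\<gamma> * eps n * real (N n) / \<alpha> \<le> real (m n)" unfolding m_def by (rule real_nat_ceiling_ge)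
      then show "(\<alpha> / 2 + \<gamma> / 2 * eps n - (\<alpha> / 2 - \<gamma> / 2 * eps n)) * real (N n)
          \<le> (\<alpha> / 2 + \<gamma> / 2 * eps n + (\<alpha> / 2 - \<gamma> / 2 * eps n)) * real (m n)"
        using par by (simp add: field_simps)
      show "0 \<le> \<alpha> / 2 + \<gamma> / 2 * eps n" using par eps_pos[of n] by simp
      show "0 \<le> \<xi>" using par by simp
    qed
    moreover have "(real (k n) * eps n - real (m n) * eps n) * (p n / eps n) = (real (k n) - real (m n)) * p n"
      using eps_pos[of n] by (simp add: field_simps)
    ultimately show ?case by simp
  qed
  then show ?thesis by (rule tendsto_upperbound[OF lim]) simp
qed

lemma density_at_infinity:
  assumes t: "t \<ge> 0" and j: "j \<in> {1..d}"
  shows "((\<lambda>x. f x j t) \<longlongrightarrow> 0) at_top"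
proof (rule tendsto_sandwich[where f = "\<lambda>_. 0"])
  show "((\<lambda>x. 1 / (x - \<gamma> * \<nu> / \<alpha>)) \<longlongrightarrow> 0) at_top"
  proof (intro tendsto_divide_0[OF tendsto_const] filterlim_at_top_imp_at_infinity)
    show "LIM x at_top. x - \<gamma> * \<nu> / \<alpha> :> at_top"
      using filterlim_tendsto_add_at_top[OF tendsto_const filterlim_ident, of "- (\<gamma> * \<nu> / \<alpha>)"] by simp
  qed
  show "\<forall>\<^sub>F x in at_top. f x j t \<le> 1 / (x - \<gamma> * \<nu> / \<alpha>)"
    using eventually_gt_at_top[of "\<gamma> * \<nu> / \<alpha>"] eventually_gt_at_top[of "0::real"]
  proof eventually_elim
    case (elim x)
    then show ?case using density_tail_bound[OF t elim j] by (subst pos_le_divide_eq) (auto simp: mult.commute)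
  qed
  show "\<forall>\<^sub>F x in at_top. 0 \<le> f x j t"
    by (rule eventually_mono[OF eventually_gt_at_top[of "0::real"]]) (rule density_nonneg[OF t _ j])
qed auto

text \<open>
  The phase changes only in jumps out of level 0, at total rate \<open>lam * N\<close>, which is of larger order than
  \<open>1 / eps\<close>; since probabilities are bounded, the scaled net phase flow must vanish in the limit.
\<close>
lemma phase_balance_integral:
  assumes st: "0 \<le> s" "s \<le> t" and j: "j \<in> {1..d}"
  defines "p \<equiv> \<lambda>n l r. measure (M n) {w \<in> space (M n). X n r w = (0, l)}"
  shows "\<exists>I. ((\<lambda>r. \<Sum>l=1..d. (C l j - (if l = j then 1 else 0)) * (p n l r / eps n)) has_integral I) {s..t}
     \<and> \<bar>I\<bar> \<le> 1 / (\<alpha> / 2 * (real (N n) * eps n))"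
proof -
  define lam where "lam = \<alpha> / 2 + \<gamma> / 2 * eps n"
  define \<psi> where "\<psi> y = (if snd y = j then 1 else 0 :: real)" for y :: "nat \<times> nat"
  define P where "P y r = measure (M n) {w \<in> space (M n). X n r w = y}" for y r
  define u where "u r = (\<Sum>y\<in>states d (N n). \<psi> y * P y r)" for r
  define Q where "Q r = (\<Sum>l=1..d. (C l j - (if l = j then 1 else 0)) * p n l r)" for r
  have lam: "lam > 0" "lam \<ge> \<alpha> / 2" using par eps_pos[of n] by (auto simp: lam_def add_pos_pos)
  have du: "(u has_real_derivative lam * real (N n) * Q r) (at r within {0..})" if r: "r \<ge> 0" for r
  proof -
    define R where "R = rate (N n) C lam (\<alpha> / 2 - \<gamma> / 2 * eps n) \<xi>"
    \<comment> \<open>Above level 0 every transition keeps the phase, so the generator of the phase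
      indicator lives on level 0 alone.\<close>
    have gen: "(\<Sum>y\<in>states d (N n). R (k, l) y * (\<psi> y - \<psi> (k, l))) =
        (if k = 0 then lam * real (N n) * (C l j - (if l = j then 1 else 0)) else 0)"
      if "l \<in> {1..d}" "k \<le> N n" for k l
    proof -
      have "(\<Sum>m=1..d. C l m * (\<psi> (1, m) - \<psi> (0, l))) = (\<Sum>m=1..d. (if m = j then C l j else 0) - C l m * (if l = j then 1 else 0))"
        by (intro sum.cong) (auto simp: \<psi>_def)
      also have "\<dots> = C l j - (if l = j then 1 else 0)"
        using j stoch that(1) unfolding stochastic_matrix_def
        by (simp add: sum_subtractf sum.delta flip: sum_distrib_right)
      finally have eq: "(\<Sum>m=1..d. C l m * (\<psi> (1, m) - \<psi> (0, l))) = C l j - (if l = j then 1 else 0)" .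
      show ?thesis unfolding R_def sum_rate[OF that N_pos] eq by (simp add: \<psi>_def)
    qed
    have "(\<Sum>z\<in>states d (N n). P z r * (\<Sum>y\<in>states d (N n). R z y * (\<psi> y - \<psi> z))) =
       (\<Sum>(k, l)\<in>states d (N n). P (k, l) r * (if k = 0 then lam * real (N n) * (C l j - (if l = j then 1 else 0)) else 0))"
    proof (rule sum.cong)
      fix z assume "z \<in> states d (N n)"
      then obtain k l where z: "z = (k, l)" "l \<in> {1..d}" "k \<le> N n" by (auto simp: states_def)
      show "P z r * (\<Sum>y\<in>states d (N n). R z y * (\<psi> y - \<psi> z)) =
        (case z of (k, l) \<Rightarrow> P (k, l) r * (if k = 0 then lam * real (N n) * (C l j - (if l = j then 1 else 0)) else 0))"
        unfolding z(1) gen[OF z(2,3)] by simp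
    qed simp
    also have "\<dots> = (\<Sum>k=0..N n. \<Sum>l=1..d. P (k, l) r * (if k = 0 then lam * real (N n) * (C l j - (if l = j then 1 else 0)) else 0))"
      unfolding states_def by (rule sum.cartesian_product[symmetric])
    also have "\<dots> = (\<Sum>k=0..N n. if k = 0 then lam * real (N n) * Q r else 0)"
      by (intro sum.cong) (auto simp: Q_def P_def p_def sum_distrib_left mult_ac)
    also have "\<dots> = lam * real (N n) * Q r" by (simp add: sum.delta)
    finally show ?thesis
      using markov_chain_forward[OF chain[of n] r, of \<psi>] unfolding u_def P_def R_def lam_def by simp
  qed
  have "((\<lambda>r. lam * real (N n) * Q r) has_integral u t - u s) {s..t}"
  proof (rule fundamental_theorem_of_calculus[OF st(2)])
    fix r assume "r \<in> {s..t}"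
    then have "(u has_real_derivative lam * real (N n) * Q r) (at r within {s..t})"
      by (intro DERIV_subset[OF du]) (use st in auto)
    then show "(u has_vector_derivative lam * real (N n) * Q r) (at r within {s..t})"
      by (simp add: has_real_derivative_iff_has_vector_derivative)
  qed
  \<comment> \<open>The probability \<open>u\<close> of phase \<open>j\<close> changes by at most 1
    over any time. Dividing its large rate \<open>lam * N\<close> out and scaling by
    \<open>eps\<close> leaves an integral of size at most
    \<open>1 / (lam * N * eps)\<close>.\<close>
  from has_integral_mult_right[OF this, of "1 / (lam * real (N n) * eps n)"]
  have "((\<lambda>r. Q r / eps n) has_integral (u t - u s) / (lam * (real (N n) * eps n))) {s..t}"
    using lam(1) N_pos[of n] eps_pos[of n] by (simp add: field_simps)
  moreover have "\<bar>(u t - u s) / (lam * (real (N n) * eps n))\<bar> \<le> 1 / (\<alpha> / 2 * (real (N n) * eps n))"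
  proof -
    have "0 \<le> u r \<and> u r \<le> 1" if "r \<ge> 0" for r
    proof -
      have "u r \<le> (\<Sum>y\<in>states d (N n). P y r)"
        unfolding u_def by (intro sum_mono) (simp add: \<psi>_def P_def)
      also have "\<dots> = 1" unfolding P_def by (rule markov_chain_prob_sum[OF chain finite_states that])
      finally show ?thesis by (simp add: u_def \<psi>_def P_def sum_nonneg)
    qed
    from this[of s] this[of t] have "\<bar>u t - u s\<bar> \<le> 1" using st by auto
    moreover have "\<alpha> / 2 * (real (N n) * eps n) \<le> lam * (real (N n) * eps n)"
      using lam eps_pos[of n] by (intro mult_right_mono) auto
    moreover have "0 < \<alpha> / 2 * (real (N n) * eps n)" using par eps_pos[of n] N_pos[of n] by simp
    ultimately show ?thesis unfolding abs_divide
      by (intro frac_le) auto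
  qed
  ultimately show ?thesis unfolding Q_def by (auto simp: sum_divide_distrib)
qed

lemma phase_continuous:
  assumes "j \<in> {1..d}" "t \<ge> 0"
  shows "continuous_on {t..u} (\<lambda>r. measure (M n) {w \<in> space (M n). X n r w = (0, j)})"
proof -
  have y: "(0, j) \<in> states d (N n)" using assms by (simp add: states_def)
  have eq: "(\<Sum>y\<in>states d (N n). (if y = (0, j) then 1 else 0) * measure (M n) {w \<in> space (M n). X n r w = y}) =
      measure (M n) {w \<in> space (M n). X n r w = (0, j)}" for r
    using y by (simp add: finite_states if_distrib[of "\<lambda>c. c * _"] cong: if_cong)
  have "continuous_on {0..} (\<lambda>r. \<Sum>y\<in>states d (N n). (if y = (0, j) then 1 else 0) * measure (M n) {w \<in> space (M n). X n r w = y})"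
    by (rule DERIV_continuous_on, rule markov_chain_forward[OF chain]) simp
  then show ?thesis unfolding eq by (rule continuous_on_subset) (use assms in auto)
qed

text \<open>
  The densities converge only pointwise; by the Baire category theorem the convergence is dominated on
  some subinterval of every interval, which suffices by continuity of the limit.
\<close>
lemma vertex_phases:
  assumes t: "t > 0" and j: "j \<in> {1..d}"
  shows "f 0 j t = (\<Sum>l=1..d. C l j * f 0 l t)"
proof -
  define c where "c l = C l j - (if l = j then 1 else 0)" for l
  define p where "p n l r = measure (M n) {w \<in> space (M n). X n r w = (0, l)}" for n l r
  define \<phi> where "\<phi> n r = (\<Sum>l=1..d. c l * (p n l r / eps n))" for n r
  define g where "g r = (\<Sum>l=1..d. c l * f 0 l r)" for r
  have plim: "(\<lambda>n. p n l r / eps n) \<longlonglongrightarrow> f 0 l r" if "r > 0" "l \<in> {1..d}" for l r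
    using dens that unfolding limit_density_def p_def by force
  have lim: "(\<lambda>n. \<phi> n r) \<longlonglongrightarrow> g r" if "r > 0" for r
    unfolding \<phi>_def g_def by (intro tendsto_intros plim that)
  have \<phi>c: "continuous_on {s..u} (\<phi> n)" if "s \<ge> 0" for s u n
    unfolding \<phi>_def p_def using that by (intro continuous_intros phase_continuous) (use eps_pos[of n] in auto)
  have gc: "continuous_on {s..u} g" if "s > 0" for s u
    unfolding g_def using cont_t[OF f_cont(1), of _ s 0 u] that by (intro continuous_intros) auto
  have int: "\<exists>I. (\<phi> n has_integral I) {s..u} \<and> \<bar>I\<bar> \<le> 1 / (\<alpha> / 2 * (real (N n) * eps n))" if "0 \<le> s" "s \<le> u" for s u n
    using phase_balance_integral[OF that j, of n] unfolding \<phi>_def c_def p_def .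
  \<comment> \<open>This is where \<open>N * eps\<close> tending to infinity is used.\<close>
  have small: "(\<lambda>n. 1 / (\<alpha> / 2 * (real (N n) * eps n))) \<longlonglongrightarrow> 0"
    using par by (intro tendsto_divide_0[OF tendsto_const] filterlim_at_top_imp_at_infinity
      filterlim_tendsto_pos_mult_at_top[OF tendsto_const _ N_eps]) auto
  \<comment> \<open>Domination is known only on an unspecified subinterval, so \<open>g\<close> is
    first shown to vanish somewhere in each interval; continuity of \<open>g\<close> then gives
    \<open>g t = 0\<close>.\<close>
  have zero: "\<exists>r\<in>{s..u}. g r = 0" if su: "0 < s" "s < u" for s u
  proof -
    have "\<exists>s' u' K. s \<le> s' \<and> s' < u' \<and> u' \<le> u \<and> (\<forall>n. \<forall>r\<in>{s'..u'}. \<bar>\<phi> n r\<bar> \<le> K)"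
    proof (rule pointwise_bounded_imp_bounded_on_subinterval[OF su(2), of \<phi>])
      show "continuous_on {s..u} (\<phi> n)" for n by (rule \<phi>c) (use su in auto)
      fix r assume "r \<in> {s..u}"
      then have "convergent (\<lambda>n. \<phi> n r)" using lim[of r] su by (auto simp: convergent_def)
      then have "Bseq (\<lambda>n. \<phi> n r)" by (rule convergent_imp_Bseq)
      then show "\<exists>K. \<forall>n. \<bar>\<phi> n r\<bar> \<le> K" by (auto simp: Bseq_def)
    qed
    then obtain s' u' K where su': "s \<le> s'" "s' < u'" "u' \<le> u" and K: "\<And>n r. r \<in> {s'..u'} \<Longrightarrow> \<bar>\<phi> n r\<bar> \<le> K"
      by blast
    have "g s' = 0"
    proof (rule integral_zero_imp_zero[OF su'(2) gc])
      fix v assume v: "s' \<le> v" "v \<le> u'"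
      have int': "(\<phi> n has_integral integral {s'..v} (\<phi> n)) {s'..v}"
        "\<bar>integral {s'..v} (\<phi> n)\<bar> \<le> 1 / (\<alpha> / 2 * (real (N n) * eps n))" for n
        using int[of s' v n] su su' v by (auto simp: integral_unique)
      have "(\<lambda>n. integral {s'..v} (\<phi> n)) \<longlonglongrightarrow> integral {s'..v} g"
      proof (rule dominated_convergence(2))
        show "\<phi> n integrable_on {s'..v}" for n using int'(1) by (rule has_integral_integrable)
        show "(\<lambda>_. K) integrable_on {s'..v}" by (rule integrable_const_ivl)
        show "norm (\<phi> n r) \<le> K" if "r \<in> {s'..v}" for n r using K[of r n] that v by simp
        show "(\<lambda>n. \<phi> n r) \<longlonglongrightarrow> g r" if "r \<in> {s'..v}" for r using lim[of r] that su su' by simp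
      qed
      moreover have "(\<lambda>n. integral {s'..v} (\<phi> n)) \<longlonglongrightarrow> 0"
        by (rule tendsto_0_le[OF small, of _ 1]) (auto simp only: real_norm_def mult_1_right intro!: always_eventually order_trans[OF int'(2) abs_ge_self])
      ultimately show "integral {s'..v} g = 0" by (rule LIMSEQ_unique)
    qed (use su su' in auto)
    then show ?thesis using su' by auto
  qed
  have "g t = 0"
  proof (rule ccontr)
    assume gt: "g t \<noteq> 0"
    have "\<exists>e>0. \<forall>r\<in>{t..t + 1}. dist r t < e \<longrightarrow> dist (g r) (g t) < \<bar>g t\<bar>"
      using gc[OF t, of "t + 1", unfolded continuous_on_iff, rule_format, of t "\<bar>g t\<bar>"] gt by auto
    then obtain e where e: "e > 0" "\<And>r. r \<in> {t..t + 1} \<Longrightarrow> dist r t < e \<Longrightarrow> dist (g r) (g t) < \<bar>g t\<bar>"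
      by blast
    obtain r where r: "r \<in> {t..t + min 1 (e / 2)}" "g r = 0"
      using zero[of t "t + min 1 (e / 2)"] t e(1) by auto
    then have "dist (g r) (g t) < \<bar>g t\<bar>" using e by (intro e(2)) (auto simp: dist_real_def)
    then show False using r by (simp add: dist_real_def)
  qed
  moreover have "g t = (\<Sum>l=1..d. C l j * f 0 l t) - f 0 j t"
  proof -
    have "g t = (\<Sum>l=1..d. C l j * f 0 l t - (if l = j then f 0 j t else 0))"
      unfolding g_def c_def by (intro sum.cong) (auto simp: algebra_simps)
    then show ?thesis using j by (simp add: sum_subtractf sum.delta)
  qed
  ultimately show ?thesis by simp
qed

end

theorem proposition5p1:
  fixes d l0 :: nat
    and C :: "nat \<Rightarrow> nat \<Rightarrow> real"
    and \<alpha> \<gamma> \<xi> \<nu> \<sigma> \<beta> :: real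
    and eps :: "nat \<Rightarrow> real"
    and N :: "nat \<Rightarrow> nat"
    and M :: "nat \<Rightarrow> 'w measure"
    and X :: "nat \<Rightarrow> real \<Rightarrow> 'w \<Rightarrow> nat \<times> nat"
    and W :: "'v measure"
    and Z :: "real \<Rightarrow> 'v \<Rightarrow> real"
    and J :: "real \<Rightarrow> 'v \<Rightarrow> nat"
    and f :: "real \<Rightarrow> nat \<Rightarrow> real \<Rightarrow> real"
  assumes "\<alpha> > 0" and "\<gamma> > 0" and "\<xi> > 0" and "\<nu> > 0"
    and "l0 \<in> {1..d}"
    and "stochastic_matrix d C" and "irreducible_matrix d C"
    and "\<And>n. N n > 0" and "\<And>n. eps n > 0" and "\<And>n. \<alpha> / 2 - \<gamma> / 2 * eps n > 0"
    and "eps \<longlonglongrightarrow> 0"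
    and "filterlim N at_top sequentially"
    and "filterlim (\<lambda>n. real (N n) * eps n) at_top sequentially"
    and "(\<lambda>n. real (N n) * (eps n)\<^sup>2) \<longlonglongrightarrow> \<nu>"
    and "\<And>n. markov_chain (M n) (X n) (states d (N n))
           (rate (N n) C (\<alpha> / 2 + \<gamma> / 2 * eps n) (\<alpha> / 2 - \<gamma> / 2 * eps n) \<xi>) (0, l0)"
    and "prob_space W"
    and "\<And>t. t \<ge> 0 \<Longrightarrow> Z t \<in> borel_measurable W"
    and "\<And>t. t \<ge> 0 \<Longrightarrow> J t \<in> W \<rightarrow>\<^sub>M count_space {1..d}"
    and "\<And>t w. t \<ge> 0 \<Longrightarrow> w \<in> space W \<Longrightarrow> Z t w \<ge> 0"
    and "tends_in_law d eps M X W Z J"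
    and "limit_density d eps M X W Z J f"
    and "smooth_on_rays d f"
    and "\<sigma>\<^sup>2 = \<alpha> * \<nu>" and "\<beta> = \<gamma> * \<nu> / \<alpha>"
  shows "(\<forall>x>0. \<forall>t\<ge>0. \<forall>j\<in>{1..d}.
            hderiv (\<lambda>s. f x j s) t =
              - hderiv (\<lambda>y. (- \<alpha> * (y - \<beta>)) * f y j t) x
              + 1 / 2 * \<sigma>\<^sup>2 * hderiv (hderiv (\<lambda>y. f y j t)) x
              - \<xi> * f x j t) \<and>
         dirac_initial_condition d l0 W Z J f \<and>
         (\<forall>t>0. (\<Sum>l\<in>{1..d}. \<alpha> * \<beta> * f 0 l t - \<sigma>\<^sup>2 / 2 * hderiv (\<lambda>x. f x l t) 0) - \<xi> = 0) \<and>
         (\<forall>t>0. \<forall>j\<in>{1..d}. f 0 j t = (\<Sum>l\<in>{1..d}. C l j * f 0 l t)) \<and>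
         (\<forall>t\<ge>0. \<forall>j\<in>{1..d}. ((\<lambda>x. f x j t) \<longlongrightarrow> 0) at_top)"
proof -
  interpret star_density d l0 C \<alpha> \<gamma> \<xi> \<nu> eps N M X W Z J f
    by (intro star_density.intro star_limit.intro star_density_axioms.intro assms)
  note sq = assms(23) and \<beta> = assms(24)
  have \<alpha>\<beta>: "\<alpha> * \<beta> = \<gamma> * \<nu>" using \<open>\<alpha> > 0\<close> by (simp add: \<beta>)
  have eq: "hderiv (\<lambda>s. f x j s) t =
              - hderiv (\<lambda>y. (- \<alpha> * (y - \<beta>)) * f y j t) x
              + 1 / 2 * \<sigma>\<^sup>2 * hderiv (hderiv (\<lambda>y. f y j t)) x
              - \<xi> * f x j t" if "x > 0" "t \<ge> 0" "j \<in> {1..d}" for x t j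
  proof -
    have d: "((\<lambda>y. f y j t) has_real_derivative fx j t x) (at x within {0..})"
      by (rule f_derivs(1)) (use that in auto)
    have "((\<lambda>y. (- \<alpha> * (y - \<beta>)) * f y j t) has_real_derivative
        - \<alpha> * f x j t + (- \<alpha> * (x - \<beta>)) * fx j t x) (at x within {0..})"
      by (auto intro!: derivative_eq_intros d)
    then have "hderiv (\<lambda>y. (- \<alpha> * (y - \<beta>)) * f y j t) x = - \<alpha> * f x j t + (- \<alpha> * (x - \<beta>)) * fx j t x"
      by (rule hderiv_eqI[rotated]) (use that in simp)
    also have "\<dots> = - \<alpha> * f x j t - (\<alpha> * x - \<gamma> * \<nu>) * fx j t x"
      unfolding \<alpha>\<beta>[symmetric] by (simp add: algebra_simps)
    finally show ?thesis
      using pde[OF that(2,1,3)] by (simp add: ft_def fxx_def sq)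
  qed
  have bc: "(\<Sum>l\<in>{1..d}. \<alpha> * \<beta> * f 0 l t - \<sigma>\<^sup>2 / 2 * hderiv (\<lambda>x. f x l t) 0) - \<xi> = 0" if "t > 0" for t
  proof -
    have "(\<Sum>l\<in>{1..d}. \<alpha> * \<beta> * f 0 l t - \<sigma>\<^sup>2 / 2 * hderiv (\<lambda>x. f x l t) 0) = - (\<Sum>l\<in>{1..d}. flux l 0 t)"
      unfolding flux_def \<alpha>\<beta> sq sum_negf[symmetric] by (intro sum.cong) (auto simp: fx_def)
    then show ?thesis using vertex_balance[OF that] by simp
  qed
  show ?thesis
    using eq bc initial_condition vertex_phases density_at_infinity by blast
qed

end
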